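(* Let $\{p_k\}_{k\ge 1}$ be a Beurling generalized prime number system with generalized prime counting function $\pi$ and generalized integer counting function $N$. Then $$\pi(x)=\operatorname{Li}(x)+O_n\!\left(\frac{x}{\log^n x}\right)\quad\text{for all } n\in\mathbb{N}$$ holds if and only if there is some $a>0$ such that $$N(x)=ax+O_n\!\left(\frac{x}{\log^n x}\right)\quad\text{for all } n\in\mathbb{N}.$$
   Context: A (Beurling) generalized prime number system is a real sequence $\{p_k\}_{k\ge 1}$ with $1<p_1\le p_2\le\dots\le p_k\to\infty$. The generalized integers are the elements of the multiplicative semigroup (with $1$) generated by the $p_k$, counted with multiplicity (that is, each finite formal product $\prod_k p_k^{m_k}$, with $m_k\ge 0$ integers almost all zero, contributes one generalized integer), arranged in a non-decreasing sequence $1=n_0<n_1\le n_2\le\dots\to\infty$. The counting functions are $\pi(x)=\sum_{p_k\le x}1$ and $N(x)=\sum_{n_k\le x}1$. $\operatorname{Li}$ denotes the logarithmic integral, e.g. $\operatorname{Li}(x)=\int_2^x \frac{du}{\log u}$ (additive constants are irrelevant). All $O$-estimates are understood for $x$ sufficiently large, and the implied constants may depend on $n$. *)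

theory Defs
  imports "HOL-Analysis.Analysis" "HOL-Library.Landau_Symbols"
begin

text \<open>Indices start at 0: \<open>p 0\<close> is the smallest generalized prime.\<close>

definition gen_prime_system :: "(nat \<Rightarrow> real) \<Rightarrow> bool" where
  "gen_prime_system p \<longleftrightarrow> 1 < p 0 \<and> mono p \<and> filterlim p at_top sequentially"

definition gen_prime_count :: "(nat \<Rightarrow> real) \<Rightarrow> real \<Rightarrow> nat" where
  "gen_prime_count p x = card {k. p k \<le> x}"

text \<open>
  A generalized integer is indexed by its finitely supported exponent sequence \<open>m\<close>, so that
  distinct formal products with equal real values are counted separately; \<open>m = 0\<close> gives 1.
\<close>

definition exponents :: "(nat \<Rightarrow> nat) set" where
  "exponents = {m. finite {k. m k \<noteq> 0}}"

definition gen_integer :: "(nat \<Rightarrow> real) \<Rightarrow> (nat \<Rightarrow> nat) \<Rightarrow> real" where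
  "gen_integer p m = (\<Prod>k | m k \<noteq> 0. p k ^ m k)"

definition gen_integer_count :: "(nat \<Rightarrow> real) \<Rightarrow> real \<Rightarrow> nat" where
  "gen_integer_count p x = card {m \<in> exponents. gen_integer p m \<le> x}"

definition Li :: "real \<Rightarrow> real" where
  "Li x = integral {2..x} (\<lambda>u. 1 / ln u)"

text \<open>Both counting functions take the cardinality of finite sets.\<close>

lemma finite_gen_primes_le:
  assumes "gen_prime_system p"
  shows "finite {k. p k \<le> x}"
proof -
  have "eventually (\<lambda>k. p k > x) sequentially"
    using assms unfolding gen_prime_system_def filterlim_at_top_dense by blast
  then obtain n where n: "\<And>k. k \<ge> n \<Longrightarrow> p k > x"
    unfolding eventually_sequentially by blast
  have "{k. p k \<le> x} \<subseteq> {..<n}"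
    using n by (auto simp: not_le[symmetric] intro: ccontr)
  then show ?thesis
    using finite_subset by blast
qed

lemma finite_gen_integers_le:
  assumes "gen_prime_system p"
  shows "finite {m \<in> exponents. gen_integer p m \<le> x}"
proof -
  have p0: "p 0 > 1" and mono: "\<And>k. p 0 \<le> p k"
    using assms unfolding gen_prime_system_def by (auto intro: monoD)
  then have p1: "p k > 1" for k
    using less_le_trans by blast
  obtain B where B: "x < p 0 ^ B"
    using real_arch_pow[OF p0] by blast
  define K where "K = {k. p k \<le> x}"
  have factor: "p k ^ m k \<le> x"
    if m: "m \<in> exponents" "gen_integer p m \<le> x" and k: "m k \<noteq> 0" for m k
  proof -
    have fin: "finite {k. m k \<noteq> 0}"
      using m by (simp add: exponents_def)
    have "(\<Prod>j\<in>{k}. p j ^ m j) \<le> (\<Prod>j | m j \<noteq> 0. p j ^ m j)"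
      by (rule prod_mono2[OF fin])
         (use k p1 in \<open>auto intro: one_le_power less_imp_le order_trans[OF zero_le_one]\<close>)
    then show ?thesis
      using m by (simp add: gen_integer_def)
  qed
  have "{m \<in> exponents. gen_integer p m \<le> x}
          \<subseteq> {m. \<forall>k. (k \<in> K \<longrightarrow> m k \<in> {..B}) \<and> (k \<notin> K \<longrightarrow> m k = 0)}"
  proof (intro subsetI CollectI allI conjI impI)
    fix m k
    assume m: "m \<in> {m \<in> exponents. gen_integer p m \<le> x}"
    show "m k \<in> {..B}"
    proof (cases "m k = 0")
      case False
      have "p 0 ^ m k \<le> p k ^ m k"
        using p0 mono by (intro power_mono) auto
      also have "\<dots> \<le> x"
        using factor m False by blast
      also have "\<dots> < p 0 ^ B"
        by (fact B)
      finally show ?thesis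
        using p0 by simp
    qed simp
    show "m k = 0" if "k \<notin> K"
    proof (rule ccontr)
      assume k: "m k \<noteq> 0"
      have "p k \<le> p k ^ m k"
        using p1[of k] k by (intro self_le_power) auto
      also have "\<dots> \<le> x"
        using factor m k by blast
      finally show False
        using that by (simp add: K_def)
    qed
  qed
  moreover have "finite {m. \<forall>k. (k \<in> K \<longrightarrow> m k \<in> {..B}) \<and> (k \<notin> K \<longrightarrow> m k = (0::nat))}"
    using finite_gen_primes_le[OF assms] by (intro finite_set_of_finite_funs) (auto simp: K_def)
  ultimately show ?thesis
    by (rule finite_subset)
qed

end

theory Submission
  imports Defs "HOL-Complex_Analysis.Complex_Analysis" "HOL-Probability.Sinc_Integral"
    "HOL-Real_Asymp.Real_Asymp"
begin

text \<open>
  The two counting functions are compared through their Dirichlet series, and the theorem holds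
  because, for a series with nonnegative coefficients, an asymptotic formula with an error smaller
  than every power of the logarithm is \<^emph>\<open>equivalent\<close> to a growth condition on the series at the line
  \<open>Re s = 1\<close>. That growth condition can be carried from \<open>zeta\<close> to its logarithmic derivative and
  back.

  Write \<open>z = s - 1\<close>. For a series \<open>D\<close> with nonnegative coefficients and summatory function \<open>S(u)\<close>
  in the logarithmic variable, put \<open>h(z) = z / (1 + z) * D(1 + z)\<close>; the factor removes a simple pole
  at \<open>s = 1\<close>. Call a holomorphic function on \<open>Re z > 0\<close> slow if each of its derivatives is
  \<open>O((1 + |Im z|) powr e)\<close> on the strip \<open>0 < Re z < 1\<close>, for every \<open>e > 0\<close>. Then
  \<open>S(u) exp(-u) - a\<close> is \<open>O(u powr -n)\<close> for all \<open>n\<close> if and only if \<open>h\<close> is slow and tends to \<open>a\<close> at \<open>0\<close>.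

  \<^item> The Abelian half (\<open>abelian\<close>) starts from \<open>h(z) - a = z * F(z)\<close>, where \<open>F\<close> is the Laplace transform
    of the remainder and has bounded derivatives. This gives linear growth only. But nonnegativity
    gives \<open>|D(1 + z)| \<le> D(1 + Re z) = O(1 / Re z)\<close>, and interpolating the two bounds
    (\<open>slow_of_linear_growth\<close>) brings the exponent down to an arbitrary \<open>e\<close>.
  \<^item> The Tauberian half (\<open>tauberian\<close>) integrates the \<open>k\<close>-th derivative of \<open>F\<close> against a Fejer kernel.
    The result bounds averages of \<open>u ^ k\<close> times the remainder over short windows by a constant, and
    monotonicity of \<open>S\<close> turns averages into pointwise bounds.

  Let \<open>Z\<close> be the function \<open>h\<close> for the generalized integers (so \<open>D = zeta\<close>), and \<open>V\<close> that for the
  primes weighted by \<open>log p\<close>. Unique factorization gives \<open>- zeta' = zeta * (sum over prime powers)\<close>, so up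
  to the harmless contribution of the proper powers \<open>V\<close> is determined by \<open>Z' / Z\<close>, and conversely.

  \<^item> If \<open>Z\<close> is slow, so is \<open>V\<close> as soon as \<open>1 / Z\<close> is \<open>O((1 + |Im z|) powr e)\<close>. The classical 3-4-1
    inequality bounds \<open>Z\<close> below by a power of \<open>Re z\<close>; taken at a distance \<open>(1 + |Im z|) powr -8e\<close> from
    the boundary and combined with the slow growth of \<open>Z'\<close>, it gives a bound up to the boundary
    (\<open>slow_upto_0_inverse_Z\<close>).
  \<^item> If \<open>V\<close> is slow, so is \<open>W = Z' / Z\<close>, but integrating \<open>W\<close> alone would bound only \<open>log |Z|\<close> by a power.
    At distance \<open>(1 + |Im z|) powr -e\<close> from the boundary, however, \<open>|log |zeta||\<close> is, up to a constant, at
    most the logarithm of \<open>zeta\<close> at a real point, hence of order \<open>log (1 + |Im z|)\<close>; from there to the boundary the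
    integral of \<open>W\<close> is bounded. So \<open>Z\<close> and \<open>1 / Z\<close> grow slower than every power, and the linear
    equation \<open>Z' = W * Z\<close> passes this on to all derivatives (\<open>Z_slow_of_V_slow\<close>).

  Finally, partial summation shows that \<open>\<pi>(x) = Li(x) + \<dots>\<close> is equivalent to \<open>\<theta>(x) = x + \<dots>\<close> with the
  same class of errors, where \<open>\<theta>\<close> sums \<open>log p\<close> over the primes up to \<open>x\<close>.
\<close>

section \<open>Slowly growing functions on the right half-plane\<close>

definition right_half_plane :: "complex set" where
  "right_half_plane = {z. 0 < Re z}"

text \<open>
  The bound is kept for the derivatives of order up to \<open>k\<close> so that closure under differential
  equations can be proved by induction on \<open>k\<close>. The constant may depend on the order and on the
  exponent, but it is uniform up to the boundary line of the half-plane.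
\<close>

definition slow_upto :: "nat \<Rightarrow> (complex \<Rightarrow> complex) \<Rightarrow> bool" where
  "slow_upto k g \<longleftrightarrow> g holomorphic_on right_half_plane \<and>
     (\<forall>j\<le>k. \<forall>e>0. \<exists>C. \<forall>z. 0 < Re z \<longrightarrow> Re z < 1 \<longrightarrow>
        norm ((deriv ^^ j) g z) \<le> C * (1 + \<bar>Im z\<bar>) powr e)"

definition slow :: "(complex \<Rightarrow> complex) \<Rightarrow> bool" where
  "slow g \<longleftrightarrow> (\<forall>k. slow_upto k g)"

lemma open_right_half_plane [simp]: "open right_half_plane"
  unfolding right_half_plane_def by (rule open_halfspace_Re_gt)

lemma mem_right_half_plane [simp]: "z \<in> right_half_plane \<longleftrightarrow> 0 < Re z"
  by (simp add: right_half_plane_def)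

lemma slow_upto_bound:
  assumes "slow_upto k g" "j \<le> k" "e > 0"
  obtains C where "C > 0" "\<And>z. 0 < Re z \<Longrightarrow> Re z < 1 \<Longrightarrow>
        norm ((deriv ^^ j) g z) \<le> C * (1 + \<bar>Im z\<bar>) powr e"
proof -
  obtain C where C: "\<And>z. 0 < Re z \<Longrightarrow> Re z < 1 \<Longrightarrow>
        norm ((deriv ^^ j) g z) \<le> C * (1 + \<bar>Im z\<bar>) powr e"
    using assms unfolding slow_upto_def by blast
  show thesis
  proof (rule that[of "\<bar>C\<bar> + 1"])
    fix z assume z: "0 < Re z" "Re z < 1"
    have "C * (1 + \<bar>Im z\<bar>) powr e \<le> (\<bar>C\<bar> + 1) * (1 + \<bar>Im z\<bar>) powr e"
      by (intro mult_right_mono) auto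
    then show "norm ((deriv ^^ j) g z) \<le> (\<bar>C\<bar> + 1) * (1 + \<bar>Im z\<bar>) powr e"
      using C[OF z] by linarith
  qed simp
qed

lemma slow_bound:
  assumes "slow g" "e > 0"
  shows "\<exists>C>0. \<forall>z. 0 < Re z \<longrightarrow> Re z < 1 \<longrightarrow>
        norm ((deriv ^^ j) g z) \<le> C * (1 + \<bar>Im z\<bar>) powr e"
proof -
  have "slow_upto j g" using assms(1) by (simp add: slow_def)
  from slow_upto_bound[OF this order_refl assms(2)] show ?thesis by metis
qed

lemma slow_uptoI:
  assumes "g holomorphic_on right_half_plane"
    and "\<And>j e. j \<le> k \<Longrightarrow> 0 < e \<Longrightarrow> \<exists>C. \<forall>z. 0 < Re z \<longrightarrow> Re z < 1 \<longrightarrow>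
        norm ((deriv ^^ j) g z) \<le> C * (1 + \<bar>Im z\<bar>) powr e"
  shows "slow_upto k g"
  using assms unfolding slow_upto_def by blast

lemma slowI:
  assumes "g holomorphic_on right_half_plane"
    and "\<And>j e. 0 < e \<Longrightarrow> \<exists>C. \<forall>z. 0 < Re z \<longrightarrow> Re z < 1 \<longrightarrow>
        norm ((deriv ^^ j) g z) \<le> C * (1 + \<bar>Im z\<bar>) powr e"
  shows "slow g"
  using assms unfolding slow_upto_def slow_def by blast

lemma slow_holomorphic: "slow g \<Longrightarrow> g holomorphic_on right_half_plane"
  by (simp add: slow_upto_def slow_def)

lemma slow_upto_mult:
  assumes f: "slow_upto k f" and g: "slow_upto k g"
  shows "slow_upto k (\<lambda>z. f z * g z)"
proof (rule slow_uptoI)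
  have hol: "f holomorphic_on right_half_plane" "g holomorphic_on right_half_plane"
    using f g by (simp_all add: slow_upto_def)
  then show "(\<lambda>z. f z * g z) holomorphic_on right_half_plane"
    by (intro holomorphic_intros)
  fix j :: nat and e :: real assume j: "j \<le> k" and e: "0 < e"
  have "\<forall>i\<in>{0..j}. \<exists>C>0. \<forall>z. 0 < Re z \<longrightarrow> Re z < 1 \<longrightarrow>
      norm ((deriv ^^ i) f z) \<le> C * (1 + \<bar>Im z\<bar>) powr (e/2)"
  proof
    fix i assume "i \<in> {0..j}"
    then show "\<exists>C>0. \<forall>z. 0 < Re z \<longrightarrow> Re z < 1 \<longrightarrow>
      norm ((deriv ^^ i) f z) \<le> C * (1 + \<bar>Im z\<bar>) powr (e/2)"
      using slow_upto_bound[OF f, of i "e/2"] j e by (metis atLeastAtMost_iff half_gt_zero order_trans)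
  qed
  then obtain A where A: "\<And>i z. i \<le> j \<Longrightarrow> 0 < Re z \<Longrightarrow> Re z < 1 \<Longrightarrow>
      norm ((deriv ^^ i) f z) \<le> A i * (1 + \<bar>Im z\<bar>) powr (e/2)" "\<And>i. i \<le> j \<Longrightarrow> A i > 0"
    by (metis atLeastAtMost_iff le0)
  have "\<forall>i\<in>{0..j}. \<exists>C>0. \<forall>z. 0 < Re z \<longrightarrow> Re z < 1 \<longrightarrow>
      norm ((deriv ^^ i) g z) \<le> C * (1 + \<bar>Im z\<bar>) powr (e/2)"
  proof
    fix i assume "i \<in> {0..j}"
    then show "\<exists>C>0. \<forall>z. 0 < Re z \<longrightarrow> Re z < 1 \<longrightarrow>
      norm ((deriv ^^ i) g z) \<le> C * (1 + \<bar>Im z\<bar>) powr (e/2)"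
      using slow_upto_bound[OF g, of i "e/2"] j e by (metis atLeastAtMost_iff half_gt_zero order_trans)
  qed
  then obtain B where B: "\<And>i z. i \<le> j \<Longrightarrow> 0 < Re z \<Longrightarrow> Re z < 1 \<Longrightarrow>
      norm ((deriv ^^ i) g z) \<le> B i * (1 + \<bar>Im z\<bar>) powr (e/2)" "\<And>i. i \<le> j \<Longrightarrow> B i > 0"
    by (metis atLeastAtMost_iff le0)
  show "\<exists>C. \<forall>z. 0 < Re z \<longrightarrow> Re z < 1 \<longrightarrow>
        norm ((deriv ^^ j) (\<lambda>z. f z * g z) z) \<le> C * (1 + \<bar>Im z\<bar>) powr e"
  proof (intro exI allI impI)
    fix z assume z: "0 < Re z" "Re z < 1"
    have "norm ((deriv ^^ j) (\<lambda>z. f z * g z) z)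
      = norm (\<Sum>i = 0..j. of_nat (j choose i) * (deriv ^^ i) f z * (deriv ^^ (j-i)) g z)"
      using z hol by (subst higher_deriv_mult[of _ right_half_plane]) auto
    also have "\<dots> \<le> (\<Sum>i = 0..j. real (j choose i) * (A i * B (j-i)) * (1 + \<bar>Im z\<bar>) powr e)"
    proof (rule sum_norm_le)
      fix i assume "i \<in> {0..j}"
      then have i: "i \<le> j" by simp
      have "norm ((deriv ^^ i) f z) * norm ((deriv ^^ (j-i)) g z)
        \<le> (A i * (1 + \<bar>Im z\<bar>) powr (e/2)) * (B (j-i) * (1 + \<bar>Im z\<bar>) powr (e/2))"
        using A[OF i] B[of "j-i"] z by (intro mult_mono) (auto simp: less_imp_le)
      also have "\<dots> = A i * B (j-i) * (1 + \<bar>Im z\<bar>) powr e"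
        by (simp add: powr_add[symmetric] algebra_simps)
      finally show "norm (of_nat (j choose i) * (deriv ^^ i) f z * (deriv ^^ (j-i)) g z)
        \<le> real (j choose i) * (A i * B (j-i)) * (1 + \<bar>Im z\<bar>) powr e"
        by (simp add: norm_mult mult.assoc mult_left_mono)
    qed
    also have "\<dots> = (\<Sum>i = 0..j. real (j choose i) * (A i * B (j-i))) * (1 + \<bar>Im z\<bar>) powr e"
      by (simp add: sum_distrib_right)
    finally show "norm ((deriv ^^ j) (\<lambda>z. f z * g z) z)
       \<le> (\<Sum>i = 0..j. real (j choose i) * (A i * B (j-i))) * (1 + \<bar>Im z\<bar>) powr e" .
  qed
qed

lemma slow_upto_add:
  assumes f: "slow_upto k f" and g: "slow_upto k g"
  shows "slow_upto k (\<lambda>z. f z + g z)"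
proof (rule slow_uptoI)
  have hol: "f holomorphic_on right_half_plane" "g holomorphic_on right_half_plane"
    using f g by (simp_all add: slow_upto_def)
  then show "(\<lambda>z. f z + g z) holomorphic_on right_half_plane"
    by (intro holomorphic_intros)
  fix j :: nat and e :: real assume j: "j \<le> k" and e: "0 < e"
  obtain A where A: "\<And>z. 0 < Re z \<Longrightarrow> Re z < 1 \<Longrightarrow> norm ((deriv ^^ j) f z) \<le> A * (1 + \<bar>Im z\<bar>) powr e"
    using slow_upto_bound[OF f j e] by blast
  obtain B where B: "\<And>z. 0 < Re z \<Longrightarrow> Re z < 1 \<Longrightarrow> norm ((deriv ^^ j) g z) \<le> B * (1 + \<bar>Im z\<bar>) powr e"
    using slow_upto_bound[OF g j e] by blast
  show "\<exists>C. \<forall>z. 0 < Re z \<longrightarrow> Re z < 1 \<longrightarrow>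
        norm ((deriv ^^ j) (\<lambda>z. f z + g z) z) \<le> C * (1 + \<bar>Im z\<bar>) powr e"
  proof (intro exI allI impI)
    fix z assume z: "0 < Re z" "Re z < 1"
    have "(deriv ^^ j) (\<lambda>z. f z + g z) z = (deriv ^^ j) f z + (deriv ^^ j) g z"
      using z hol by (intro higher_deriv_add[of _ right_half_plane]) auto
    also have "norm \<dots> \<le> (A + B) * (1 + \<bar>Im z\<bar>) powr e"
      using norm_triangle_mono[OF A[OF z] B[OF z]] by (simp add: algebra_simps)
    finally show "norm ((deriv ^^ j) (\<lambda>z. f z + g z) z) \<le> (A + B) * (1 + \<bar>Im z\<bar>) powr e" .
  qed
qed

text \<open>
  Half the radius is used because \<open>g\<close> is controlled on the open ball only.
\<close>

lemma higher_deriv_bound_Cauchy: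
  assumes "g holomorphic_on S" "ball z r \<subseteq> S" "0 < r"
    and "\<And>w. w \<in> ball z r \<Longrightarrow> norm (g w) \<le> B"
  shows "norm ((deriv ^^ n) g z) \<le> fact n * B / (r/2) ^ n"
proof (rule Cauchy_inequality)
  have sub: "cball z (r/2) \<subseteq> ball z r"
    using \<open>0 < r\<close> by auto
  have "g holomorphic_on cball z (r/2)"
    using assms sub by (meson holomorphic_on_subset order_trans)
  then show "continuous_on (cball z (r/2)) g" "g holomorphic_on ball z (r/2)"
    by (auto intro: holomorphic_on_imp_continuous_on elim: holomorphic_on_subset)
  show "norm (g x) \<le> B" if "norm (z - x) = r/2" for x
    using that \<open>0 < r\<close> by (intro assms(4)) (simp add: dist_norm)
qed (use \<open>0 < r\<close> in auto)

text \<open>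
  A bounded function on a larger half-plane has bounded derivatives on the smaller one, by Cauchy's
  estimate on balls of a fixed radius.
\<close>

lemma slow_bounded:
  assumes hol: "g holomorphic_on {z. - d < Re z}" and d: "0 < d"
    and B: "\<And>z. - d < Re z \<Longrightarrow> norm (g z) \<le> B"
  shows "slow g"
proof (rule slowI)
  show "g holomorphic_on right_half_plane"
    using hol by (rule holomorphic_on_subset) (use d in auto)
  fix j :: nat and e :: real assume e: "0 < e"
  show "\<exists>C. \<forall>z. 0 < Re z \<longrightarrow> Re z < 1 \<longrightarrow> norm ((deriv ^^ j) g z) \<le> C * (1 + \<bar>Im z\<bar>) powr e"
  proof (intro exI allI impI)
    fix z assume z: "0 < Re z" "Re z < 1"
    have sub: "ball z d \<subseteq> {z. - d < Re z}"
    proof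
      fix w assume "w \<in> ball z d"
      then have "\<bar>Re z - Re w\<bar> < d"
        by (metis abs_Re_le_cmod dist_norm mem_ball minus_complex.simps(1) order_le_less_trans)
      then show "w \<in> {z. - d < Re z}" using z by auto
    qed
    have Bpos: "0 \<le> B" using B[of z] z d norm_ge_zero[of "g z"] by linarith
    have "norm ((deriv ^^ j) g z) \<le> fact j * B / (d/2) ^ j"
      using sub d B by (intro higher_deriv_bound_Cauchy[OF hol sub]) auto
    also have "\<dots> * 1 \<le> fact j * B / (d/2) ^ j * (1 + \<bar>Im z\<bar>) powr e"
      using e d Bpos by (intro mult_left_mono) (auto intro!: ge_one_powr_ge_zero)
    finally show "norm ((deriv ^^ j) g z) \<le> fact j * B / (d/2) ^ j * (1 + \<bar>Im z\<bar>) powr e"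
      by simp
  qed
qed

lemma slow_const: "slow (\<lambda>_. c)"
  by (rule slow_bounded[of _ 1 "norm c"]) auto

lemma slow_mult: "slow f \<Longrightarrow> slow g \<Longrightarrow> slow (\<lambda>z. f z * g z)"
  unfolding slow_def using slow_upto_mult by blast

lemma slow_add: "slow f \<Longrightarrow> slow g \<Longrightarrow> slow (\<lambda>z. f z + g z)"
  unfolding slow_def using slow_upto_add by blast

lemma slow_diff: "slow f \<Longrightarrow> slow g \<Longrightarrow> slow (\<lambda>z. f z - g z)"
  using slow_add[OF _ slow_mult[OF slow_const[of "-1"]], of f g] by simp

lemma slow_upto_cong:
  assumes "slow_upto k f" "\<And>z. 0 < Re z \<Longrightarrow> f z = g z"
  shows "slow_upto k g"
proof (rule slow_uptoI)
  show "g holomorphic_on right_half_plane"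
    using assms holomorphic_transform[of f right_half_plane g] by (auto simp: slow_upto_def)
  fix j :: nat and e :: real assume j: "j \<le> k" and e: "0 < e"
  have "(deriv ^^ j) g z = (deriv ^^ j) f z" if "0 < Re z" for z
  proof (rule higher_deriv_cong_ev)
    show "\<forall>\<^sub>F x in nhds z. g x = f x"
      using eventually_nhds_in_open[of right_half_plane z] that assms(2)
      by (auto elim!: eventually_mono)
  qed simp
  then show "\<exists>C. \<forall>z. 0 < Re z \<longrightarrow> Re z < 1 \<longrightarrow>
        norm ((deriv ^^ j) g z) \<le> C * (1 + \<bar>Im z\<bar>) powr e"
    using slow_upto_bound[OF assms(1) j e] by metis
qed

lemma slow_cong:
  assumes "slow f" "\<And>z. 0 < Re z \<Longrightarrow> f z = g z"
  shows "slow g"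
  using assms slow_upto_cong unfolding slow_def by blast

lemma slow_upto_0I:
  assumes "g holomorphic_on right_half_plane"
    and "\<And>e. 0 < e \<Longrightarrow> \<exists>C. \<forall>z. 0 < Re z \<longrightarrow> Re z < 1 \<longrightarrow>
        norm (g z) \<le> C * (1 + \<bar>Im z\<bar>) powr e"
  shows "slow_upto 0 g"
  using assms unfolding slow_upto_def by simp

lemma slow_upto_Suc:
  assumes "slow_upto 0 g" "slow_upto k (deriv g)"
  shows "slow_upto (Suc k) g"
proof (rule slow_uptoI)
  fix j :: nat and e :: real assume j: "j \<le> Suc k" and e: "0 < e"
  show "\<exists>C. \<forall>z. 0 < Re z \<longrightarrow> Re z < 1 \<longrightarrow>
        norm ((deriv ^^ j) g z) \<le> C * (1 + \<bar>Im z\<bar>) powr e"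
  proof (cases j)
    case 0
    then show ?thesis using assms(1) e unfolding slow_upto_def by auto
  next
    case (Suc i)
    have "(deriv ^^ j) g = (deriv ^^ i) (deriv g)"
      by (simp add: Suc funpow_Suc_right del: funpow.simps)
    then show ?thesis using assms(2) e j Suc unfolding slow_upto_def by auto
  qed
qed (use assms in \<open>simp add: slow_upto_def\<close>)

lemma slow_deriv:
  assumes "slow g"
  shows "slow (deriv g)"
proof (rule slowI)
  show "deriv g holomorphic_on right_half_plane"
    using slow_holomorphic[OF assms] by (intro holomorphic_deriv) auto
  fix j :: nat and e :: real assume e: "0 < e"
  have "(deriv ^^ j) (deriv g) = (deriv ^^ (Suc j)) g"
    by (simp add: funpow_Suc_right del: funpow.simps)
  then show "\<exists>C. \<forall>z. 0 < Re z \<longrightarrow> Re z < 1 \<longrightarrow>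
        norm ((deriv ^^ j) (deriv g) z) \<le> C * (1 + \<bar>Im z\<bar>) powr e"
    using slow_bound[OF assms e, of "Suc j"] by metis
qed

text \<open>
  The equation expresses one more derivative of \<open>Z\<close> through derivatives already controlled.
\<close>

lemma slow_linear_ode:
  assumes W: "slow W" and Z: "slow_upto 0 Z"
    and ode: "\<And>z. 0 < Re z \<Longrightarrow> deriv Z z = W z * Z z"
  shows "slow Z"
proof -
  have "slow_upto k Z" for k
  proof (induction k)
    case (Suc k)
    have "slow_upto k (\<lambda>z. W z * Z z)"
      using W Suc by (intro slow_upto_mult) (auto simp: slow_def)
    then have "slow_upto k (deriv Z)"
      by (rule slow_upto_cong) (simp add: ode)
    then show ?case using Z by (intro slow_upto_Suc)
  qed (rule Z)
  then show ?thesis by (simp add: slow_def)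
qed

text \<open>
  The derivative of \<open>1 / f\<close> is \<open>- f' * (1 / f) ^ 2\<close>, which gains one order in the induction.
\<close>

lemma slow_inverse:
  assumes f: "slow f" and inv: "slow_upto 0 (\<lambda>z. inverse (f z))"
    and nz: "\<And>z. 0 < Re z \<Longrightarrow> f z \<noteq> 0"
  shows "slow (\<lambda>z. inverse (f z))"
proof -
  have "slow_upto k (\<lambda>z. inverse (f z))" for k
  proof (induction k)
    case (Suc k)
    have "slow (\<lambda>z. -1 * deriv f z)"
      using slow_deriv[OF f] by (intro slow_mult slow_const)
    then have "slow_upto k (\<lambda>z. -1 * deriv f z)"
      unfolding slow_def by blast
    from slow_upto_mult[OF this slow_upto_mult[OF Suc Suc]]
    have "slow_upto k (\<lambda>z. (-1 * deriv f z) * (inverse (f z) * inverse (f z)))" .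
    moreover have "deriv (\<lambda>z. inverse (f z)) z = (-1 * deriv f z) * (inverse (f z) * inverse (f z))"
      if "0 < Re z" for z
    proof (rule DERIV_imp_deriv)
      have "(f has_field_derivative deriv f z) (at z)"
        using slow_holomorphic[OF f] that
        by (intro holomorphic_derivI[of _ right_half_plane]) auto
      then show "((\<lambda>z. inverse (f z)) has_field_derivative (-1 * deriv f z) * (inverse (f z) * inverse (f z))) (at z)"
        using nz[OF that] by (auto intro!: derivative_eq_intros simp: field_simps)
    qed
    ultimately have "slow_upto k (deriv (\<lambda>z. inverse (f z)))"
      by (rule_tac slow_upto_cong) auto
    then show ?case using inv by (intro slow_upto_Suc)
  qed (rule inv)
  then show ?thesis by (simp add: slow_def)
qed

section \<open>Interpolation, division and boundary behaviour\<close>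

lemma higher_deriv_eqI:
  assumes "open S" "\<And>n z. z \<in> S \<Longrightarrow> (F n has_field_derivative F (Suc n) z) (at z)" "z \<in> S"
  shows "(deriv ^^ n) (F 0) z = F n z"
  using assms(3)
proof (induction n arbitrary: z)
  case (Suc n)
  have "(deriv ^^ Suc n) (F 0) z = deriv ((deriv ^^ n) (F 0)) z"
    by simp
  also have "\<dots> = deriv (F n) z"
    using eventually_nhds_in_open[OF assms(1) Suc.prems]
    by (intro deriv_cong_ev) (auto elim!: eventually_mono simp: Suc.IH)
  also have "\<dots> = F (Suc n) z"
    by (intro DERIV_imp_deriv assms Suc.prems)
  finally show ?case .
qed simp

lemma higher_deriv_inverse:
  fixes z :: complex
  assumes "0 < Re z"
  shows "(deriv ^^ n) inverse z = (-1) ^ n * fact n / z ^ Suc n"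
proof -
  define F :: "nat \<Rightarrow> complex \<Rightarrow> complex" where "F = (\<lambda>n z. (-1) ^ n * fact n * inverse z ^ Suc n)"
  have "(F n has_field_derivative F (Suc n) z) (at z)" if "z \<in> right_half_plane" for n z
  proof -
    have "z \<noteq> 0" using that by auto
    have "((\<lambda>z. inverse z ^ Suc n) has_field_derivative - of_nat (Suc n) * inverse z ^ Suc (Suc n)) (at z)"
      using DERIV_power[OF DERIV_inverse[OF \<open>z \<noteq> 0\<close>], of "Suc n"]
      by (rule DERIV_cong) (simp add: algebra_simps)
    from DERIV_cmult[OF this, of "(-1) ^ n * fact n"] show ?thesis
      unfolding F_def by (rule DERIV_cong) (simp add: algebra_simps)
  qed
  then have "(deriv ^^ n) (F 0) z = F n z"
    using assms by (intro higher_deriv_eqI[of right_half_plane]) auto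
  moreover have "F 0 = inverse" by (simp add: F_def fun_eq_iff)
  ultimately have "(deriv ^^ n) inverse z = F n z" by (simp only:)
  then show ?thesis by (simp only: F_def divide_inverse power_inverse)
qed

text \<open>
  Interpolation between a bound that is bad at great height and one that is bad near the boundary.
  At the abscissa \<open>x0 = (1 + |Im z|) powr -a / 2\<close> Cauchy's estimate costs only powers of \<open>1 / x0\<close>.
  To the left of \<open>x0\<close> a Taylor polynomial based at \<open>x0\<close> is used: its terms are of the same size, because
  each further derivative costs a factor \<open>1 / x0\<close> and the displacement is at most \<open>x0\<close>, while in the
  remainder the factor \<open>x0 ^ (n + 1)\<close> cancels the linear growth once \<open>n\<close> is large.
\<close>

lemma slow_of_linear_growth:
  assumes hol: "g holomorphic_on right_half_plane"
    and lin: "\<And>k. \<exists>C. \<forall>z. 0 < Re z \<longrightarrow> Re z < 1 \<longrightarrow> norm ((deriv ^^ k) g z) \<le> C * (1 + \<bar>Im z\<bar>)"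
    and B: "\<And>z. 0 < Re z \<Longrightarrow> Re z < 2 \<Longrightarrow> norm (g z) \<le> B / Re z"
  shows "slow g"
proof (rule slowI[OF hol])
  fix j :: nat and e :: real assume e: "0 < e"
  have B0: "0 \<le> B" using order_trans[OF norm_ge_zero B[of 1]] by simp
  define c where "c = (\<lambda>m. fact m * 2 * B * 4 ^ m :: real)"
  have c0: "0 \<le> c m" for m using B0 by (simp add: c_def)
  have cauchy: "norm ((deriv ^^ m) g z) \<le> c m * (1 / Re z) ^ Suc m" if z: "0 < Re z" "Re z < 1" for m z
  proof -
    have ball: "Re z / 2 < Re w \<and> Re w < 2" if "w \<in> ball z (Re z / 2)" for w
    proof -
      have "\<bar>Re z - Re w\<bar> < Re z / 2"
        using that by (metis abs_Re_le_cmod dist_norm mem_ball minus_complex.simps(1) order_le_less_trans)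
      then show ?thesis using z unfolding abs_less_iff by (intro conjI; linarith)
    qed
    have "norm ((deriv ^^ m) g z) \<le> fact m * (2 * B / Re z) / (Re z / 2 / 2) ^ m"
    proof (rule higher_deriv_bound_Cauchy[OF hol])
      show "ball z (Re z / 2) \<subseteq> right_half_plane"
        using ball z by fastforce
      fix w assume w: "w \<in> ball z (Re z / 2)"
      have "norm (g w) \<le> B / Re w" using ball[OF w] z by (intro B) auto
      also have "\<dots> \<le> B / (Re z / 2)"
        using ball[OF w] z B0 by (intro divide_left_mono) auto
      finally show "norm (g w) \<le> 2 * B / Re z" by (simp add: mult.commute)
    qed (use z in auto)
    also have "\<dots> = c m * (1 / Re z) ^ Suc m"
      using z by (simp add: c_def power_divide)
    finally show ?thesis .
  qed
  \<comment> \<open>The abscissa at which the two bounds are balanced is a small negative power of the height.\<close>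
  define a where "a = e / real (Suc j)"
  have a: "0 < a" using e by (simp add: a_def)
  obtain n where n: "1 / a \<le> real n" using real_arch_simple by blast
  obtain C where C: "\<And>z. 0 < Re z \<Longrightarrow> Re z < 1 \<Longrightarrow> norm ((deriv ^^ (j + Suc n)) g z) \<le> C * (1 + \<bar>Im z\<bar>)"
    using lin by blast
  define K where "K = (\<Sum>i\<le>n. c (j+i)) * 2 ^ Suc j + \<bar>C\<bar>"
  show "\<exists>C. \<forall>z. 0 < Re z \<longrightarrow> Re z < 1 \<longrightarrow> norm ((deriv ^^ j) g z) \<le> C * (1 + \<bar>Im z\<bar>) powr e"
  proof (intro exI allI impI)
    fix z assume z: "0 < Re z" "Re z < 1"
    define T where "T = 1 + \<bar>Im z\<bar>"
    have T: "1 \<le> T" by (simp add: T_def)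
    define x0 where "x0 = T powr (-a) / 2"
    have x0: "0 < x0" "x0 < 1"
      using T a powr_mono[of "-a" 0 T] by (auto simp: x0_def)
    have x0pow: "(1 / x0) ^ Suc j = 2 ^ Suc j * T powr e"
    proof -
      have "1 / x0 = 2 * T powr a" using T by (simp add: x0_def powr_minus field_simps)
      moreover have "(T powr a) ^ Suc j = T powr e"
        using T by (simp add: a_def powr_realpow[symmetric] powr_powr del: power_Suc)
      ultimately show ?thesis by (simp only: power_mult_distrib)
    qed
    have cs: "c (j+i) \<le> (\<Sum>i\<le>n. c (j+i))" if "i \<le> n" for i
      using member_le_sum[of i "{..n}" "\<lambda>i. c (j+i)"] that c0 by auto
    show "norm ((deriv ^^ j) g z) \<le> K * (1 + \<bar>Im z\<bar>) powr e"
    proof (cases "x0 \<le> Re z")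
      case True
      have "norm ((deriv ^^ j) g z) \<le> c j * (1 / Re z) ^ Suc j" by (rule cauchy[OF z])
      also have "\<dots> \<le> c j * (1 / x0) ^ Suc j"
        using True x0 z c0 by (intro mult_left_mono power_mono divide_left_mono) auto
      also have "\<dots> = c j * 2 ^ Suc j * T powr e" using x0pow by simp
      also have "\<dots> \<le> K * T powr e"
        unfolding K_def using cs[of 0] T by (intro mult_right_mono) (simp_all add: add_increasing2)
      finally show ?thesis by (simp add: T_def)
    next
      case False
      define w where "w = Complex x0 (Im z)"
      have segm: "Im u = Im z \<and> Re z \<le> Re u \<and> Re u \<le> x0" if "u \<in> closed_segment z w" for u
      proof -
        from that obtain v where v: "0 \<le> v" "v \<le> 1" "u = (1 - v) *\<^sub>R z + v *\<^sub>R w"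
          by (auto simp: in_segment)
        have "Re u = Re z + v * (x0 - Re z)" "Im u = Im z"
          by (simp_all add: v w_def algebra_simps)
        moreover have "v * (x0 - Re z) \<le> 1 * (x0 - Re z)" "0 \<le> v * (x0 - Re z)"
          using False v by (auto intro!: mult_right_mono)
        ultimately show ?thesis by simp
      qed
      have dist: "norm (z - w) \<le> x0"
        using False z norm_triangle_ineq[of "z - w" 0]
        by (simp add: w_def cmod_def)
      have "norm ((deriv ^^ (j+0)) g z - (\<Sum>i\<le>n. (deriv ^^ (j+i)) g w * (z - w) ^ i / fact i))
          \<le> \<bar>C\<bar> * T * norm (z - w) ^ Suc n / fact n"
      proof (rule complex_Taylor[of "closed_segment z w" n "\<lambda>i. (deriv ^^ (j+i)) g"])
        fix i u assume "u \<in> closed_segment z w"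
        then have "u \<in> right_half_plane" using segm[of u] z by simp
        then have "((deriv ^^ (j+i)) g has_field_derivative (deriv ^^ Suc (j+i)) g u) (at u)"
          by (intro has_field_derivative_higher_deriv[OF hol]) auto
        then show "((deriv ^^ (j+i)) g has_field_derivative (deriv ^^ (j + Suc i)) g u)
              (at u within closed_segment z w)"
          by (simp add: has_field_derivative_at_within)
      next
        fix u assume "u \<in> closed_segment z w"
        then have u: "0 < Re u" "Re u < 1" "Im u = Im z" using segm[of u] z x0 by auto
        have "norm ((deriv ^^ (j + Suc n)) g u) \<le> C * T" using C[OF u(1,2)] u(3) by (simp add: T_def)
        also have "\<dots> \<le> \<bar>C\<bar> * T" using T by (intro mult_right_mono) auto
        finally show "norm ((deriv ^^ (j + Suc n)) g u) \<le> \<bar>C\<bar> * T" .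
      qed auto
      also have "\<dots> \<le> \<bar>C\<bar> * T * norm (z - w) ^ Suc n / 1"
        using T by (intro divide_left_mono) auto
      also have "\<dots> \<le> \<bar>C\<bar> * T * x0 ^ Suc n / 1"
        using dist T by (intro divide_right_mono mult_left_mono power_mono) auto
      also have "\<dots> \<le> \<bar>C\<bar> * 1"
      proof -
        have "x0 ^ Suc n \<le> (T powr (-a)) ^ Suc n"
          using T by (intro power_mono) (auto simp: x0_def)
        also have "\<dots> = T powr (- (a * real (Suc n)))"
          using T by (simp add: powr_realpow[symmetric] powr_powr del: power_Suc)
        also have "\<dots> \<le> T powr (-1)"
        proof (rule powr_mono)
          have "1 \<le> a * real n" using n a by (simp add: field_simps)
          then show "- (a * real (Suc n)) \<le> -1" using a by (simp add: algebra_simps)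
        qed (use T in auto)
        finally have "T * x0 ^ Suc n \<le> T * T powr (-1)" using T by (intro mult_left_mono) auto
        also have "\<dots> = 1" using T by (simp add: powr_minus)
        finally have "\<bar>C\<bar> * (T * x0 ^ Suc n) \<le> \<bar>C\<bar> * 1" by (rule mult_left_mono) simp
        then show ?thesis by (simp only: mult.assoc div_by_1)
      qed
      finally have 1: "norm ((deriv ^^ j) g z - (\<Sum>i\<le>n. (deriv ^^ (j+i)) g w * (z - w) ^ i / fact i)) \<le> \<bar>C\<bar>"
        by simp
      have "norm (\<Sum>i\<le>n. (deriv ^^ (j+i)) g w * (z - w) ^ i / fact i) \<le> (\<Sum>i\<le>n. c (j+i) * (1/x0) ^ Suc j)"
      proof (rule sum_norm_le)
        fix i
        have "norm ((deriv ^^ (j+i)) g w * (z - w) ^ i / fact i) \<le> norm ((deriv ^^ (j+i)) g w * (z - w) ^ i) / 1"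
          unfolding norm_divide by (intro divide_left_mono) auto
        also have "\<dots> = norm ((deriv ^^ (j+i)) g w) * norm (z - w) ^ i" by (simp add: norm_mult norm_power)
        also have "\<dots> \<le> (c (j+i) * (1 / x0) ^ Suc (j+i)) * x0 ^ i"
          using cauchy[of w "j+i"] x0 c0 dist by (intro mult_mono power_mono) (auto simp: w_def)
        also have "\<dots> = c (j+i) * (1/x0) ^ Suc j"
          using x0 by (simp add: power_add power_divide field_simps)
        finally show "norm ((deriv ^^ (j+i)) g w * (z - w) ^ i / fact i) \<le> c (j+i) * (1/x0) ^ Suc j" .
      qed
      also have "\<dots> = (\<Sum>i\<le>n. c (j+i)) * 2 ^ Suc j * T powr e"
        unfolding x0pow by (simp add: sum_distrib_right mult.assoc)
      finally have "norm ((deriv ^^ j) g z) \<le> (\<Sum>i\<le>n. c (j+i)) * 2 ^ Suc j * T powr e + \<bar>C\<bar>"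
        using 1 norm_triangle_sub[of "(deriv ^^ j) g z" "\<Sum>i\<le>n. (deriv ^^ (j+i)) g w * (z - w) ^ i / fact i"]
        by linarith
      also have "\<dots> \<le> (\<Sum>i\<le>n. c (j+i)) * 2 ^ Suc j * T powr e + \<bar>C\<bar> * T powr e"
        using ge_one_powr_ge_zero[OF T, of e] e by (simp add: mult_le_cancel_left1)
      finally show ?thesis by (simp add: K_def T_def algebra_simps)
    qed
  qed
qed

text \<open>
  Dividing by \<open>z\<close> gains decay at great height. Near \<open>0\<close> the quotient is not singular because \<open>h\<close>
  vanishes there: by Leibniz, its \<open>k\<close>-th derivative is a multiple of the Taylor polynomial of \<open>h\<close> based at
  \<open>z\<close>, evaluated at the boundary point \<open>0\<close>, divided by \<open>z ^ (k + 1)\<close>; and this polynomial differs from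
  \<open>h(0) = 0\<close> by at most a constant times \<open>|z| ^ (k + 1)\<close>. Since \<open>h\<close> is not defined at \<open>0\<close>, Taylor's
  theorem is applied at \<open>d * z\<close> and \<open>d\<close> tends to \<open>0\<close>.
\<close>

lemma bounded_higher_deriv_quotient:
  assumes h: "slow h"
    and h0: "\<And>z. 0 < Re z \<Longrightarrow> norm z < 1 \<Longrightarrow> norm (h z) \<le> C * norm z"
  shows "\<exists>B. \<forall>z. 0 < Re z \<longrightarrow> Re z < 1 \<longrightarrow> norm ((deriv ^^ k) (\<lambda>z. h z / z) z) \<le> B"
proof -
  have hol: "h holomorphic_on right_half_plane" by (rule slow_holomorphic[OF h])
  have "\<exists>A>0. \<forall>z. 0 < Re z \<longrightarrow> Re z < 1 \<longrightarrow> norm ((deriv ^^ i) h z) \<le> A * (1 + \<bar>Im z\<bar>)" for i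
  proof -
    obtain A where "A > 0" "\<forall>z. 0 < Re z \<longrightarrow> Re z < 1 \<longrightarrow>
        norm ((deriv ^^ i) h z) \<le> A * (1 + \<bar>Im z\<bar>) powr 1"
      using slow_bound[OF h zero_less_one, of i] by (elim exE conjE) (rule that)
    then show ?thesis by (intro exI[of _ A]) simp
  qed
  then obtain A where A: "\<And>i z. 0 < Re z \<Longrightarrow> Re z < 1 \<Longrightarrow> norm ((deriv ^^ i) h z) \<le> A i * (1 + \<bar>Im z\<bar>)"
      and A0: "\<And>i. A i > 0"
    by metis
  have leibniz: "(deriv ^^ k) (\<lambda>z. h z / z) z
      = (\<Sum>i\<le>k. of_nat (k choose i) * (deriv ^^ i) h z * ((-1) ^ (k-i) * fact (k-i) / z ^ Suc (k-i)))"
    if "0 < Re z" for z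
  proof -
    have "(\<lambda>z. h z / z) = (\<lambda>z. h z * inverse z)" by (simp add: divide_inverse)
    moreover have "(deriv ^^ k) (\<lambda>z. h z * inverse z) z
      = (\<Sum>i = 0..k. of_nat (k choose i) * (deriv ^^ i) h z * (deriv ^^ (k-i)) inverse z)"
      using that hol by (intro higher_deriv_mult[of _ right_half_plane])
        (auto intro!: holomorphic_on_inverse holomorphic_intros)
    ultimately show ?thesis
      using higher_deriv_inverse[OF that] by (simp add: atMost_atLeast0)
  qed
  define B1 where "B1 = (\<Sum>i\<le>k. real (k choose i) * (2 * A i) * fact (k-i))"
  define B2 where "B2 = fact k * (2 * A (Suc k))"
  have B1: "norm ((deriv ^^ k) (\<lambda>z. h z / z) z) \<le> B1" if z: "0 < Re z" "Re z < 1" "1 \<le> norm z" for z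
    unfolding leibniz[OF z(1)] B1_def
  proof (rule sum_norm_le)
    fix i
    have "1 + \<bar>Im z\<bar> \<le> 2 * norm z" using z(3) abs_Im_le_cmod[of z] by linarith
    then have "norm ((deriv ^^ i) h z) \<le> A i * (2 * norm z)"
      using A[OF z(1,2), of i] A0[of i] mult_left_mono by (meson less_imp_le order_trans)
    moreover have "norm ((-1) ^ (k-i) * fact (k-i) / z ^ Suc (k-i)) \<le> fact (k-i) / norm z"
    proof -
      have "norm ((-1) ^ (k-i) * fact (k-i) / z ^ Suc (k-i)) = fact (k-i) / norm z ^ Suc (k-i)"
        by (simp add: norm_divide norm_mult norm_power)
      also have "\<dots> \<le> fact (k-i) / norm z ^ 1"
        using z(3) by (intro divide_left_mono power_increasing mult_pos_pos zero_less_power) auto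
      finally show ?thesis by simp
    qed
    ultimately have "norm ((deriv ^^ i) h z) * norm ((-1) ^ (k-i) * fact (k-i) / z ^ Suc (k-i))
        \<le> (A i * (2 * norm z)) * (fact (k-i) / norm z)"
      using A0[of i] by (intro mult_mono) auto
    also have "\<dots> = 2 * A i * fact (k-i)" using z by (auto simp: field_simps)
    finally show "norm (of_nat (k choose i) * (deriv ^^ i) h z * ((-1) ^ (k-i) * fact (k-i) / z ^ Suc (k-i)))
      \<le> real (k choose i) * (2 * A i) * fact (k-i)"
      unfolding norm_mult mult.assoc by (simp add: mult_left_mono)
  qed
  have B2: "norm ((deriv ^^ k) (\<lambda>z. h z / z) z) \<le> B2" if z: "0 < Re z" "norm z < 1" for z
  proof -
    define P where "P = (\<lambda>w. \<Sum>i\<le>k. (deriv ^^ i) h z * (w - z) ^ i / fact i)"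
    \<comment> \<open>Up to a factor, the Leibniz expansion is the Taylor polynomial at \<open>z\<close> evaluated at \<open>0\<close>.\<close>
    have eq: "(deriv ^^ k) (\<lambda>z. h z / z) z = (-1) ^ k * fact k / z ^ Suc k * P 0"
      unfolding leibniz[OF z(1)] P_def sum_distrib_left
    proof (rule sum.cong)
      fix i assume "i \<in> {..k}"
      then have i: "i \<le> k" by simp
      then obtain l where k: "k = l + i" by (metis le_add_diff_inverse2)
      have "of_nat (k choose i) = (fact k / (fact i * fact l) :: complex)"
        using binomial_fact[OF i, where 'a=complex] k by simp
      then have "of_nat (k choose i) * H * ((-1) ^ (k-i) * fact (k-i) / z ^ Suc (k-i))
          = (-1) ^ l * (fact k / fact i * H * (1 / z ^ Suc l))" for H :: complex
        by (simp add: k)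
      then have "of_nat (k choose i) * (deriv ^^ i) h z * ((-1) ^ (k-i) * fact (k-i) / z ^ Suc (k-i))
          = (-1) ^ l * (fact k / fact i * (deriv ^^ i) h z * (1 / z ^ Suc l))" .
      also have "(-1) ^ l = ((-1) ^ k * (-1) ^ i :: complex)"
        by (simp add: k power_add mult.assoc flip: power_mult_distrib)
      also have "1 / z ^ Suc l = z ^ i / z ^ Suc k"
      proof -
        have "z \<noteq> 0" using z by auto
        then show ?thesis by (simp add: k power_add)
      qed
      finally show "of_nat (k choose i) * (deriv ^^ i) h z * ((-1) ^ (k-i) * fact (k-i) / z ^ Suc (k-i))
          = (-1) ^ k * fact k / z ^ Suc k * ((deriv ^^ i) h z * (0 - z) ^ i / fact i)"
        by (simp add: power_minus[of z] mult_ac)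
    qed simp
    have taylor: "norm (h (of_real d * z) - P (of_real d * z)) \<le> 2 * A (Suc k) * norm z ^ Suc k"
      if d: "0 < d" "d < 1" for d :: real
    proof -
      have segm: "0 < Re u \<and> Re u < 1 \<and> \<bar>Im u\<bar> \<le> 1" if u: "u \<in> closed_segment z (of_real d * z)" for u
      proof -
        from u obtain v where v: "0 \<le> v" "v \<le> 1" "u = (1 - v) *\<^sub>R z + v *\<^sub>R (of_real d * z)"
          by (auto simp: in_segment)
        define r where "r = 1 - v + v * d"
        have ur: "u = r *\<^sub>R z"
          by (simp add: v r_def scaleR_conv_of_real algebra_simps)
        have "0 < r" using v d by (cases "v = 1") (auto simp: r_def intro!: add_pos_nonneg)
        moreover have "r \<le> 1" using v d mult_left_mono[of d 1 v] by (simp add: r_def)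
        moreover have Re: "\<bar>Re z\<bar> < 1" and Im: "\<bar>Im z\<bar> < 1"
          using abs_Re_le_cmod[of z] abs_Im_le_cmod[of z] z by auto
        moreover have "r * Re z \<le> 1 * Re z"
          by (rule mult_right_mono) (use \<open>r \<le> 1\<close> z in auto)
        moreover have "r * \<bar>Im z\<bar> \<le> 1 * \<bar>Im z\<bar>"
          by (rule mult_right_mono) (use \<open>r \<le> 1\<close> z in auto)
        moreover have "\<bar>Im u\<bar> = r * \<bar>Im z\<bar>" "Re u = r * Re z"
          using \<open>0 < r\<close> by (simp_all add: ur abs_mult)
        moreover have "0 < r * Re z" using \<open>0 < r\<close> z by simp
        ultimately show ?thesis by linarith
      qed
      have "norm ((deriv ^^ 0) h (of_real d * z) - (\<Sum>i\<le>k. (deriv ^^ i) h z * (of_real d * z - z) ^ i / fact i))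
          \<le> 2 * A (Suc k) * norm (of_real d * z - z) ^ Suc k / fact k"
      proof (rule complex_Taylor[of "closed_segment z (of_real d * z)" k "\<lambda>i. (deriv ^^ i) h"])
        fix i u assume "u \<in> closed_segment z (of_real d * z)"
        then have "u \<in> right_half_plane" using segm[of u] by simp
        then have "((deriv ^^ i) h has_field_derivative (deriv ^^ Suc i) h u) (at u)"
          by (intro has_field_derivative_higher_deriv[OF hol]) auto
        then show "((deriv ^^ i) h has_field_derivative (deriv ^^ Suc i) h u)
              (at u within closed_segment z (of_real d * z))"
          by (simp add: has_field_derivative_at_within)
      next
        fix u assume "u \<in> closed_segment z (of_real d * z)"
        then have u: "0 < Re u" "Re u < 1" "\<bar>Im u\<bar> \<le> 1" using segm[of u] by auto
        have "norm ((deriv ^^ Suc k) h u) \<le> A (Suc k) * (1 + \<bar>Im u\<bar>)" by (rule A[OF u(1,2)])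
        also have "\<dots> \<le> A (Suc k) * 2" using u(3) A0[of "Suc k"] by (intro mult_left_mono) auto
        finally show "norm ((deriv ^^ Suc k) h u) \<le> 2 * A (Suc k)" by simp
      qed auto
      also have "\<dots> \<le> 2 * A (Suc k) * norm (of_real d * z - z) ^ Suc k / 1"
        using A0[of "Suc k"] by (intro divide_left_mono) auto
      also have "norm (of_real d * z - z) = (1 - d) * norm z"
      proof -
        have "of_real d * z - z = - (of_real (1 - d) * z)" by (simp add: algebra_simps)
        then show ?thesis using d by (simp only: norm_minus_cancel norm_mult norm_of_real abs_of_pos diff_gt_0_iff_gt)
      qed
      also have "2 * A (Suc k) * ((1 - d) * norm z) ^ Suc k / 1 \<le> 2 * A (Suc k) * (1 * norm z) ^ Suc k / 1"
        using d A0[of "Suc k"] by (intro divide_right_mono mult_left_mono power_mono mult_right_mono) auto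
      finally show ?thesis by (simp add: P_def)
    qed
    have "norm (0 - P 0) \<le> 2 * A (Suc k) * norm z ^ Suc k"
    proof (rule tendsto_upperbound)
      have "((\<lambda>d. h (of_real d * z)) \<longlongrightarrow> 0) (at_right 0)"
      proof (rule Lim_null_comparison)
        show "\<forall>\<^sub>F d in at_right 0. norm (h (of_real d * z)) \<le> C * (d * norm z)"
        proof -
          have "\<forall>\<^sub>F d in at_right (0::real). 0 < d \<and> d < 1"
            using eventually_at_right_real[of 0 1] by simp
          then show ?thesis
          proof eventually_elim
            case (elim d)
            have "d * norm z \<le> 1 * norm z" using elim by (intro mult_right_mono) auto
            then have "norm (h (of_real d * z)) \<le> C * norm (of_real d * z)"
              using elim z by (intro h0) (auto simp: norm_mult)
            then show ?case using elim by (simp add: norm_mult)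
          qed
        qed
        show "((\<lambda>d. C * (d * norm z)) \<longlongrightarrow> 0) (at_right 0)"
          by (auto intro!: tendsto_eq_intros)
      qed
      moreover have "((\<lambda>d. P (of_real d * z)) \<longlongrightarrow> P 0) (at_right (0::real))"
        unfolding P_def by (auto intro!: tendsto_eq_intros)
      ultimately show "((\<lambda>d. norm (h (of_real d * z) - P (of_real d * z))) \<longlongrightarrow> norm (0 - P 0)) (at_right (0::real))"
        by (intro tendsto_intros)
      have "\<forall>\<^sub>F d in at_right (0::real). 0 < d \<and> d < 1"
        using eventually_at_right_real[of 0 1] by simp
      then show "\<forall>\<^sub>F d in at_right (0::real). norm (h (of_real d * z) - P (of_real d * z)) \<le> 2 * A (Suc k) * norm z ^ Suc k"
        by eventually_elim (rule taylor; simp)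
    qed simp
    then have "norm ((-1) ^ k * fact k / z ^ Suc k * P 0)
        \<le> fact k / norm z ^ Suc k * (2 * A (Suc k) * norm z ^ Suc k)"
      unfolding norm_mult by (intro mult_mono) (auto simp: norm_divide norm_mult norm_power)
    also have "\<dots> = B2" using z by (auto simp: B2_def field_simps)
    finally show ?thesis unfolding eq .
  qed
  have "norm ((deriv ^^ k) (\<lambda>z. h z / z) z) \<le> max B1 B2" if "0 < Re z" "Re z < 1" for z
    using B1[of z] B2[of z] that by fastforce
  then show ?thesis by blast
qed

lemma slow_Lipschitz:
  assumes h: "slow h" and R: "0 \<le> R"
  shows "\<exists>L>0. \<forall>w z. 0 < Re w \<and> Re w < 1 \<and> \<bar>Im w\<bar> \<le> R \<and> 0 < Re z \<and> Re z < 1 \<and> \<bar>Im z\<bar> \<le> R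
      \<longrightarrow> norm (h w - h z) \<le> L * norm (w - z)"
proof -
  obtain A where A: "A > 0" "\<forall>z. 0 < Re z \<longrightarrow> Re z < 1 \<longrightarrow> norm ((deriv ^^ 1) h z) \<le> A * (1 + \<bar>Im z\<bar>) powr 1"
    using slow_bound[OF h zero_less_one, of 1] by (elim exE conjE) (rule that)
  define S where "S = {z. 0 < Re z} \<inter> {z. Re z < 1} \<inter> {z. Im z \<le> R} \<inter> {z. - R \<le> Im z}"
  have conv: "convex S" unfolding S_def
    by (intro convex_Int convex_halfspace_Re_gt convex_halfspace_Re_lt convex_halfspace_Im_ge
        convex_halfspace_Im_le)
  have "norm (h w - h z) \<le> A * (1 + R) * norm (w - z)" if "w \<in> S" "z \<in> S" for w z
  proof (rule field_differentiable_bound[OF conv _ _ that])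
    fix u assume u: "u \<in> S"
    show "(h has_field_derivative deriv h u) (at u within S)"
      by (rule holomorphic_derivI[OF slow_holomorphic[OF h] open_right_half_plane])
        (use u in \<open>simp add: S_def\<close>)
    have "norm (deriv h u) \<le> A * (1 + \<bar>Im u\<bar>)" using A(2)[rule_format, of u] u by (simp add: S_def)
    also have "\<dots> \<le> A * (1 + R)" using u A(1) by (intro mult_left_mono) (auto simp: S_def)
    finally show "norm (deriv h u) \<le> A * (1 + R)" .
  qed
  moreover have "w \<in> S" if "0 < Re w" "Re w < 1" "\<bar>Im w\<bar> \<le> R" for w
    using that by (auto simp: S_def abs_le_iff)
  ultimately show ?thesis
    using A(1) R by (intro exI[of _ "A * (1 + R)"]) auto
qed

text \<open>
  The derivative is bounded near \<open>0\<close>, so \<open>h\<close> is Lipschitz there and extends to the boundary point.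
\<close>

lemma slow_boundary_limit:
  assumes h: "slow h"
  shows "\<exists>a C. \<forall>z. 0 < Re z \<longrightarrow> norm z < 1 \<longrightarrow> norm (h z - a) \<le> C * norm z"
proof -
  obtain L where L: "0 < L"
    and Lip: "\<forall>w z. 0 < Re w \<and> Re w < 1 \<and> \<bar>Im w\<bar> \<le> 1 \<and> 0 < Re z \<and> Re z < 1 \<and> \<bar>Im z\<bar> \<le> 1
      \<longrightarrow> norm (h w - h z) \<le> L * norm (w - z)"
    using slow_Lipschitz[OF h zero_le_one] by (elim exE conjE) (rule that)
  define x where "x = (\<lambda>n. of_real (inverse (real (Suc (Suc n)))) :: complex)"
  have xr: "0 < Re (x n)" "Re (x n) < 1" "Im (x n) = 0" for n
    by (auto simp: x_def field_simps)
  have x0: "x \<longlonglongrightarrow> 0"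
    unfolding x_def using tendsto_of_real[OF LIMSEQ_Suc[OF LIMSEQ_inverse_real_of_nat], where 'a=complex]
    by (simp only: of_real_0)
  have "Cauchy (\<lambda>n. h (x n))"
  proof (rule metric_CauchyI)
    fix e :: real assume "0 < e"
    then have "0 < e / L" using L by simp
    then obtain M where M: "\<And>m n. m \<ge> M \<Longrightarrow> n \<ge> M \<Longrightarrow> dist (x m) (x n) < e / L"
      using metric_CauchyD[OF LIMSEQ_imp_Cauchy[OF x0]] by blast
    have "dist (h (x m)) (h (x n)) < e" if "m \<ge> M" "n \<ge> M" for m n
    proof -
      have "norm (h (x m) - h (x n)) \<le> L * norm (x m - x n)" using xr by (intro Lip[rule_format]) auto
      also have "\<dots> < e" using M[OF that] L by (simp add: dist_norm field_simps)
      finally show ?thesis by (simp add: dist_norm)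
    qed
    then show "\<exists>M. \<forall>m\<ge>M. \<forall>n\<ge>M. dist (h (x m)) (h (x n)) < e" by blast
  qed
  then obtain a where a: "(\<lambda>n. h (x n)) \<longlonglongrightarrow> a"
    using Cauchy_convergent_iff convergent_def by blast
  show ?thesis
  proof (intro exI[of _ a] exI[of _ L] allI impI)
    fix z :: complex assume z: "0 < Re z" "norm z < 1"
    have z': "Re z < 1" "\<bar>Im z\<bar> \<le> 1" using abs_Re_le_cmod[of z] abs_Im_le_cmod[of z] z by auto
    show "norm (h z - a) \<le> L * norm z"
    proof (rule tendsto_le)
      show "(\<lambda>n. norm (h z - h (x n))) \<longlonglongrightarrow> norm (h z - a)" by (intro tendsto_intros a)
      have "(\<lambda>n. L * norm (z - x n)) \<longlonglongrightarrow> L * norm (z - 0)" by (intro tendsto_intros x0)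
      then show "(\<lambda>n. L * norm (z - x n)) \<longlonglongrightarrow> L * norm z" by simp
      show "\<forall>\<^sub>F n in sequentially. norm (h z - h (x n)) \<le> L * norm (z - x n)"
        using z z' xr by (intro always_eventually allI Lip[rule_format]) auto
    qed simp
  qed
qed

section \<open>Differentiating Laplace transforms\<close>

lemma norm_integral_le_integral:
  fixes f :: "'a \<Rightarrow> 'b::{banach,second_countable_topology}"
  assumes "integrable M f" "integrable M g" "\<And>x. x \<in> space M \<Longrightarrow> norm (f x) \<le> g x"
  shows "norm (\<integral>x. f x \<partial>M) \<le> (\<integral>x. g x \<partial>M)"
proof -
  have "norm (\<integral>x. f x \<partial>M) \<le> (\<integral>x. norm (f x) \<partial>M)" by (rule integral_norm_bound)
  also have "\<dots> \<le> (\<integral>x. g x \<partial>M)" using assms by (intro integral_mono) auto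
  finally show ?thesis .
qed

text \<open>
  An arbitrary small part of the exponential decay absorbs the factor \<open>l\<close>. The statement is about an
  arbitrary measure: with a counting measure it concerns Dirichlet series, with Lebesgue measure on a
  half-line it concerns Laplace transforms.
\<close>

lemma integrable_laplace_mult:
  fixes h :: "'a \<Rightarrow> complex" and l :: "'a \<Rightarrow> real"
  assumes [measurable]: "l \<in> borel_measurable M" "h \<in> borel_measurable M"
    and l0: "\<And>i. i \<in> space M \<Longrightarrow> 0 \<le> l i"
    and int: "\<And>x. x0 < x \<Longrightarrow> integrable M (\<lambda>i. norm (h i) * exp (- (x * l i)))"
    and x: "x0 < x"
  shows "integrable M (\<lambda>i. norm (- of_real (l i) * h i) * exp (- (x * l i)))"
proof (rule Bochner_Integration.integrable_bound)
  define d where "d = (x - x0) / 2"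
  have d: "0 < d" "x0 < x - d" using x by (simp_all add: d_def field_simps)
  show "integrable M (\<lambda>i. 1 / d * (norm (h i) * exp (- ((x - d) * l i))))"
    using int[OF d(2)] by (intro integrable_mult_right)
  show "AE i in M. norm (norm (- of_real (l i) * h i) * exp (- (x * l i)))
      \<le> norm (1 / d * (norm (h i) * exp (- ((x - d) * l i))))"
  proof (rule AE_I2)
    fix i assume i: "i \<in> space M"
    have "d * l i \<le> exp (d * l i)" using exp_ge_add_one_self[of "d * l i"] by linarith
    then have "l i \<le> 1 / d * exp (d * l i)" using d(1) by (simp add: field_simps)
    then have "l i * (norm (h i) * exp (- (x * l i))) \<le> 1 / d * exp (d * l i) * (norm (h i) * exp (- (x * l i)))"
      by (intro mult_right_mono) auto
    also have "\<dots> = 1 / d * (norm (h i) * (exp (d * l i) * exp (- (x * l i))))" by simp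
    also have "exp (d * l i) * exp (- (x * l i)) = exp (- ((x - d) * l i))"
      by (simp add: exp_add[symmetric] algebra_simps)
    finally show "norm (norm (- of_real (l i) * h i) * exp (- (x * l i)))
      \<le> norm (1 / d * (norm (h i) * exp (- ((x - d) * l i))))"
      using l0[OF i] d(1) by (simp add: norm_mult)
  qed
qed measurable

lemma integrable_laplace_power:
  fixes h :: "'a \<Rightarrow> complex" and l :: "'a \<Rightarrow> real"
  assumes [measurable]: "l \<in> borel_measurable M" "h \<in> borel_measurable M"
    and l0: "\<And>i. i \<in> space M \<Longrightarrow> 0 \<le> l i"
    and int: "\<And>x. x0 < x \<Longrightarrow> integrable M (\<lambda>i. norm (h i) * exp (- (x * l i)))"
    and x: "x0 < x"
  shows "integrable M (\<lambda>i. norm ((- of_real (l i)) ^ k * h i) * exp (- (x * l i)))"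
  using x
proof (induction k arbitrary: x)
  case (Suc k)
  have "integrable M (\<lambda>i. norm (- of_real (l i) * ((- of_real (l i)) ^ k * h i)) * exp (- (x * l i)))"
    by (rule integrable_laplace_mult[where ?x0.0 = x0]) (use l0 Suc in auto)
  then show ?case by (simp add: mult.assoc)
qed (use int in simp)

lemma integrable_laplace_complex:
  fixes h :: "'a \<Rightarrow> complex" and l :: "'a \<Rightarrow> real"
  assumes [measurable]: "l \<in> borel_measurable M" "h \<in> borel_measurable M"
    and int: "integrable M (\<lambda>i. norm (h i) * exp (- (Re s * l i)))"
  shows "integrable M (\<lambda>i. h i * exp (- (s * of_real (l i))))"
  by (rule Bochner_Integration.integrable_bound[OF int]) (auto simp: norm_mult)

text \<open>
  Differentiation under the integral sign: the second-order Taylor remainder of the exponential is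
  bounded by \<open>|w| ^ 2\<close> times an integrable function.
\<close>

lemma has_field_derivative_laplace:
  fixes h :: "'a \<Rightarrow> complex" and l :: "'a \<Rightarrow> real"
  assumes [measurable]: "l \<in> borel_measurable M" "h \<in> borel_measurable M"
    and l0: "\<And>i. i \<in> space M \<Longrightarrow> 0 \<le> l i"
    and int: "\<And>x. x0 < x \<Longrightarrow> integrable M (\<lambda>i. norm (h i) * exp (- (x * l i)))"
    and s: "x0 < Re s"
  shows "((\<lambda>s. \<integral>i. h i * exp (- (s * of_real (l i))) \<partial>M) has_field_derivative
           (\<integral>i. - of_real (l i) * h i * exp (- (s * of_real (l i))) \<partial>M)) (at s)"
proof -
  define F where "F = (\<lambda>s. \<integral>i. h i * exp (- (s * of_real (l i))) \<partial>M)"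
  define F' where "F' = (\<integral>i. - of_real (l i) * h i * exp (- (s * of_real (l i))) \<partial>M)"
  define d where "d = (Re s - x0) / 2"
  have d: "0 < d" "x0 < Re s - d" using s by (simp_all add: d_def field_simps)
  define A where "A = (\<integral>i. norm ((- of_real (l i)) ^ 2 * h i) * exp (- ((Re s - d) * l i)) \<partial>M)"
  have intA: "integrable M (\<lambda>i. norm ((- of_real (l i)) ^ 2 * h i) * exp (- ((Re s - d) * l i)))"
    by (rule integrable_laplace_power[where ?x0.0 = x0]) (use l0 int d in auto)
  have int0: "integrable M (\<lambda>i. h i * exp (- (s * of_real (l i))))" if "x0 < Re s" for s
    by (rule integrable_laplace_complex) (use int that in auto)
  have int1: "integrable M (\<lambda>i. - of_real (l i) * h i * exp (- (s * of_real (l i))))"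
  proof (rule integrable_laplace_complex)
    show "integrable M (\<lambda>i. norm (- of_real (l i) * h i) * exp (- (Re s * l i)))"
      by (rule integrable_laplace_mult[where ?x0.0 = x0]) (use l0 int s in auto)
  qed auto
  have main: "norm (F (s + w) - F s - w * F') \<le> norm w ^ 2 * A" if w: "norm w < d" for w
  proof -
    have re: "x0 < Re (s + w)" using w d(2) abs_Re_le_cmod[of w] by (simp add: abs_le_iff)
    have eq: "F (s + w) - F s - w * F' = (\<integral>i. h i * exp (- ((s + w) * of_real (l i)))
        - h i * exp (- (s * of_real (l i))) - w * (- of_real (l i) * h i * exp (- (s * of_real (l i)))) \<partial>M)"
      unfolding F_def F'_def using int0[OF re] int0[OF s] int1
      by (simp add: Bochner_Integration.integral_diff)
    have "norm (F (s + w) - F s - w * F')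
        \<le> (\<integral>i. norm w ^ 2 * (norm ((- of_real (l i)) ^ 2 * h i) * exp (- ((Re s - d) * l i))) \<partial>M)"
      unfolding eq
    proof (rule norm_integral_le_integral)
      show "integrable M (\<lambda>i. norm w ^ 2 * (norm ((- of_real (l i)) ^ 2 * h i) * exp (- ((Re s - d) * l i))))"
        using intA by (rule integrable_mult_right)
      show "integrable M (\<lambda>i. h i * exp (- ((s + w) * of_real (l i)))
        - h i * exp (- (s * of_real (l i))) - w * (- of_real (l i) * h i * exp (- (s * of_real (l i)))))"
        by (intro Bochner_Integration.integrable_diff int0[OF re] int0[OF s] integrable_mult_right int1)
      fix i assume i: "i \<in> space M"
      define v where "v = - (w * of_real (l i))"
      have nv: "norm v = norm w * l i" using l0[OF i] by (simp add: v_def norm_mult)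
      have "h i * exp (- ((s + w) * of_real (l i)))
        - h i * exp (- (s * of_real (l i))) - w * (- of_real (l i) * h i * exp (- (s * of_real (l i))))
        = h i * exp (- (s * of_real (l i))) * (exp v - (\<Sum>j\<le>1. v ^ j / fact j))"
        by (simp add: v_def algebra_simps exp_add[symmetric] exp_diff exp_minus divide_inverse)
      also have "norm \<dots> = norm (h i) * exp (- (Re s * l i)) * norm (exp v - (\<Sum>j\<le>1. v ^ j / fact j))"
        by (simp add: norm_mult)
      also have "\<dots> \<le> norm (h i) * exp (- (Re s * l i)) * (exp (norm v) * norm v ^ Suc 1 / fact 1)"
        by (intro mult_left_mono Taylor_exp_field) auto
      also have "\<dots> = norm w ^ 2 * (l i ^ 2 * norm (h i)) * (exp (- (Re s * l i)) * exp (norm w * l i))"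
        unfolding nv by (simp add: power2_eq_square algebra_simps)
      also have "\<dots> \<le> norm w ^ 2 * (l i ^ 2 * norm (h i)) * exp (- ((Re s - d) * l i))"
      proof (intro mult_left_mono)
        have "norm w * l i \<le> d * l i" using w l0[OF i] by (intro mult_right_mono) auto
        then show "exp (- (Re s * l i)) * exp (norm w * l i) \<le> exp (- ((Re s - d) * l i))"
          by (simp add: exp_add[symmetric] algebra_simps)
      qed auto
      finally show "norm (h i * exp (- ((s + w) * of_real (l i)))
        - h i * exp (- (s * of_real (l i))) - w * (- of_real (l i) * h i * exp (- (s * of_real (l i)))))
        \<le> norm w ^ 2 * (norm ((- of_real (l i)) ^ 2 * h i) * exp (- ((Re s - d) * l i)))"
        by (simp add: norm_mult norm_power mult.assoc)
    qed
    also have "\<dots> = norm w ^ 2 * A" unfolding A_def by (rule integral_mult_right_zero)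
    finally show ?thesis .
  qed
  have "(\<lambda>w. (F (s + w) - F s) / w - F') \<midarrow>0\<rightarrow> 0"
  proof (rule Lim_null_comparison)
    show "\<forall>\<^sub>F w in at 0. norm ((F (s + w) - F s) / w - F') \<le> norm w * A"
      unfolding eventually_at
    proof (intro exI[of _ d] conjI ballI impI d)
      fix w :: complex assume "w \<noteq> 0 \<and> dist w 0 < d"
      then have w: "w \<noteq> 0" "norm w < d" by auto
      have "(F (s + w) - F s) / w - F' = (F (s + w) - F s - w * F') / w"
        using w by (simp add: field_simps)
      also have "norm \<dots> \<le> norm w ^ 2 * A / norm w"
        unfolding norm_divide using main[OF w(2)] by (intro divide_right_mono) auto
      finally show "norm ((F (s + w) - F s) / w - F') \<le> norm w * A"
        using w by (simp add: power2_eq_square)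
    qed
    show "((\<lambda>w::complex. norm w * A) \<longlongrightarrow> 0) (at 0)"
      by (intro tendsto_mult_left_zero tendsto_norm_zero tendsto_ident_at)
  qed
  then have "(\<lambda>w. (F (s + w) - F s) / w) \<midarrow>0\<rightarrow> F'" by (rule LIM_zero_cancel)
  then have "(F has_field_derivative F') (at s)" by (simp only: DERIV_def)
  then show ?thesis by (simp only: F_def F'_def)
qed

lemma higher_deriv_laplace:
  fixes h :: "'a \<Rightarrow> complex" and l :: "'a \<Rightarrow> real"
  assumes [measurable]: "l \<in> borel_measurable M" "h \<in> borel_measurable M"
    and l0: "\<And>i. i \<in> space M \<Longrightarrow> 0 \<le> l i"
    and int: "\<And>x. x0 < x \<Longrightarrow> integrable M (\<lambda>i. norm (h i) * exp (- (x * l i)))"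
    and s: "x0 < Re s"
  shows "(deriv ^^ k) (\<lambda>s. \<integral>i. h i * exp (- (s * of_real (l i))) \<partial>M) s
      = (\<integral>i. (- of_real (l i)) ^ k * h i * exp (- (s * of_real (l i))) \<partial>M)"
proof -
  define F where "F = (\<lambda>k s. \<integral>i. ((- of_real (l i)) ^ k * h i) * exp (- (s * of_real (l i))) \<partial>M)"
  have "(deriv ^^ k) (F 0) s = F k s"
  proof (rule higher_deriv_eqI[of "{s. x0 < Re s}"])
    fix k s assume s: "s \<in> {s. x0 < Re s}"
    have "(F k has_field_derivative
      (\<integral>i. - of_real (l i) * ((- of_real (l i)) ^ k * h i) * exp (- (s * of_real (l i))) \<partial>M)) (at s)"
      unfolding F_def
      by (rule has_field_derivative_laplace[where ?x0.0 = x0])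
        (use l0 s integrable_laplace_power[of l M h x0, OF _ _ l0 int] in auto)
    then show "(F k has_field_derivative F (Suc k) s) (at s)"
      by (simp add: F_def mult.assoc)
  qed (use s in \<open>auto simp: open_halfspace_Re_gt\<close>)
  then show ?thesis by (simp add: F_def)
qed

lemma holomorphic_laplace:
  fixes h :: "'a \<Rightarrow> complex" and l :: "'a \<Rightarrow> real"
  assumes [measurable]: "l \<in> borel_measurable M" "h \<in> borel_measurable M"
    and l0: "\<And>i. i \<in> space M \<Longrightarrow> 0 \<le> l i"
    and int: "\<And>x. x0 < x \<Longrightarrow> integrable M (\<lambda>i. norm (h i) * exp (- (x * l i)))"
  shows "(\<lambda>s. \<integral>i. h i * exp (- (s * of_real (l i))) \<partial>M) holomorphic_on {s. x0 < Re s}"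
  unfolding holomorphic_on_open[OF open_halfspace_Re_gt]
  using has_field_derivative_laplace[of l M h x0, OF assms(1,2) l0 int] by blast

section \<open>The Fejer kernel\<close>

text \<open>
  Up to normalization, the Fourier transform of the tent function \<open>max 0 (1 - |v|)\<close>. The tent has
  compact support, so that averaging against it is local; its transform is integrable, so that
  Fubini's theorem applies to it.
\<close>

definition fejer :: "real \<Rightarrow> real" where
  "fejer t = (1 - cos t) / t\<^sup>2"

lemma fejer_measurable [measurable]: "fejer \<in> borel_measurable borel"
  unfolding fejer_def by measurable

lemma fejer_nonneg: "0 \<le> fejer t"
  by (simp add: fejer_def)

text \<open>
  Integration by parts reduces the integral to that of \<open>sin t / t\<close>, whose primitive is \<open>Si\<close>.
\<close>

lemma fejer_half_line:
  "set_integrable lborel {0<..} fejer" "(LINT t:{0<..}|lborel. fejer t) = pi / 2"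
proof -
  define F where "F = (\<lambda>t. Si t - (1 - cos t) / t)"
  have lim0: "((\<lambda>t. (1 - cos t) / t) \<longlongrightarrow> (0::real)) (at_right 0)"
    by real_asymp
  have limInf: "((\<lambda>t. (1 - cos t) / t) \<longlongrightarrow> (0::real)) at_top"
    by real_asymp
  have Si0: "(Si \<longlongrightarrow> 0) (at_right 0)"
    using isCont_Si[of 0] Si_neg[of 0] by (simp add: isCont_def filterlim_at_split)
  have A: "((F \<circ> real_of_ereal) \<longlongrightarrow> 0) (at_right 0)"
    unfolding zero_ereal_def ereal_tendsto_simps F_def
    using tendsto_diff[OF Si0 lim0] by simp
  have B: "((F \<circ> real_of_ereal) \<longlongrightarrow> pi / 2) (at_left \<infinity>)"
    unfolding ereal_tendsto_simps F_def
    using tendsto_diff[OF Si_at_top limInf] by simp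
  have der: "DERIV F x :> fejer x" if "0 < ereal x" for x
  proof -
    have x: "0 < x" using that by simp
    have "sinc x = sin x / x" using x by simp
    then show ?thesis
      unfolding F_def fejer_def using x
      by (auto intro!: derivative_eq_intros DERIV_Si simp: field_simps power2_eq_square)
  qed
  have cont: "isCont fejer x" if "0 < ereal x" for x
    unfolding fejer_def using that by (auto intro!: continuous_intros)
  note * = interval_integral_FTC_nonneg[of 0 \<infinity> F fejer, OF _ der cont _ A B]
  have e: "einterval 0 \<infinity> = {0<..}" by (auto simp: einterval_def zero_ereal_def)
  show "set_integrable lborel {0<..} fejer"
    using *(1) by (simp add: e fejer_nonneg)
  show "(LINT t:{0<..}|lborel. fejer t) = pi / 2"
    using *(2) by (simp add: interval_lebesgue_integral_def e fejer_nonneg zero_ereal_def)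
qed

lemma has_bochner_integral_fejer: "has_bochner_integral lborel fejer pi"
proof -
  define G where "G = (\<lambda>t. indicator {0<..} t *\<^sub>R fejer t)"
  have G: "has_bochner_integral lborel G (pi/2)"
    using fejer_half_line unfolding set_integrable_def set_lebesgue_integral_def G_def
    by (simp add: has_bochner_integral_iff)
  then have "has_bochner_integral lborel (\<lambda>t. G (0 + (-1) * t)) (pi/2)"
    using lborel_has_bochner_integral_real_affine_iff[of "-1" G "pi/2" 0] by simp
  from has_bochner_integral_add[OF G this]
  have "has_bochner_integral lborel (\<lambda>t. G t + G (- t)) pi" by simp
  moreover have "(\<lambda>t. G t + G (- t)) = fejer"
    by (auto simp: G_def fejer_def fun_eq_iff indicator_def)
  ultimately show ?thesis by simp
qed

lemma has_bochner_integral_cos_kernel: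
  "has_bochner_integral lborel (\<lambda>t. (1 - cos (a * t)) / t\<^sup>2) (pi * \<bar>a\<bar>)"
proof (cases "a = 0")
  case False
  have "has_bochner_integral lborel (\<lambda>t. fejer (0 + a * t)) (pi /\<^sub>R \<bar>a\<bar>)"
    using has_bochner_integral_fejer lborel_has_bochner_integral_real_affine_iff[OF False] by blast
  then have "has_bochner_integral lborel (\<lambda>t. a\<^sup>2 * fejer (0 + a * t)) (a\<^sup>2 * (pi /\<^sub>R \<bar>a\<bar>))"
    by (rule has_bochner_integral_mult_right) 
  moreover have "a\<^sup>2 * (pi /\<^sub>R \<bar>a\<bar>) = pi * \<bar>a\<bar>"
    using False by (simp add: field_simps power2_eq_square)
  moreover have "(\<lambda>t. a\<^sup>2 * fejer (0 + a * t)) = (\<lambda>t. (1 - cos (a * t)) / t\<^sup>2)"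
    using False by (simp add: fejer_def fun_eq_iff power_mult_distrib)
  ultimately show ?thesis by (simp only:)
qed (simp add: has_bochner_integral_zero)

text \<open>
  The product \<open>(1 - cos t) * cos (t * v)\<close> is a combination of terms \<open>1 - cos (a * t)\<close> with
  \<open>a = 1 + v\<close>, \<open>a = 1 - v\<close> and \<open>a = v\<close>, and the second difference of \<open>|v|\<close> is the tent.
\<close>

lemma has_bochner_integral_fejer_cos:
  "has_bochner_integral lborel (\<lambda>t. fejer t * cos (t * v)) (pi * max 0 (1 - \<bar>v\<bar>))"
proof -
  define k where "k = (\<lambda>a t::real. (1 - cos (a * t)) / t\<^sup>2)"
  have k: "has_bochner_integral lborel (k a) (pi * \<bar>a\<bar>)" for a
    unfolding k_def by (rule has_bochner_integral_cos_kernel)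
  have "has_bochner_integral lborel (\<lambda>t. (1/2) * k (1 + v) t + (1/2) * k (1 - v) t - k v t)
     ((1/2) * (pi * \<bar>1 + v\<bar>) + (1/2) * (pi * \<bar>1 - v\<bar>) - pi * \<bar>v\<bar>)"
    by (intro has_bochner_integral_add has_bochner_integral_diff has_bochner_integral_mult_right k)
  moreover have "(1/2) * (pi * \<bar>1 + v\<bar>) + (1/2) * (pi * \<bar>1 - v\<bar>) - pi * \<bar>v\<bar> = pi * max 0 (1 - \<bar>v\<bar>)"
    by (auto simp: abs_if max_def field_simps)
  moreover have "(\<lambda>t. (1/2) * k (1 + v) t + (1/2) * k (1 - v) t - k v t) = (\<lambda>t. fejer t * cos (t * v))"
  proof
    fix t
    have "cos ((1 + v) * t) + cos ((1 - v) * t) = 2 * cos t * cos (t * v)"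
      using cos_times_cos[of t "t * v"] by (simp add: field_simps)
    moreover have "cos (v * t) = cos (t * v)" by (simp add: mult.commute)
    moreover have "(1 - cos t) * cos (t * v) = cos (t * v) - cos t * cos (t * v)"
      by (simp add: left_diff_distrib)
    ultimately have "(1 - cos ((1 + v) * t)) / 2 + (1 - cos ((1 - v) * t)) / 2 - (1 - cos (v * t))
        = (1 - cos t) * cos (t * v)"
      by (simp only: mult.assoc) argo
    moreover have "(1/2) * k (1 + v) t + (1/2) * k (1 - v) t - k v t
        = ((1 - cos ((1 + v) * t)) / 2 + (1 - cos ((1 - v) * t)) / 2 - (1 - cos (v * t))) / t\<^sup>2"
      by (simp add: k_def add_divide_distrib diff_divide_distrib)
    ultimately show "(1/2) * k (1 + v) t + (1/2) * k (1 - v) t - k v t = fejer t * cos (t * v)"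
      by (simp add: fejer_def)
  qed
  ultimately show ?thesis by simp
qed

lemma has_bochner_integral_fejer_exp:
  assumes "0 < d"
  shows "has_bochner_integral lborel (\<lambda>t. of_real (fejer (d * t)) * exp (\<i> * of_real (t * v)))
           (complex_of_real (pi / d * max 0 (1 - \<bar>v\<bar> / d)))"
proof -
  define c where "c = (\<lambda>t. fejer t * cos (t * (v / d)))"
  define s where "s = (\<lambda>t. fejer t * sin (t * (v / d)))"
  have c: "has_bochner_integral lborel c (pi * max 0 (1 - \<bar>v / d\<bar>))"
    unfolding c_def by (rule has_bochner_integral_fejer_cos)
  have int_s: "integrable lborel s"
  proof (rule Bochner_Integration.integrable_bound)
    show "integrable lborel fejer" using has_bochner_integral_fejer by (rule integrable.intros)
    have "norm (s t) \<le> norm (fejer t)" for t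
    proof -
      have "norm (s t) = fejer t * \<bar>sin (t * (v / d))\<bar>" by (simp add: s_def abs_mult fejer_nonneg)
      also have "\<dots> \<le> fejer t * 1" by (intro mult_left_mono fejer_nonneg) simp
      finally show ?thesis by (simp add: fejer_nonneg)
    qed
    then show "AE t in lborel. norm (s t) \<le> norm (fejer t)" by simp
  qed (simp add: s_def)
  have odd: "s (0 + (-1) * t) = - s t" for t by (simp add: s_def fejer_def)
  have "integral\<^sup>L lborel s = \<bar>-1\<bar> *\<^sub>R (\<integral>t. s (0 + (-1) * t) \<partial>lborel)"
    by (rule lborel_integral_real_affine) simp
  then have "integral\<^sup>L lborel s = 0" unfolding odd by simp
  then have s: "has_bochner_integral lborel s 0"
    using int_s by (simp add: has_bochner_integral_iff)
  define cs where "cs = (\<lambda>t. complex_of_real (c t) + \<i> * complex_of_real (s t))"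
  define V where "V = complex_of_real (pi * max 0 (1 - \<bar>v / d\<bar>)) + \<i> * complex_of_real 0"
  have "has_bochner_integral lborel cs V"
    unfolding cs_def V_def
    by (intro has_bochner_integral_add has_bochner_integral_mult_right has_bochner_integral_of_real c s)
  then have "has_bochner_integral lborel (\<lambda>t. cs (0 + d * t)) (V /\<^sub>R \<bar>d\<bar>)"
    using lborel_has_bochner_integral_real_affine_iff[of d cs V 0] assms by auto
  moreover have "(\<lambda>t. cs (0 + d * t)) = (\<lambda>t. of_real (fejer (d * t)) * exp (\<i> * of_real (t * v)))"
    using assms by (auto simp: fun_eq_iff cs_def c_def s_def complex_eq_iff Re_exp Im_exp)
  moreover have "V /\<^sub>R \<bar>d\<bar> = complex_of_real (pi / d * max 0 (1 - \<bar>v\<bar> / d))"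
    using assms by (simp add: V_def scaleR_conv_of_real divide_inverse abs_mult mult_ac)
  ultimately show ?thesis by (simp only:)
qed

text \<open>
  A bound for the Fourier transform of \<open>g\<close> bounds the average of \<open>g\<close> against every tent, whatever
  its width. By Fubini the average is the integral of the Fourier transform against the Fejer kernel,
  whose total mass is \<open>pi / d\<close>, and the same factor \<open>pi / d\<close> multiplies the tent.
\<close>

lemma fejer_mean_bound:
  fixes g :: "real \<Rightarrow> complex"
  assumes g: "integrable lborel g" and d: "0 < d"
    and B: "\<And>t. norm (\<integral>u. g u * exp (- (\<i> * of_real (t * u))) \<partial>lborel) \<le> B"
  shows "norm (\<integral>u. g u * of_real (max 0 (1 - \<bar>y - u\<bar> / d)) \<partial>lborel) \<le> B"
proof -
  have [measurable]: "g \<in> borel_measurable lborel" using g by (rule borel_measurable_integrable)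
  define \<Phi> where "\<Phi> = (\<lambda>t u. of_real (fejer (d * t)) * exp (\<i> * of_real (t * (y - u))) * g u)"
  have fej: "has_bochner_integral lborel (\<lambda>t. fejer (d * t)) (pi / d)"
    using lborel_has_bochner_integral_real_affine_iff[of d fejer pi 0] has_bochner_integral_fejer d
    by (simp add: field_simps)
  then have fej_int: "integrable lborel (\<lambda>t. fejer (d * t))" by (rule integrable.intros)
  have meas: "(\<lambda>(t, u). \<Phi> t u) \<in> borel_measurable (lborel \<Otimes>\<^sub>M lborel)"
    unfolding \<Phi>_def by measurable
  have norm: "norm (\<Phi> t u) = fejer (d * t) * norm (g u)" for t u
    by (simp add: \<Phi>_def norm_mult fejer_nonneg)
  have prod: "integrable (lborel \<Otimes>\<^sub>M lborel) (\<lambda>(t, u). \<Phi> t u)"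
  proof (rule lborel_pair.Fubini_integrable[OF meas])
    have "(\<lambda>t. \<integral>u. norm (\<Phi> t u) \<partial>lborel) = (\<lambda>t. fejer (d * t) * (\<integral>u. norm (g u) \<partial>lborel))"
      unfolding norm by simp
    then show "integrable lborel (\<lambda>t. \<integral>u. norm (case (t, u) of (t, u) \<Rightarrow> \<Phi> t u) \<partial>lborel)"
      using fej_int by simp
    show "AE t in lborel. integrable lborel (\<lambda>u. case (t, u) of (t, u) \<Rightarrow> \<Phi> t u)"
    proof (rule AE_I2)
      fix t
      show "integrable lborel (\<lambda>u. case (t, u) of (t, u) \<Rightarrow> \<Phi> t u)"
      proof (rule Bochner_Integration.integrable_bound)
        show "integrable lborel (\<lambda>u. fejer (d * t) * norm (g u))"
          using g by (intro integrable_mult_right integrable_norm)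
      qed (auto simp: norm abs_mult fejer_nonneg, auto simp: \<Phi>_def)
    qed
  qed
  have "(\<integral>u. (\<integral>t. \<Phi> t u \<partial>lborel) \<partial>lborel) = (\<integral>t. (\<integral>u. \<Phi> t u \<partial>lborel) \<partial>lborel)"
    by (rule lborel_pair.Fubini_integral[OF prod])
  also have "(\<lambda>u. \<integral>t. \<Phi> t u \<partial>lborel) = (\<lambda>u. of_real (pi / d) * (g u * of_real (max 0 (1 - \<bar>y - u\<bar> / d))))"
  proof
    fix u
    have "(\<integral>t. \<Phi> t u \<partial>lborel) = of_real (pi / d * max 0 (1 - \<bar>y - u\<bar> / d)) * g u"
      unfolding \<Phi>_def using has_bochner_integral_fejer_exp[OF d, of "y - u"]
      by (simp only: integral_mult_left_zero has_bochner_integral_integral_eq)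
    then show "(\<integral>t. \<Phi> t u \<partial>lborel) = of_real (pi / d) * (g u * of_real (max 0 (1 - \<bar>y - u\<bar> / d)))"
      by (simp only: of_real_mult mult_ac)
  qed
  also have "(\<lambda>t. \<integral>u. \<Phi> t u \<partial>lborel) = (\<lambda>t. of_real (fejer (d * t)) * exp (\<i> * of_real (t * y)) *
       (\<integral>u. g u * exp (- (\<i> * of_real (t * u))) \<partial>lborel))"
  proof
    fix t
    have "\<Phi> t u = of_real (fejer (d * t)) * exp (\<i> * of_real (t * y)) * (g u * exp (- (\<i> * of_real (t * u))))" for u
      by (simp add: \<Phi>_def algebra_simps exp_diff exp_minus divide_inverse)
    then show "(\<integral>u. \<Phi> t u \<partial>lborel) = of_real (fejer (d * t)) * exp (\<i> * of_real (t * y)) *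
       (\<integral>u. g u * exp (- (\<i> * of_real (t * u))) \<partial>lborel)"
      by (simp only: integral_mult_right_zero)
  qed
  finally have eq: "of_real (pi / d) * (\<integral>u. g u * of_real (max 0 (1 - \<bar>y - u\<bar> / d)) \<partial>lborel) =
     (\<integral>t. of_real (fejer (d * t)) * exp (\<i> * of_real (t * y)) *
       (\<integral>u. g u * exp (- (\<i> * of_real (t * u))) \<partial>lborel) \<partial>lborel)"
    by (simp only: integral_mult_right_zero)
  have "pi / d * norm (\<integral>u. g u * of_real (max 0 (1 - \<bar>y - u\<bar> / d)) \<partial>lborel) =
     norm (of_real (pi / d) * (\<integral>u. g u * of_real (max 0 (1 - \<bar>y - u\<bar> / d)) \<partial>lborel))"
    using d by (simp only: norm_mult norm_of_real) simp
  also have "\<dots> \<le> (\<integral>t. fejer (d * t) * B \<partial>lborel)"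
    unfolding eq
  proof (rule norm_integral_le_integral)
    show "integrable lborel (\<lambda>t. fejer (d * t) * B)" using fej_int by simp
    have "integrable lborel (\<lambda>t. \<integral>u. \<Phi> t u \<partial>lborel)"
      using lborel_pair.integrable_fst[OF prod] by simp
    then show "integrable lborel (\<lambda>t. of_real (fejer (d * t)) * exp (\<i> * of_real (t * y)) *
       (\<integral>u. g u * exp (- (\<i> * of_real (t * u))) \<partial>lborel))"
    proof -
      have "\<Phi> t u = of_real (fejer (d * t)) * exp (\<i> * of_real (t * y)) * (g u * exp (- (\<i> * of_real (t * u))))" for t u
        by (simp add: \<Phi>_def algebra_simps exp_diff exp_minus divide_inverse)
      then have "(\<integral>u. \<Phi> t u \<partial>lborel) = of_real (fejer (d * t)) * exp (\<i> * of_real (t * y)) *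
       (\<integral>u. g u * exp (- (\<i> * of_real (t * u))) \<partial>lborel)" for t
        by (simp only: integral_mult_right_zero)
      with \<open>integrable lborel (\<lambda>t. \<integral>u. \<Phi> t u \<partial>lborel)\<close> show ?thesis by simp
    qed
    fix t
    show "norm (of_real (fejer (d * t)) * exp (\<i> * of_real (t * y)) *
       (\<integral>u. g u * exp (- (\<i> * of_real (t * u))) \<partial>lborel)) \<le> fejer (d * t) * B"
      using B[of t] fejer_nonneg[of "d * t"] by (simp add: norm_mult mult_left_mono)
  qed
  also have "\<dots> = pi / d * B"
    using fej by (simp add: has_bochner_integral_integral_eq)
  finally show ?thesis using d by (simp add: field_simps)
qed

section \<open>Dirichlet series with nonnegative weights\<close>

lemma has_bochner_integral_exp_tail:
  fixes s :: complex and l :: real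
  assumes s: "0 < Re s"
  shows "has_bochner_integral lborel (\<lambda>u. indicator {l..} u *\<^sub>R exp (- (s * of_real u))) (exp (- (s * of_real l)) / s)"
proof -
  have e: "einterval l \<infinity> = {l<..}" by (auto simp: einterval_def)
  have s0: "s \<noteq> 0" using s by auto
  define x where "x = Re s"
  have x: "0 < x" using s by (simp add: x_def)
  define F where "F = (\<lambda>u. - exp (- (x * u)) / x)"
  have lim1: "((F \<circ> real_of_ereal) \<longlongrightarrow> F l) (at_right (ereal l))"
    unfolding ereal_tendsto_simps F_def using x by (auto intro!: tendsto_eq_intros)
  have lim_exp: "((\<lambda>u. exp (- (x * u))) \<longlongrightarrow> 0) at_top"
    using x by real_asymp
  then have "(F \<longlongrightarrow> - 0 / x) at_top"
    unfolding F_def using x by (intro tendsto_intros) auto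
  then have lim2: "((F \<circ> real_of_ereal) \<longlongrightarrow> 0) (at_left \<infinity>)"
    unfolding ereal_tendsto_simps by simp
  have real_int: "set_integrable lborel (einterval l \<infinity>) (\<lambda>u. exp (- (x * u)))"
  proof (rule interval_integral_FTC_nonneg(1)[OF _ _ _ _ lim1 lim2])
    show "DERIV F u :> exp (- (x * u))" for u
      unfolding F_def using x by (auto intro!: derivative_eq_intros)
  qed auto
  have cint: "set_integrable lborel (einterval l \<infinity>) (\<lambda>u. exp (- (s * complex_of_real u)))"
    unfolding set_integrable_def
  proof (rule Bochner_Integration.integrable_bound)
    show "integrable lborel (\<lambda>u. indicator (einterval l \<infinity>) u *\<^sub>R exp (- (x * u)))"
      using real_int by (simp add: set_integrable_def)
  qed (auto simp: x_def e indicator_def)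
  define G where "G = (\<lambda>u. - exp (- (s * complex_of_real u)) / s)"
  have lim3: "((G \<circ> real_of_ereal) \<longlongrightarrow> G l) (at_right (ereal l))"
    unfolding ereal_tendsto_simps G_def using s0 by (auto intro!: tendsto_eq_intros)
  have "((\<lambda>u. exp (- (s * complex_of_real u))) \<longlongrightarrow> 0) at_top"
    by (rule tendsto_norm_zero_cancel) (use lim_exp in \<open>simp add: x_def\<close>)
  then have "(G \<longlongrightarrow> - 0 / s) at_top"
    unfolding G_def using s0 by (intro tendsto_intros) auto
  then have lim4: "((G \<circ> real_of_ereal) \<longlongrightarrow> 0) (at_left \<infinity>)"
    unfolding ereal_tendsto_simps by simp
  have "(LBINT u=l..\<infinity>. exp (- (s * complex_of_real u))) = 0 - G l"
  proof (rule interval_integral_FTC_integrable[OF _ _ _ cint lim3 lim4])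
    show "(G has_vector_derivative exp (- (s * complex_of_real u))) (at u)" for u
      unfolding G_def using s0
      by (auto intro!: derivative_eq_intros has_vector_derivative_real_field simp: field_simps)
  qed (auto intro!: continuous_intros)
  then have val: "(\<integral>u. indicator {l<..} u *\<^sub>R exp (- (s * complex_of_real u)) \<partial>lborel) = exp (- (s * of_real l)) / s"
    by (simp add: interval_lebesgue_integral_def set_lebesgue_integral_def e G_def)
  have int: "integrable lborel (\<lambda>u. indicator {l<..} u *\<^sub>R exp (- (s * complex_of_real u)))"
    using cint by (simp add: set_integrable_def e)
  have ae: "AE u in lborel. indicator {l<..} u *\<^sub>R exp (- (s * complex_of_real u)) = indicator {l..} u *\<^sub>R exp (- (s * complex_of_real u))"
    using AE_lborel_singleton[of l] by eventually_elim (auto simp: indicator_def)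
  show ?thesis
    using val int ae
    by (subst has_bochner_integral_cong_AE[of _ _ "\<lambda>u. indicator {l<..} u *\<^sub>R exp (- (s * complex_of_real u))"])
       (auto simp: has_bochner_integral_iff)
qed

lemma has_bochner_integral_exp_tail_real:
  fixes x l :: real
  assumes "0 < x"
  shows "has_bochner_integral lborel (\<lambda>u. indicator {l..} u * exp (- (x * u))) (exp (- (x * l)) / x)"
proof -
  have "has_bochner_integral lborel (\<lambda>u. complex_of_real (indicator {l..} u * exp (- (x * u)))) (complex_of_real (exp (- (x * l)) / x))"
    using has_bochner_integral_exp_tail[of "of_real x" l] assms
    by (simp add: scaleR_conv_of_real exp_of_real[symmetric])
  from has_bochner_integral_Re[OF this] show ?thesis by (simp only: Re_complex_of_real)
qed

text \<open>
  A general Dirichlet series \<open>\<Sum> w i * n i powr -s\<close> with \<open>l i = ln (n i)\<close>. The abstract index set lets the same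
  number occur several times.
\<close>

definition dirichlet :: "'a set \<Rightarrow> ('a \<Rightarrow> real) \<Rightarrow> ('a \<Rightarrow> real) \<Rightarrow> complex \<Rightarrow> complex" where
  "dirichlet I w l s = (\<Sum>\<^sub>ai\<in>I. of_real (w i) * exp (- (s * of_real (l i))))"

definition dirichlet_summable :: "'a set \<Rightarrow> ('a \<Rightarrow> real) \<Rightarrow> ('a \<Rightarrow> real) \<Rightarrow> real \<Rightarrow> bool" where
  "dirichlet_summable I w l x \<longleftrightarrow> Infinite_Set_Sum.abs_summable_on (\<lambda>i. w i * exp (- (x * l i))) I"

locale nonneg_dirichlet =
  fixes I :: "'a set" and w l :: "'a \<Rightarrow> real"
  assumes countable_index: "countable I"
    and weight_nonneg: "\<And>i. i \<in> I \<Longrightarrow> 0 \<le> w i"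
    and log_nonneg: "\<And>i. i \<in> I \<Longrightarrow> 0 \<le> l i"
begin

lemma summable_iff:
  "dirichlet_summable I w l x \<longleftrightarrow> integrable (count_space I) (\<lambda>i. norm (complex_of_real (w i)) * exp (- (x * l i)))"
  unfolding dirichlet_summable_def abs_summable_on_def
  by (rule Bochner_Integration.integrable_cong[OF refl]) (auto simp: weight_nonneg)

lemma dirichlet_holomorphic:
  assumes "\<And>x. x0 < x \<Longrightarrow> dirichlet_summable I w l x"
  shows "dirichlet I w l holomorphic_on {s. x0 < Re s}"
  unfolding dirichlet_def infsetsum_def
  by (rule holomorphic_laplace) (use assms log_nonneg in \<open>auto simp: summable_iff\<close>)

lemma dirichlet_has_derivative:
  assumes "\<And>x. x0 < x \<Longrightarrow> dirichlet_summable I w l x" "x0 < Re s"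
  shows "(dirichlet I w l has_field_derivative - dirichlet I (\<lambda>i. l i * w i) l s) (at s)"
proof -
  have "(dirichlet I w l has_field_derivative
    (\<integral>i. - of_real (l i) * of_real (w i) * exp (- (s * of_real (l i))) \<partial>count_space I)) (at s)"
    unfolding dirichlet_def infsetsum_def
    by (rule has_field_derivative_laplace[where ?x0.0 = x0]) (use assms log_nonneg in \<open>auto simp: summable_iff\<close>)
  then show ?thesis by (simp add: dirichlet_def infsetsum_def)
qed

lemma summable_log_weight:
  assumes "\<And>x. x0 < x \<Longrightarrow> dirichlet_summable I w l x" "x0 < x"
  shows "dirichlet_summable I (\<lambda>i. l i * w i) l x"
proof -
  have "integrable (count_space I) (\<lambda>i. norm (- of_real (l i) * complex_of_real (w i)) * exp (- (x * l i)))"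
    by (rule integrable_laplace_mult[where ?x0.0 = x0]) (use assms log_nonneg in \<open>auto simp: summable_iff\<close>)
  also have "?this \<longleftrightarrow> dirichlet_summable I (\<lambda>i. l i * w i) l x"
    unfolding dirichlet_summable_def abs_summable_on_def
    by (rule Bochner_Integration.integrable_cong[OF refl]) (auto simp: weight_nonneg log_nonneg norm_mult)
  finally show ?thesis .
qed

lemma dirichlet_of_real:
  "dirichlet I w l (of_real x) = of_real (\<Sum>\<^sub>ai\<in>I. w i * exp (- (x * l i)))"
  unfolding dirichlet_def by (subst infsetsum_of_real[symmetric]) (simp_all add: exp_of_real[symmetric])

lemma Re_dirichlet_of_real: "dirichlet I w l (of_real x) = of_real (Re (dirichlet I w l (of_real x)))"
  by (simp add: dirichlet_of_real)

lemma Re_dirichlet_nonneg: "0 \<le> Re (dirichlet I w l (of_real x))"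
  by (auto simp: dirichlet_of_real weight_nonneg intro!: infsetsum_nonneg)

lemma norm_dirichlet_le:
  assumes "dirichlet_summable I w l (Re s)"
  shows "norm (dirichlet I w l s) \<le> Re (dirichlet I w l (of_real (Re s)))"
proof -
  have "norm (dirichlet I w l s) \<le> (\<Sum>\<^sub>ai\<in>I. norm (of_real (w i) * exp (- (s * of_real (l i)))))"
    unfolding dirichlet_def by (rule norm_infsetsum_bound)
  also have "\<dots> = (\<Sum>\<^sub>ai\<in>I. w i * exp (- (Re s * l i)))"
    by (rule infsetsum_cong) (auto simp: norm_mult weight_nonneg)
  finally show ?thesis by (simp add: dirichlet_of_real)
qed

lemma Re_dirichlet_antimono:
  assumes "dirichlet_summable I w l x" "dirichlet_summable I w l y" "x \<le> y"
  shows "Re (dirichlet I w l (of_real y)) \<le> Re (dirichlet I w l (of_real x))"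
  unfolding dirichlet_of_real Re_complex_of_real
  using assms by (intro infsetsum_mono)
    (auto simp: dirichlet_summable_def intro!: mult_left_mono weight_nonneg mult_right_mono log_nonneg)

end

definition summatory :: "'a set \<Rightarrow> ('a \<Rightarrow> real) \<Rightarrow> ('a \<Rightarrow> real) \<Rightarrow> real \<Rightarrow> real" where
  "summatory I w l u = (\<Sum>i | i \<in> I \<and> l i \<le> u. w i)"

locale discrete_dirichlet = nonneg_dirichlet +
  assumes finite_le: "\<And>u. finite {i \<in> I. l i \<le> u}"
begin

lemma summatory_nonneg: "0 \<le> summatory I w l u"
  unfolding summatory_def by (intro sum_nonneg) (auto simp: weight_nonneg)

lemma mono_summatory: "mono (summatory I w l)"
  unfolding summatory_def using finite_le
  by (intro monoI sum_mono2) (auto simp: weight_nonneg)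

lemma measurable_summatory [measurable]: "summatory I w l \<in> borel_measurable borel"
  by (rule borel_measurable_mono[OF mono_summatory])

text \<open>
  Divided by \<open>x\<close>, a finite partial sum is the integral of a finite sum of truncated exponentials, and
  this sum is at most the summatory function times \<open>exp (- x * u)\<close>.
\<close>

lemma summable_of_summatory_bound:
  assumes C: "\<And>u. 0 \<le> u \<Longrightarrow> summatory I w l u \<le> C * exp u" and x: "1 < x"
  shows "dirichlet_summable I w l x"
  unfolding dirichlet_summable_def
proof (rule abs_summable_finite_sumsI)
  fix F assume F: "finite F" "F \<subseteq> I"
  define g where "g = (\<lambda>u. C * (indicator {0..} u * exp (- ((x - 1) * u))))"
  have g: "has_bochner_integral lborel g (C * (exp (- ((x - 1) * 0)) / (x - 1)))"
    unfolding g_def using x by (intro has_bochner_integral_mult_right has_bochner_integral_exp_tail_real) auto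
  define h where "h = (\<lambda>u. \<Sum>i\<in>F. w i * (indicator {l i..} u * exp (- (x * u))))"
  have h: "has_bochner_integral lborel h (\<Sum>i\<in>F. w i * (exp (- (x * l i)) / x))"
    unfolding h_def using x
    by (intro has_bochner_integral_sum has_bochner_integral_mult_right has_bochner_integral_exp_tail_real) auto
  have "h u \<le> g u" for u
  proof (cases "0 \<le> u")
    case True
    have "h u = (\<Sum>i\<in>F. if l i \<le> u then w i else 0) * exp (- (x * u))"
      unfolding h_def sum_distrib_right by (intro sum.cong) (auto simp: indicator_def)
    also have "(\<Sum>i\<in>F. if l i \<le> u then w i else 0) = sum w {i \<in> F. l i \<le> u}"
      using F(1) by (simp add: sum.inter_filter)
    also have "sum w {i \<in> F. l i \<le> u} \<le> summatory I w l u"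
      unfolding summatory_def using F finite_le by (intro sum_mono2) (auto simp: weight_nonneg)
    also have "summatory I w l u \<le> C * exp u" using C True by blast
    also have "C * exp u * exp (- (x * u)) = g u"
      using True by (simp add: g_def mult.assoc exp_add[symmetric] algebra_simps)
    finally show ?thesis by simp
  next
    case False
    have "h u = 0" unfolding h_def
    proof (intro sum.neutral ballI)
      fix i assume "i \<in> F"
      then have "0 \<le> l i" using F log_nonneg by auto
      then show "w i * (indicator {l i..} u * exp (- (x * u))) = 0" using False by simp
    qed
    then show ?thesis using False by (simp add: g_def)
  qed
  then have "(\<Sum>i\<in>F. w i * (exp (- (x * l i)) / x)) \<le> C * (exp (- ((x - 1) * 0)) / (x - 1))"
    using g h by (metis has_bochner_integral_iff integral_mono)
  then have "(\<Sum>i\<in>F. w i * exp (- (x * l i))) / x \<le> C / (x - 1)"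
    by (simp add: sum_divide_distrib)
  then have "(\<Sum>i\<in>F. w i * exp (- (x * l i))) \<le> C / (x - 1) * x"
    using x by (simp add: pos_divide_le_eq)
  moreover have "(\<Sum>i\<in>F. norm (w i * exp (- (x * l i)))) = (\<Sum>i\<in>F. w i * exp (- (x * l i)))"
    using F weight_nonneg by (intro sum.cong) auto
  ultimately show "(\<Sum>i\<in>F. norm (w i * exp (- (x * l i)))) \<le> C / (x - 1) * x" by simp
qed

text \<open>
  Partial summation: \<open>exp (- s * l) / s\<close> is the integral of \<open>exp (- s * u)\<close> over \<open>u \<ge> l\<close>, and summation
  and integration are exchanged.
\<close>

lemma dirichlet_eq_laplace:
  assumes sum: "dirichlet_summable I w l (Re s)" and s: "0 < Re s"
  shows "has_bochner_integral lborel (\<lambda>u. indicator {0..} u *\<^sub>R (of_real (summatory I w l u) * exp (- (s * of_real u))))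
           (dirichlet I w l s / s)"
proof -
  interpret A: sigma_finite_measure "count_space I"
    by (rule sigma_finite_measure_count_space_countable[OF countable_index])
  interpret P: pair_sigma_finite "count_space I" lborel ..
  define \<Phi> where "\<Phi> = (\<lambda>i u. complex_of_real (w i) * (indicator {l i..} u *\<^sub>R exp (- (s * of_real u))))"
  have meas: "(\<lambda>(i, u). \<Phi> i u) \<in> borel_measurable (count_space I \<Otimes>\<^sub>M lborel)"
    by (rule measurable_pair_measure_countable1[OF countable_index]) (simp add: \<Phi>_def)
  have inner: "has_bochner_integral lborel (\<Phi> i) (of_real (w i) * (exp (- (s * of_real (l i))) / s))" for i
    unfolding \<Phi>_def using s by (intro has_bochner_integral_mult_right has_bochner_integral_exp_tail)
  have norm: "(\<integral>u. norm (\<Phi> i u) \<partial>lborel) = w i * exp (- (Re s * l i)) / Re s" if "i \<in> I" for i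
  proof -
    have "(\<lambda>u. norm (\<Phi> i u)) = (\<lambda>u. w i * (indicator {l i..} u * exp (- (Re s * u))))"
      using weight_nonneg[OF that] by (auto simp: \<Phi>_def norm_mult fun_eq_iff)
    then show ?thesis
      using has_bochner_integral_mult_right[OF has_bochner_integral_exp_tail_real[OF s, of "l i"], of "w i"]
      by (simp only: has_bochner_integral_integral_eq times_divide_eq_right)
  qed
  have prod: "integrable (count_space I \<Otimes>\<^sub>M lborel) (\<lambda>(i, u). \<Phi> i u)"
  proof (rule P.Fubini_integrable[OF meas])
    have "integrable (count_space I) (\<lambda>i. w i * exp (- (Re s * l i)) / Re s)"
      using sum unfolding dirichlet_summable_def abs_summable_on_def by (rule integrable_divide)
    also have "?this \<longleftrightarrow> integrable (count_space I) (\<lambda>i. \<integral>u. norm (case (i, u) of (i, u) \<Rightarrow> \<Phi> i u) \<partial>lborel)"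
      by (rule Bochner_Integration.integrable_cong[OF refl]) (simp_all add: norm)
    finally show "integrable (count_space I) (\<lambda>i. \<integral>u. norm (case (i, u) of (i, u) \<Rightarrow> \<Phi> i u) \<partial>lborel)" .
    show "AE i in count_space I. integrable lborel (\<lambda>u. case (i, u) of (i, u) \<Rightarrow> \<Phi> i u)"
      using inner by (auto simp: has_bochner_integral_iff)
  qed
  have fiber: "(\<integral>i. \<Phi> i u \<partial>count_space I) = indicator {0..} u *\<^sub>R (of_real (summatory I w l u) * exp (- (s * of_real u)))" for u
  proof -
    have "(\<integral>i. \<Phi> i u \<partial>count_space I) = infsetsum (\<lambda>i. \<Phi> i u) I"
      by (simp add: infsetsum_def)
    also have "\<dots> = infsetsum (\<lambda>i. \<Phi> i u) {i \<in> I. l i \<le> u}"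
      by (rule infsetsum_cong_neutral) (auto simp: \<Phi>_def)
    also have "\<dots> = (\<Sum>i | i \<in> I \<and> l i \<le> u. \<Phi> i u)"
      by (rule infsetsum_finite[OF finite_le])
    also have "\<dots> = (\<Sum>i | i \<in> I \<and> l i \<le> u. of_real (w i) * exp (- (s * of_real u)))"
      by (rule sum.cong) (auto simp: \<Phi>_def)
    also have "\<dots> = of_real (summatory I w l u) * exp (- (s * of_real u))"
      by (simp add: summatory_def sum_distrib_right)
    also have "\<dots> = indicator {0..} u *\<^sub>R (of_real (summatory I w l u) * exp (- (s * of_real u)))"
    proof (cases "0 \<le> u")
      case False
      then have empty: "{i. i \<in> I \<and> l i \<le> u} = {}" using log_nonneg by fastforce
      show ?thesis unfolding summatory_def empty by simp
    qed simp
    finally show ?thesis .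
  qed
  have "integrable lborel (\<lambda>u. \<integral>i. \<Phi> i u \<partial>count_space I)"
    by (rule P.integrable_snd[OF prod])
  moreover have "(\<integral>u. (\<integral>i. \<Phi> i u \<partial>count_space I) \<partial>lborel) = (\<integral>i. (\<integral>u. \<Phi> i u \<partial>lborel) \<partial>count_space I)"
    by (rule P.Fubini_integral[OF prod])
  moreover have "(\<integral>i. (\<integral>u. \<Phi> i u \<partial>lborel) \<partial>count_space I) = dirichlet I w l s / s"
  proof -
    have "(\<lambda>i. \<integral>u. \<Phi> i u \<partial>lborel) = (\<lambda>i. of_real (w i) * exp (- (s * of_real (l i))) / s)"
      by (simp add: has_bochner_integral_integral_eq[OF inner])
    then show ?thesis by (simp add: dirichlet_def infsetsum_def)
  qed
  ultimately show ?thesis unfolding fiber by (simp add: has_bochner_integral_iff)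
qed

end

section \<open>Abelian and Tauberian theorem for the remainder\<close>

definition rapidly_decaying :: "(real \<Rightarrow> real) \<Rightarrow> bool" where
  "rapidly_decaying f \<longleftrightarrow> (\<forall>n::nat. \<exists>C. \<forall>u\<ge>0. \<bar>f u\<bar> \<le> C / (1 + u) ^ n)"

text \<open>
  On the middle half of its support the tent is at least \<open>1 / 2\<close>.
\<close>

lemma integral_against_tent_ge:
  fixes G :: "real \<Rightarrow> real"
  assumes int: "integrable lborel (\<lambda>u. G u * max 0 (1 - \<bar>y - u\<bar> / d))"
    and d: "0 < d" and c: "0 \<le> c" and G: "\<And>u. \<bar>y - u\<bar> \<le> d \<Longrightarrow> c \<le> G u"
  shows "c * d / 2 \<le> (\<integral>u. G u * max 0 (1 - \<bar>y - u\<bar> / d) \<partial>lborel)"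
proof -
  have "c * d / 2 = (\<integral>u. c / 2 * indicator {y - d/2..y + d/2} u \<partial>lborel)"
    using d by simp
  also have "\<dots> \<le> (\<integral>u. G u * max 0 (1 - \<bar>y - u\<bar> / d) \<partial>lborel)"
  proof (rule integral_mono[OF _ int])
    show "integrable lborel (\<lambda>u. c / 2 * indicator {y - d/2..y + d/2} u)"
      by (intro integrable_mult_right integrable_real_indicator) (auto simp: emeasure_lborel_Icc_eq)
    fix u
    show "c / 2 * indicator {y - d/2..y + d/2} u \<le> G u * max 0 (1 - \<bar>y - u\<bar> / d)"
    proof (cases "\<bar>y - u\<bar> \<le> d")
      case True
      have Gu: "c \<le> G u" by (rule G[OF True])
      show ?thesis
      proof (cases "u \<in> {y - d/2..y + d/2}")
        case True
        then have "\<bar>y - u\<bar> \<le> d / 2" by (intro abs_leI) auto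
        then have "\<bar>y - u\<bar> / d \<le> 1 / 2" using d by (simp add: field_simps)
        then have m: "1 / 2 \<le> max 0 (1 - \<bar>y - u\<bar> / d)" by (intro max.coboundedI2) linarith
        have "c * (1 / 2) \<le> G u * max 0 (1 - \<bar>y - u\<bar> / d)"
          using Gu c by (intro mult_mono Gu m) auto
        then show ?thesis using True by simp
      qed (use Gu c in simp)
    next
      case False
      then have "1 \<le> \<bar>y - u\<bar> / d" using d by (simp add: field_simps)
      moreover have "u \<notin> {y - d/2..y + d/2}"
      proof
        assume "u \<in> {y - d/2..y + d/2}"
        then have "\<bar>y - u\<bar> \<le> d" using d by (intro abs_leI) auto
        with False show False by simp
      qed
      ultimately show ?thesis by simp
    qed
  qed
  finally show ?thesis .
qed

text \<open>
  Since \<open>S\<close> is monotone, \<open>f + a\<close> can decrease at most like \<open>exp (- u)\<close>. If \<open>f y\<close> is large and positive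
  compared with the width \<open>d\<close>, then \<open>f\<close> stays of this size on the window \<open>y \<le> u \<le> y + 2 * d\<close>; if it
  is large and negative, it was so on \<open>y - 2 * d \<le> u \<le> y\<close>. The tent is therefore centred at
  \<open>y + d\<close> or at \<open>y - d\<close>. The factor \<open>exp (- u / y)\<close> stays bounded below on these windows; it comes
  from evaluating the transform at distance \<open>1 / y\<close> from the boundary, where it converges.
\<close>

lemma pointwise_bound_of_smoothed:
  fixes S :: "real \<Rightarrow> real"
  assumes S: "mono S" "\<And>u. 0 \<le> S u" and a: "0 \<le> a"
    and f: "\<And>u. f u = S u * exp (- u) - a"
    and G: "\<And>u. 0 \<le> u \<Longrightarrow> G u = u ^ k * f u * exp (- (u / y))"
    and y: "1 \<le> y" and d: "0 < d" "d \<le> 1 / 4"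
    and int: "\<And>v. integrable lborel (\<lambda>u. G u * max 0 (1 - \<bar>v - u\<bar> / d))"
    and B: "\<And>v. \<bar>\<integral>u. G u * max 0 (1 - \<bar>v - u\<bar> / d) \<partial>lborel\<bar> \<le> B"
  shows "\<bar>f y\<bar> \<le> 8 * d * a + 8 * exp 2 * 2 ^ k * B / (d * y ^ k)"
proof -
  have B0: "0 \<le> B" using B[of 0] by linarith
  have fa: "f u + a = S u * exp (- u)" for u by (simp add: f)
  have fa0: "0 \<le> f u + a" for u unfolding fa using S by simp
  have yk: "0 < y ^ k" using y by simp
  have K0: "0 \<le> 8 * exp 2 * 2 ^ k * B / (d * y ^ k)" using B0 d yk by simp
  have upper: "f y \<le> 8 * d * a + 8 * exp 2 * 2 ^ k * B / (d * y ^ k)"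
  proof (cases "f y \<le> 8 * d * a")
    case True
    then show ?thesis using K0 by linarith
  next
    case False
    have fy: "0 < f y" using False a d by (smt (verit) mult_nonneg_nonneg)
    define c where "c = y ^ k * (f y / 4) * exp (-2)"
    have "c * d / 2 \<le> (\<integral>u. G u * max 0 (1 - \<bar>(y + d) - u\<bar> / d) \<partial>lborel)"
    proof (rule integral_against_tent_ge[OF int d(1)])
      show "0 \<le> c" unfolding c_def using yk fy by simp
      fix u assume "\<bar>(y + d) - u\<bar> \<le> d"
      then have u: "y \<le> u" "u \<le> y + 2 * d" by (auto simp: abs_le_iff)
      have "f u + a = S u * exp (- u)" by (rule fa)
      also have "\<dots> \<ge> S y * exp (- u)" using S(1) u by (intro mult_right_mono) (auto dest: monoD)
      also have "S y * exp (- u) = (f y + a) * exp (- (u - y))"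
        unfolding fa by (simp add: mult.assoc exp_add[symmetric])
      finally have 1: "(f y + a) * exp (- (u - y)) \<le> f u + a" .
      have "1 - 2 * d \<le> exp (- (u - y))" using exp_ge_add_one_self[of "- (u - y)"] u by linarith
      then have "(f y + a) * (1 - 2 * d) \<le> (f y + a) * exp (- (u - y))"
        using fa0 by (rule mult_left_mono)
      with 1 have "f y + a - 2 * d * f y - 2 * d * a \<le> f u + a" by (simp add: algebra_simps)
      moreover have "2 * d * f y \<le> 1/2 * f y" using d fy by (intro mult_right_mono) auto
      ultimately have fu: "f y / 4 \<le> f u" using False by linarith
      have "u / y \<le> 2" using u d y by (simp add: field_simps)
      then have "c \<le> u ^ k * f u * exp (- (u / y))"
        unfolding c_def using fu fy u y by (intro mult_mono power_mono) auto
      then show "c \<le> G u" using G[of u] u y by simp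
    qed
    also have "\<dots> \<le> B" using B[of "y + d"] by linarith
    finally have "c * d / 2 \<le> B" .
    then have "y ^ k * d * f y \<le> 8 * exp 2 * B"
      by (simp add: c_def exp_minus field_simps)
    then have "f y \<le> 8 * exp 2 * B / (d * y ^ k)"
      using d yk by (simp add: field_simps)
    also have "\<dots> \<le> 8 * exp 2 * 2 ^ k * B / (d * y ^ k)"
    proof (intro divide_right_mono)
      have "8 * exp 2 * B * 1 \<le> 8 * exp 2 * B * 2 ^ k" using B0 by (intro mult_left_mono) auto
      then show "8 * exp 2 * B \<le> 8 * exp 2 * 2 ^ k * B" by (simp add: mult_ac)
    qed (use d yk in auto)
    finally show ?thesis using a d by (smt (verit) mult_nonneg_nonneg)
  qed
  have lower: "- f y \<le> 8 * d * a + 8 * exp 2 * 2 ^ k * B / (d * y ^ k)"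
  proof (cases "- f y \<le> 8 * d * a")
    case True
    then show ?thesis using K0 by linarith
  next
    case False
    have fy: "f y < 0" using False a d by (smt (verit) mult_nonneg_nonneg)
    define c where "c = (y / 2) ^ k * (- f y / 2) * exp (-1)"
    have "c * d / 2 \<le> (\<integral>u. - G u * max 0 (1 - \<bar>(y - d) - u\<bar> / d) \<partial>lborel)"
    proof (rule integral_against_tent_ge[OF _ d(1)])
      show "integrable lborel (\<lambda>u. - G u * max 0 (1 - \<bar>y - d - u\<bar> / d))"
        using int[of "y - d"] by simp
      show "0 \<le> c" unfolding c_def using y fy by (intro mult_nonneg_nonneg) auto
      fix u assume "\<bar>(y - d) - u\<bar> \<le> d"
      then have u: "u \<le> y" "y - 2 * d \<le> u" by (auto simp: abs_le_iff)
      have u0: "y / 2 \<le> u" using u d y by linarith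
      have "f u + a = S u * exp (- u)" by (rule fa)
      also have "\<dots> \<le> S y * exp (- u)" using S(1) u by (intro mult_right_mono) (auto dest: monoD)
      also have "S y * exp (- u) = (f y + a) * exp (y - u)"
        unfolding fa by (simp add: mult.assoc exp_add[symmetric])
      also have "\<dots> \<le> (f y + a) * (1 + 4 * d)"
      proof (intro mult_left_mono fa0)
        define v where "v = y - u"
        have v: "0 \<le> v" "v \<le> 2 * d" "v \<le> 1" using u d by (auto simp: v_def)
        have 1: "exp v \<le> 1 + v + v\<^sup>2" using v by (intro exp_bound) auto
        have "v * v \<le> v * 1" using v by (intro mult_left_mono) auto
        then have "v\<^sup>2 \<le> v" by (simp add: power2_eq_square)
        with 1 v have "exp v \<le> 1 + 4 * d" by linarith
        then show "exp (y - u) \<le> 1 + 4 * d" by (simp add: v_def)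
      qed
      finally have "f u \<le> f y + 4 * d * f y + 4 * d * a" by (simp add: algebra_simps)
      moreover have "4 * d * f y \<le> 0" using d fy by (simp add: mult_nonneg_nonpos)
      ultimately have fu: "- f y / 2 \<le> - f u" using False by linarith
      have "u / y \<le> 1" using u y by (simp add: field_simps)
      moreover have "0 \<le> u ^ k * (- f u)"
        using fu fy u0 y by (intro mult_nonneg_nonneg) auto
      ultimately have "c \<le> u ^ k * (- f u) * exp (- (u / y))"
        unfolding c_def using fu fy u0 y by (intro mult_mono power_mono) auto
      then show "c \<le> - G u" using G[of u] u0 y by simp
    qed
    also have "\<dots> \<le> B" using B[of "y - d"] by simp
    finally have "c * d / 2 \<le> B" .
    then have "y ^ k * d * (- f y) \<le> 4 * exp 1 * 2 ^ k * B"
      by (simp add: c_def exp_minus field_simps power_divide)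
    also have "\<dots> \<le> 8 * exp 2 * 2 ^ k * B"
      using B0 by (intro mult_right_mono mult_mono) auto
    finally have "- f y \<le> 8 * exp 2 * 2 ^ k * B / (d * y ^ k)"
      using d yk by (simp add: field_simps)
    then show ?thesis using a d by (smt (verit) mult_nonneg_nonneg)
  qed
  show ?thesis using upper lower by linarith
qed

context discrete_dirichlet
begin

definition remainder :: "real \<Rightarrow> real \<Rightarrow> real" where
  "remainder a u = summatory I w l u * exp (- u) - a"

lemma measurable_remainder [measurable]: "remainder a \<in> borel_measurable borel"
  unfolding remainder_def by measurable

lemma laplace_remainder:
  assumes sum: "\<And>x. 1 < x \<Longrightarrow> dirichlet_summable I w l x" and z: "0 < Re z"
  shows "has_bochner_integral lborel (\<lambda>u. indicator {0..} u *\<^sub>R (of_real (remainder a u) * exp (- (z * of_real u))))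
           (dirichlet I w l (1 + z) / (1 + z) - of_real a / z)"
proof -
  have "has_bochner_integral lborel (\<lambda>u. indicator {0..} u *\<^sub>R (of_real (summatory I w l u) * exp (- ((1 + z) * of_real u)))
      - of_real a * (indicator {0..} u *\<^sub>R exp (- (z * of_real u))))
      (dirichlet I w l (1 + z) / (1 + z) - of_real a * (exp (- (z * of_real 0)) / z))"
    using z by (intro has_bochner_integral_diff has_bochner_integral_mult_right dirichlet_eq_laplace
      has_bochner_integral_exp_tail sum) auto
  moreover have "(\<lambda>u. indicator {0..} u *\<^sub>R (of_real (summatory I w l u) * exp (- ((1 + z) * of_real u)))
      - of_real a * (indicator {0..} u *\<^sub>R exp (- (z * of_real u))))
    = (\<lambda>u. indicator {0..} u *\<^sub>R (of_real (remainder a u) * exp (- (z * of_real u))))"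
    by (auto simp: fun_eq_iff remainder_def indicator_def algebra_simps exp_add[symmetric] exp_of_real[symmetric])
  ultimately show ?thesis by simp
qed

definition remainder_transform :: "real \<Rightarrow> complex \<Rightarrow> complex" where
  "remainder_transform a z =
     (\<integral>u. of_real (remainder a u) * exp (- (z * of_real u)) \<partial>restrict_space lborel {0..})"

lemma remainder_transform_eq:
  assumes "\<And>x. 1 < x \<Longrightarrow> dirichlet_summable I w l x" "0 < Re z"
  shows "remainder_transform a z = dirichlet I w l (1 + z) / (1 + z) - of_real a / z"
  using laplace_remainder[OF assms]
  unfolding remainder_transform_def
  by (subst integral_restrict_space) (auto simp: has_bochner_integral_integral_eq)

lemma remainder_integrable:
  assumes "\<And>x. 1 < x \<Longrightarrow> dirichlet_summable I w l x" "0 < x"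
  shows "integrable (restrict_space lborel {0..}) (\<lambda>u. norm (complex_of_real (remainder a u)) * exp (- (x * u)))"
proof -
  have "integrable lborel (\<lambda>u. norm (indicator {0..} u *\<^sub>R (of_real (remainder a u) * exp (- (of_real x * complex_of_real u)))))"
    using laplace_remainder[OF assms(1), of "of_real x"] assms(2)
    by (intro integrable_norm) (auto simp: has_bochner_integral_iff)
  also have "(\<lambda>u. norm (indicator {0..} u *\<^sub>R (of_real (remainder a u) * exp (- (of_real x * complex_of_real u)))))
    = (\<lambda>u. indicator {0..} u *\<^sub>R (norm (complex_of_real (remainder a u)) * exp (- (x * u))))"
    by (auto simp: fun_eq_iff norm_mult)
  finally show ?thesis by (subst integrable_restrict_space) auto
qed

lemma higher_deriv_remainder_transform:
  assumes "\<And>x. 1 < x \<Longrightarrow> dirichlet_summable I w l x" "0 < Re z"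
  shows "(deriv ^^ k) (remainder_transform a) z =
     (\<integral>u. (- of_real u) ^ k * of_real (remainder a u) * exp (- (z * of_real u)) \<partial>restrict_space lborel {0..})"
  unfolding remainder_transform_def
proof (rule higher_deriv_laplace[where ?x0.0 = 0])
  show "integrable (restrict_space lborel {0..}) (\<lambda>u. norm (complex_of_real (remainder a u)) * exp (- (x * u)))"
    if "0 < x" for x
    by (rule remainder_integrable[OF assms(1) that])
qed (use assms(2) in \<open>auto intro!: measurable_restrict_space1\<close>)

lemma holomorphic_remainder_transform:
  assumes "\<And>x. 1 < x \<Longrightarrow> dirichlet_summable I w l x"
  shows "remainder_transform a holomorphic_on right_half_plane"
  unfolding remainder_transform_def right_half_plane_def
proof (rule holomorphic_laplace)
  show "integrable (restrict_space lborel {0..}) (\<lambda>u. norm (complex_of_real (remainder a u)) * exp (- (x * u)))"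
    if "0 < x" for x
    by (rule remainder_integrable[OF assms(1) that])
qed (auto intro!: measurable_restrict_space1)

text \<open>
  The factor \<open>z / (1 + z) = (s - 1) / s\<close> removes the pole at \<open>s = 1\<close>; dividing by \<open>s\<close> corresponds to
  taking the Laplace transform of the summatory function instead of that of its differential.
\<close>

definition residue_form :: "complex \<Rightarrow> complex" where
  "residue_form z = z / (1 + z) * dirichlet I w l (1 + z)"

lemma residue_form_eq:
  assumes "\<And>x. 1 < x \<Longrightarrow> dirichlet_summable I w l x" "0 < Re z"
  shows "residue_form z = of_real a + z * remainder_transform a z"
proof -
  have "z \<noteq> 0" using assms(2) by auto
  moreover have "remainder_transform a z = dirichlet I w l (1 + z) / (1 + z) - of_real a / z"
    by (rule remainder_transform_eq[OF assms])
  ultimately show ?thesis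
    unfolding residue_form_def by (simp add: right_diff_distrib)
qed

text \<open>
  The transform of the remainder is \<open>(h(z) - a) / z\<close>, all of whose derivatives are bounded on the
  strip. The derivative of order \<open>k = 2 * n\<close> is the transform of \<open>(- u) ^ k\<close> times the remainder. Tents of
  width \<open>y powr -n\<close> lose a factor \<open>y ^ n\<close> of the gain \<open>y ^ k\<close> and leave \<open>y powr -n\<close>.
\<close>

lemma tauberian:
  assumes sum: "\<And>x. 1 < x \<Longrightarrow> dirichlet_summable I w l x"
    and slow: "slow residue_form" and a: "0 \<le> a"
    and lim: "\<And>z. 0 < Re z \<Longrightarrow> norm z < 1 \<Longrightarrow> norm (residue_form z - of_real a) \<le> C * norm z"
  shows "rapidly_decaying (remainder a)"
  unfolding rapidly_decaying_def
proof
  fix n :: nat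
  define k where "k = 2 * n"
  have "\<exists>B. \<forall>z. 0 < Re z \<longrightarrow> Re z < 1 \<longrightarrow> norm ((deriv ^^ k) (\<lambda>z. (residue_form z - of_real a) / z) z) \<le> B"
    using slow lim by (intro bounded_higher_deriv_quotient[of _ C] slow_diff slow_const)
  then obtain B where B: "\<And>z. 0 < Re z \<Longrightarrow> Re z < 1 \<Longrightarrow>
      norm ((deriv ^^ k) (\<lambda>z. (residue_form z - of_real a) / z) z) \<le> B" by blast
  have B': "norm (\<integral>u. (- of_real u) ^ k * of_real (remainder a u) * exp (- (z * of_real u)) \<partial>restrict_space lborel {0..}) \<le> B"
    if z: "0 < Re z" "Re z < 1" for z
  proof -
    have "(deriv ^^ k) (\<lambda>z. (residue_form z - of_real a) / z) z = (deriv ^^ k) (remainder_transform a) z"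
    proof (rule higher_deriv_cong_ev)
      have "(residue_form z - of_real a) / z = remainder_transform a z" if "0 < Re z" for z
        using that residue_form_eq[OF sum that, of a] by auto
      then show "\<forall>\<^sub>F z in nhds z. (residue_form z - of_real a) / z = remainder_transform a z"
        using eventually_nhds_in_open[of right_half_plane z] z
        by (auto elim!: eventually_mono)
    qed simp
    then show ?thesis using B[OF z] higher_deriv_remainder_transform[OF sum z(1), of k a] by simp
  qed
  have B0: "0 \<le> B" using order_trans[OF norm_ge_zero B[of "1/2"]] by simp
  define K where "K = 8 * exp 2 * 2 ^ k * B"
  have K0: "0 \<le> K" using B0 by (simp add: K_def)
  have large: "\<bar>remainder a y\<bar> \<le> (2 * a + 4 * K) / y ^ n" if y: "1 < y" for y
  proof -
    define x where "x = 1 / y"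
    have x: "0 < x" "x < 1" using y by (auto simp: x_def)
    define d where "d = 1 / (4 * y ^ n)"
    have yn: "1 \<le> y ^ n" using y by simp
    have d: "0 < d" "d \<le> 1 / 4" using yn y by (auto simp: d_def field_simps)
    define G where "G = (\<lambda>u. indicator {0..} u * (u ^ k * remainder a u * exp (- (u / y))))"
    define g where "g = (\<lambda>u. complex_of_real ((-1) ^ k * G u))"
    have g_eq: "g u = indicator {0..} u *\<^sub>R ((- of_real u) ^ k * of_real (remainder a u) * exp (- (of_real x * of_real u)))" for u
    proof -
      have "complex_of_real (exp (- (u / y))) = exp (- (of_real x * of_real u))"
        by (simp add: x_def exp_of_real[symmetric])
      then show ?thesis
        by (simp add: g_def G_def scaleR_conv_of_real power_minus[of "of_real u"] mult_ac)
    qed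
    have "integrable (restrict_space lborel {0..})
       (\<lambda>u. (- of_real u) ^ k * of_real (remainder a u) * exp (- (of_real x * complex_of_real u)))"
    proof (rule integrable_laplace_complex)
      have "integrable (restrict_space lborel {0..})
         (\<lambda>u. norm ((- of_real u) ^ k * complex_of_real (remainder a u)) * exp (- (x * u)))"
        by (rule integrable_laplace_power[where ?x0.0 = 0])
          (use x remainder_integrable[OF sum] in \<open>auto intro!: measurable_restrict_space1\<close>)
      then show "integrable (restrict_space lborel {0..})
         (\<lambda>u. norm ((- of_real u) ^ k * complex_of_real (remainder a u)) * exp (- (Re (of_real x) * u)))"
        by simp
    qed (auto intro!: measurable_restrict_space1)
    then have g_int: "integrable lborel g"
      by (subst (asm) integrable_restrict_space) (auto simp: g_eq[abs_def])
    have fourier: "norm (\<integral>u. g u * exp (- (\<i> * of_real (t * u))) \<partial>lborel) \<le> B" for t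
    proof -
      have "(\<integral>u. g u * exp (- (\<i> * of_real (t * u))) \<partial>lborel)
        = (\<integral>u. indicator {0..} u *\<^sub>R ((- of_real u) ^ k * of_real (remainder a u) * exp (- (Complex x t * of_real u))) \<partial>lborel)"
      proof (rule Bochner_Integration.integral_cong[OF refl])
        fix u
        have "Complex x t = of_real x + \<i> * of_real t" by (simp add: complex_eq_iff)
        then show "g u * exp (- (\<i> * of_real (t * u)))
          = indicator {0..} u *\<^sub>R ((- of_real u) ^ k * of_real (remainder a u) * exp (- (Complex x t * of_real u)))"
          by (simp add: g_eq algebra_simps exp_add[symmetric] exp_diff exp_minus divide_inverse)
      qed
      also have "\<dots> = (\<integral>u. (- of_real u) ^ k * of_real (remainder a u) * exp (- (Complex x t * of_real u)) \<partial>restrict_space lborel {0..})"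
        by (subst integral_restrict_space) auto
      finally show ?thesis using B'[of "Complex x t"] x by simp
    qed
    have tent: "norm (\<integral>u. g u * of_real (max 0 (1 - \<bar>v - u\<bar> / d)) \<partial>lborel) \<le> B" for v
      by (rule fejer_mean_bound[OF g_int d(1) fourier])
    have G_int: "integrable lborel G"
    proof -
      have "integrable lborel (\<lambda>u. (-1) ^ k * Re (g u))"
        using g_int by (intro integrable_mult_right) auto
      then show ?thesis by (simp add: g_def mult.assoc[symmetric] power_mult_distrib[symmetric])
    qed
    have tent_int: "integrable lborel (\<lambda>u. G u * max 0 (1 - \<bar>v - u\<bar> / d))" for v
    proof (rule Bochner_Integration.integrable_bound[OF G_int])
      show "AE u in lborel. norm (G u * max 0 (1 - \<bar>v - u\<bar> / d)) \<le> norm (G u)"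
      proof (rule AE_I2)
        fix u
        have "\<bar>G u\<bar> * max 0 (1 - \<bar>v - u\<bar> / d) \<le> \<bar>G u\<bar> * 1"
          using d by (intro mult_left_mono) auto
        then show "norm (G u * max 0 (1 - \<bar>v - u\<bar> / d)) \<le> norm (G u)"
          by (simp add: abs_mult)
      qed
    qed (use G_int in measurable)
    have "\<bar>remainder a y\<bar> \<le> 8 * d * a + 8 * exp 2 * 2 ^ k * B / (d * y ^ k)"
    proof (rule pointwise_bound_of_smoothed[OF mono_summatory summatory_nonneg a])
      show "remainder a u = summatory I w l u * exp (- u) - a" for u by (simp add: remainder_def)
      show "G u = u ^ k * remainder a u * exp (- (u / y))" if "0 \<le> u" for u
        using that by (simp add: G_def)
      show "\<bar>\<integral>u. G u * max 0 (1 - \<bar>v - u\<bar> / d) \<partial>lborel\<bar> \<le> B" for v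
      proof -
        have "(\<integral>u. g u * of_real (max 0 (1 - \<bar>v - u\<bar> / d)) \<partial>lborel)
          = (\<integral>u. complex_of_real ((-1) ^ k * (G u * max 0 (1 - \<bar>v - u\<bar> / d))) \<partial>lborel)"
          by (simp add: g_def mult.assoc)
        also have "\<dots> = complex_of_real ((-1) ^ k * (\<integral>u. G u * max 0 (1 - \<bar>v - u\<bar> / d) \<partial>lborel))"
          by (simp only: integral_complex_of_real integral_mult_right_zero)
        finally show ?thesis using tent[of v] by (simp add: norm_mult norm_power)
      qed
    qed (use y d tent_int in auto)
    also have "\<dots> = 2 * a / y ^ n + K * 4 * (y ^ n / y ^ k)"
      using y by (simp add: d_def K_def)
    also have "y ^ n / y ^ k = 1 / y ^ n"
      using y by (simp add: k_def mult_2 power_add)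
    finally show ?thesis by (simp add: add_divide_distrib mult.commute)
  qed
  define D where "D = (2 * a + 4 * K) * 2 ^ n + (summatory I w l 1 + a) * 2 ^ n"
  have "\<bar>remainder a u\<bar> \<le> D / (1 + u) ^ n" if u: "0 \<le> u" for u
  proof (cases "1 < u")
    case True
    have "(1 + u) ^ n \<le> (2 * u) ^ n" using True by (intro power_mono) auto
    then have "1 / u ^ n \<le> 2 ^ n / (1 + u) ^ n"
      using True by (simp add: field_simps power_mult_distrib)
    then have "(2 * a + 4 * K) * (1 / u ^ n) \<le> (2 * a + 4 * K) * (2 ^ n / (1 + u) ^ n)"
      using a K0 by (intro mult_left_mono) auto
    moreover have "0 \<le> (summatory I w l 1 + a) * 2 ^ n / (1 + u) ^ n"
      using summatory_nonneg[of 1] a u by simp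
    ultimately show ?thesis using large[OF True] by (simp add: D_def add_divide_distrib)
  next
    case False
    have "summatory I w l u * exp (- u) \<le> summatory I w l 1 * 1"
      using False u monoD[OF mono_summatory, of u 1] summatory_nonneg by (intro mult_mono) auto
    moreover have "0 \<le> summatory I w l u * exp (- u)" using summatory_nonneg by simp
    ultimately have "\<bar>remainder a u\<bar> \<le> (summatory I w l 1 + a) * 1"
      unfolding remainder_def using a by (simp add: abs_le_iff)
    also have "\<dots> \<le> (summatory I w l 1 + a) * (2 ^ n / (1 + u) ^ n)"
    proof (intro mult_left_mono)
      have "(1 + u) ^ n \<le> 2 ^ n" using False u by (intro power_mono) auto
      then show "1 \<le> 2 ^ n / (1 + u) ^ n" using u by (simp add: field_simps)
    qed (use summatory_nonneg[of 1] a in auto)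
    also have "\<dots> \<le> D / (1 + u) ^ n"
      using a K0 u by (simp add: D_def add_divide_distrib)
    finally show ?thesis .
  qed
  then show "\<exists>C. \<forall>u\<ge>0. \<bar>remainder a u\<bar> \<le> C / (1 + u) ^ n" by blast
qed

text \<open>
  The moments of the remainder are finite, so all derivatives of its transform \<open>F\<close> are bounded, and
  \<open>z * F(z)\<close> has derivatives of linear growth. At a real point \<open>x\<close> the same identity gives
  \<open>D(1 + x) = O(1 / x)\<close>, which nonnegativity extends to all points with real part \<open>x\<close>; these are the two
  bounds to be interpolated.
\<close>

lemma abelian:
  assumes rapid: "rapidly_decaying (remainder a)"
  shows "\<And>x. 1 < x \<Longrightarrow> dirichlet_summable I w l x" and "slow residue_form"
    and "\<exists>C. \<forall>z. 0 < Re z \<longrightarrow> norm (residue_form z - of_real a) \<le> C * norm z"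
proof -
  have bound: "\<exists>C. \<forall>u\<ge>0. \<bar>remainder a u\<bar> \<le> C / (1 + u) ^ n" for n
    using rapid by (simp add: rapidly_decaying_def)
  obtain C0 where C0: "\<forall>u\<ge>0. \<bar>remainder a u\<bar> \<le> C0 / (1 + u) ^ 0" using bound by blast
  have "summatory I w l u \<le> (C0 + \<bar>a\<bar>) * exp u" if "0 \<le> u" for u
  proof -
    have "summatory I w l u * exp (- u) \<le> C0 + \<bar>a\<bar>"
      using C0[rule_format, OF that] unfolding remainder_def power_0 div_by_1 by linarith
    then have "summatory I w l u * exp (- u) * exp u \<le> (C0 + \<bar>a\<bar>) * exp u"
      by (intro mult_right_mono) auto
    then show ?thesis by (simp add: mult.assoc exp_add[symmetric])
  qed
  then show sum: "dirichlet_summable I w l x" if "1 < x" for x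
    using that by (intro summable_of_summatory_bound) auto
  have moment: "\<exists>B\<ge>0. \<forall>z. 0 < Re z \<longrightarrow> norm ((deriv ^^ k) (remainder_transform a) z) \<le> B" for k
  proof -
    obtain C where C: "\<forall>u\<ge>0. \<bar>remainder a u\<bar> \<le> C / (1 + u) ^ (k + 2)" using bound by blast
    have C_nonneg: "0 \<le> C" using C[rule_format, of 0] by simp
    define M where "M = restrict_space lborel {0::real..}"
    have intM: "integrable M (\<lambda>u. C * inverse (1 + u\<^sup>2))"
    proof (rule integrable_mult_right)
      have "integrable lborel (\<lambda>u::real. inverse (1 + u\<^sup>2))"
        using integrable_inverse_1_plus_square by (simp add: set_integrable_def einterval_def)
      from integrable_mult_indicator[OF _ this, of "{0..}"]
      show "integrable M (\<lambda>u. inverse (1 + u\<^sup>2))"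
        unfolding M_def by (subst integrable_restrict_space) auto
    qed
    have "norm ((deriv ^^ k) (remainder_transform a) z) \<le> (\<integral>u. C * inverse (1 + u\<^sup>2) \<partial>M)" if z: "0 < Re z" for z
    proof -
      have eq: "(deriv ^^ k) (remainder_transform a) z =
          (\<integral>u. (- of_real u) ^ k * of_real (remainder a u) * exp (- (z * of_real u)) \<partial>M)"
        unfolding M_def by (rule higher_deriv_remainder_transform[OF sum z])
      have le: "norm ((- of_real u) ^ k * of_real (remainder a u) * exp (- (z * of_real u)))
          \<le> C * inverse (1 + u\<^sup>2)" if "u \<in> space M" for u
      proof -
        have u: "0 \<le> u" using that by (simp add: M_def space_restrict_space)
        have "norm ((- of_real u) ^ k * of_real (remainder a u) * exp (- (z * of_real u)))
          = u ^ k * \<bar>remainder a u\<bar> * exp (- (Re z * u))"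
          using u by (simp add: norm_mult norm_power)
        also have "\<dots> \<le> u ^ k * \<bar>remainder a u\<bar> * 1"
          using u z by (intro mult_left_mono) auto
        also have "\<dots> \<le> (1 + u) ^ k * (C / (1 + u) ^ (k + 2)) * 1"
          using u C by (intro mult_right_mono mult_mono power_mono) auto
        also have "\<dots> = C * inverse ((1 + u)\<^sup>2)"
        proof -
          have "(1 + u) ^ k \<noteq> 0" using u by simp
          then show ?thesis by (simp add: power_add inverse_eq_divide power2_eq_square)
        qed
        also have "\<dots> \<le> C * inverse (1 + u\<^sup>2)"
        proof (intro mult_left_mono le_imp_inverse_le C_nonneg)
          show "1 + u\<^sup>2 \<le> (1 + u)\<^sup>2" using u by (simp add: power2_sum)
          show "0 < 1 + u\<^sup>2" by (simp add: add_pos_nonneg)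
        qed
        finally show ?thesis .
      qed
      show ?thesis unfolding eq
      proof (rule norm_integral_le_integral[OF _ intM le])
        show "integrable M (\<lambda>u. (- of_real u) ^ k * of_real (remainder a u) * exp (- (z * of_real u)))"
        proof (rule Bochner_Integration.integrable_bound[OF intM])
          show "(\<lambda>u. (- of_real u) ^ k * of_real (remainder a u) * exp (- (z * of_real u))) \<in> borel_measurable M"
            unfolding M_def by (intro measurable_restrict_space1) measurable
          show "AE u in M. norm ((- of_real u) ^ k * of_real (remainder a u) * exp (- (z * of_real u)))
              \<le> norm (C * inverse (1 + u\<^sup>2))"
            by (intro AE_I2 order_trans[OF le]) auto
        qed
      qed
    qed
    moreover have "0 \<le> (\<integral>u. C * inverse (1 + u\<^sup>2) \<partial>M)"
      using C_nonneg by (intro Bochner_Integration.integral_nonneg) (auto simp: add_nonneg_nonneg)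
    ultimately show ?thesis by blast
  qed
  obtain B where B: "\<And>k. 0 \<le> B k" "\<And>k z. 0 < Re z \<Longrightarrow> norm ((deriv ^^ k) (remainder_transform a) z) \<le> B k"
    using moment by metis
  have B1: "norm (remainder_transform a z) \<le> B 0" if "0 < Re z" for z using B(2)[OF that, of 0] by simp
  have rf: "residue_form z = of_real a + z * remainder_transform a z" if "0 < Re z" for z
    by (rule residue_form_eq[OF sum that])
  show "\<exists>C. \<forall>z. 0 < Re z \<longrightarrow> norm (residue_form z - of_real a) \<le> C * norm z"
  proof (intro exI[of _ "B 0"] allI impI)
    fix z assume z: "0 < Re z"
    have "norm (residue_form z - of_real a) = norm z * norm (remainder_transform a z)"
      unfolding rf[OF z] by (simp add: norm_mult)
    also have "\<dots> \<le> norm z * B 0" using B1[OF z] by (intro mult_left_mono) auto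
    finally show "norm (residue_form z - of_real a) \<le> B 0 * norm z" by (simp add: mult.commute)
  qed
  have hol: "remainder_transform a holomorphic_on right_half_plane"
    by (rule holomorphic_remainder_transform[OF sum])
  have "slow (\<lambda>z. z * remainder_transform a z)"
  proof (rule slow_of_linear_growth)
    show "(\<lambda>z. z * remainder_transform a z) holomorphic_on right_half_plane"
      using hol by (intro holomorphic_intros)
    show "\<exists>C. \<forall>z. 0 < Re z \<longrightarrow> Re z < 1 \<longrightarrow> norm ((deriv ^^ k) (\<lambda>z. z * remainder_transform a z) z) \<le> C * (1 + \<bar>Im z\<bar>)" for k
    proof (intro exI allI impI)
      fix z assume z: "0 < Re z" "Re z < 1"
      have "(deriv ^^ k) (\<lambda>z. z * remainder_transform a z) z
        = (\<Sum>i = 0..k. of_nat (k choose i) * (deriv ^^ i) (\<lambda>z. z) z * (deriv ^^ (k - i)) (remainder_transform a) z)"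
        using hol z by (intro higher_deriv_mult[of _ right_half_plane]) (auto intro!: holomorphic_intros)
      also have "norm \<dots> \<le> (\<Sum>i = 0..k. real (k choose i) * 2 * B (k - i) * (1 + \<bar>Im z\<bar>))"
      proof (rule sum_norm_le)
        fix i
        have "norm z \<le> \<bar>Re z\<bar> + \<bar>Im z\<bar>" by (rule cmod_le)
        then have id: "norm ((deriv ^^ i) (\<lambda>z. z) z) \<le> 2 * (1 + \<bar>Im z\<bar>)"
          using z by (auto simp: higher_deriv_id)
        have "norm (of_nat (k choose i) * (deriv ^^ i) (\<lambda>z. z) z * (deriv ^^ (k - i)) (remainder_transform a) z)
          \<le> real (k choose i) * (2 * (1 + \<bar>Im z\<bar>)) * B (k - i)"
          unfolding norm_mult using id B z by (intro mult_mono) auto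
        also have "\<dots> = real (k choose i) * 2 * B (k - i) * (1 + \<bar>Im z\<bar>)"
          by (simp only: mult_ac)
        finally show "norm (of_nat (k choose i) * (deriv ^^ i) (\<lambda>z. z) z * (deriv ^^ (k - i)) (remainder_transform a) z)
          \<le> real (k choose i) * 2 * B (k - i) * (1 + \<bar>Im z\<bar>)" .
      qed
      also have "\<dots> = (\<Sum>i = 0..k. real (k choose i) * 2 * B (k - i)) * (1 + \<bar>Im z\<bar>)"
        by (simp only: sum_distrib_right)
      finally show "norm ((deriv ^^ k) (\<lambda>z. z * remainder_transform a z) z)
        \<le> (\<Sum>i = 0..k. real (k choose i) * 2 * B (k - i)) * (1 + \<bar>Im z\<bar>)" .
    qed
    fix z assume z: "0 < Re z" "Re z < 2"
    define x where "x = Re z"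
    have x: "0 < x" "x < 2" using z by (auto simp: x_def)
    define R where "R = 2 * B 0 + \<bar>a\<bar>"
    have real: "norm (dirichlet I w l (of_real (1 + x))) \<le> R * 3 / x"
    proof -
      have "residue_form (of_real x) = of_real a + of_real x * remainder_transform a (of_real x)"
        using x by (intro rf) auto
      also have "norm \<dots> \<le> \<bar>a\<bar> + x * B 0"
        using x B1[of "of_real x"] by (intro norm_triangle_mono) (auto simp: norm_mult intro!: mult_left_mono)
      also have "\<dots> \<le> R" unfolding R_def using x B(1)[of 0] by (simp add: mult_right_mono)
      finally have "norm (of_real x / (1 + of_real x) * dirichlet I w l (of_real (1 + x))) \<le> R"
        by (simp add: residue_form_def)
      then have "x / (1 + x) * norm (dirichlet I w l (of_real (1 + x))) \<le> R"
        using x unfolding norm_mult norm_divide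
        by (metis abs_of_pos add_pos_pos norm_of_real of_real_1 of_real_add zero_less_one)
      then have "norm (dirichlet I w l (of_real (1 + x))) \<le> R * (1 + x) / x"
        using x by (simp add: field_simps)
      also have "\<dots> \<le> R * 3 / x"
        using x B(1)[of 0] by (intro divide_right_mono mult_left_mono) (auto simp: R_def)
      finally show ?thesis .
    qed
    have "norm (z * remainder_transform a z) = norm (residue_form z - of_real a)"
      unfolding rf[OF z(1)] by simp
    also have "\<dots> \<le> norm (residue_form z) + \<bar>a\<bar>"
      using norm_triangle_ineq4[of "residue_form z" "of_real a"] by simp
    also have "norm (residue_form z) \<le> 1 * norm (dirichlet I w l (1 + z))"
      unfolding residue_form_def norm_mult
    proof (rule mult_right_mono)
      have "norm z \<le> norm (1 + z)" using z(1) by (simp add: cmod_def power2_eq_square algebra_simps)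
      moreover have "0 < norm (1 + z)" using z(1) by (metis complex_Re_le_cmod less_le_trans one_complex.sel(1) plus_complex.sel(1) add_pos_pos zero_less_one)
      ultimately show "norm (z / (1 + z)) \<le> 1" by (simp add: norm_divide)
    qed simp
    also have "norm (dirichlet I w l (1 + z)) \<le> Re (dirichlet I w l (of_real (Re (1 + z))))"
      using z by (intro norm_dirichlet_le sum) auto
    also have "\<dots> \<le> norm (dirichlet I w l (of_real (1 + x)))"
      using complex_Re_le_cmod by (simp add: x_def)
    also note real
    also have "1 * (R * 3 / x) + \<bar>a\<bar> \<le> (R * 3 + 2 * \<bar>a\<bar>) / Re z"
    proof -
      have "\<bar>a\<bar> * x \<le> \<bar>a\<bar> * 2" using x by (intro mult_left_mono) auto
      then show ?thesis using x by (simp add: x_def field_simps)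
    qed
    finally show "norm (z * remainder_transform a z) \<le> (R * 3 + 2 * \<bar>a\<bar>) / Re z" by simp
  qed
  then have "slow (\<lambda>z. of_real a + z * remainder_transform a z)"
    by (intro slow_add slow_const)
  then show "slow residue_form" by (rule slow_cong) (simp add: rf)
qed

end

section \<open>The zeta function of a generalized prime system\<close>

lemma abs_summable_geometric:
  fixes r :: real
  assumes "0 \<le> r" "r < 1"
  shows "Infinite_Set_Sum.abs_summable_on (\<lambda>j. r ^ j) (A :: nat set)"
proof (rule abs_summable_on_subset)
  show "Infinite_Set_Sum.abs_summable_on (\<lambda>j. r ^ j) (UNIV :: nat set)"
    using assms by (subst abs_summable_on_nat_iff') (simp add: power_abs summable_geometric)
qed simp

text \<open>
  A finitely supported sequence is the extension by zero of a list.
\<close>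

lemma countable_exponents: "countable exponents"
proof -
  have "exponents \<subseteq> range (\<lambda>xs k. if k < length xs then xs ! k else 0)"
  proof
    fix m assume "m \<in> exponents"
    then have "finite {k. m k \<noteq> 0}" by (simp add: exponents_def)
    then obtain K where K: "\<And>k. m k \<noteq> 0 \<Longrightarrow> k < K"
      by (metis (mono_tags, lifting) finite_nat_set_iff_bounded mem_Collect_eq)
    have "m = (\<lambda>k. if k < length (map m [0..<K]) then map m [0..<K] ! k else 0)"
      using K by (auto simp: fun_eq_iff)
    then show "m \<in> range (\<lambda>xs k. if k < length xs then xs ! k else 0)" by blast
  qed
  then show ?thesis by (rule countable_subset) simp
qed

locale gen_primes =
  fixes p :: "nat \<Rightarrow> real"
  assumes system: "gen_prime_system p"
begin

lemma prime_gt_1: "1 < p k"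
  using system unfolding gen_prime_system_def by (metis le0 less_le_trans monoD)

lemma prime_ge_first: "p 0 \<le> p k"
  using system unfolding gen_prime_system_def by (auto intro: monoD)

lemma prime_pos: "0 < p k"
  using prime_gt_1[of k] by simp

definition logp :: "nat \<Rightarrow> real" where "logp k = ln (p k)"

lemma exp_logp: "exp (logp k) = p k"
  using prime_gt_1[of k] by (simp add: logp_def)

lemma logp_pos: "0 < logp k"
  using prime_gt_1[of k] by (simp add: logp_def)

lemma logp_ge_first: "logp 0 \<le> logp k"
  using prime_gt_1[of 0] prime_ge_first[of k] by (simp add: logp_def)

definition logint :: "(nat \<Rightarrow> nat) \<Rightarrow> real" where
  "logint m = ln (gen_integer p m)"

lemma gen_integer_pos: "0 < gen_integer p m"
  unfolding gen_integer_def by (intro prod_pos) (simp add: prime_pos)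

lemma exp_logint: "exp (logint m) = gen_integer p m"
  by (simp add: logint_def gen_integer_pos)

lemma logint_eq_sum:
  assumes "finite K" "{k. m k \<noteq> 0} \<subseteq> K"
  shows "logint m = (\<Sum>k\<in>K. real (m k) * logp k)"
proof -
  have fin: "finite {k. m k \<noteq> 0}" using assms finite_subset by blast
  have "logint m = (\<Sum>k | m k \<noteq> 0. ln (p k ^ m k))"
    unfolding logint_def gen_integer_def
    by (rule ln_prod) (use fin in \<open>auto simp: prime_pos less_imp_neq[OF prime_pos, symmetric]\<close>)
  also have "\<dots> = (\<Sum>k | m k \<noteq> 0. real (m k) * logp k)"
    unfolding logp_def by (intro sum.cong) (auto simp: ln_realpow prime_pos)
  also have "\<dots> = (\<Sum>k\<in>K. real (m k) * logp k)"
    using assms by (intro sum.mono_neutral_left) auto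
  finally show ?thesis .
qed

lemma logint_nonneg: "m \<in> exponents \<Longrightarrow> 0 \<le> logint m"
  by (subst logint_eq_sum[of "{k. m k \<noteq> 0}"]) (auto simp: exponents_def less_imp_le[OF logp_pos] intro!: sum_nonneg)

lemma logint_add_power:
  assumes "m \<in> exponents"
  shows "logint (m(k := m k + j)) = logint m + real j * logp k"
proof -
  define K where "K = insert k {k. m k \<noteq> 0}"
  have K: "finite K" "k \<in> K" using assms by (auto simp: K_def exponents_def)
  have "logint (m(k := m k + j)) = (\<Sum>i\<in>K. real ((m(k := m k + j)) i) * logp i)"
    using K by (intro logint_eq_sum) (auto simp: K_def)
  also have "\<dots> = (\<Sum>i\<in>K. real (m i) * logp i + (if i = k then real j * logp k else 0))"
    by (intro sum.cong) (auto simp: algebra_simps)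
  also have "\<dots> = (\<Sum>i\<in>K. real (m i) * logp i) + real j * logp k"
    using K by (simp add: sum.distrib)
  also have "(\<Sum>i\<in>K. real (m i) * logp i) = logint m"
    using K by (intro logint_eq_sum[symmetric]) (auto simp: K_def)
  finally show ?thesis .
qed

definition plog :: "nat \<times> nat \<Rightarrow> real" where "plog = (\<lambda>(k, j). real j * logp k)"

text \<open>
  The weights of the generalized von Mangoldt function; the pair \<open>(k, j)\<close> stands for the prime power
  \<open>p k ^ j\<close>, whose logarithm is \<open>plog (k, j)\<close>.
\<close>

definition mangoldt :: "nat \<times> nat \<Rightarrow> real" where "mangoldt = (\<lambda>(k, j). logp k)"

definition prime_powers :: "nat \<Rightarrow> (nat \<times> nat) set" where "prime_powers q = UNIV \<times> {q..}"

sublocale integers: discrete_dirichlet exponents "\<lambda>_. 1" logint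
proof
  have "{m \<in> exponents. logint m \<le> u} = {m \<in> exponents. gen_integer p m \<le> exp u}" for u
    using exp_le_cancel_iff[of "logint _" u] by (simp add: exp_logint)
  then show "finite {m \<in> exponents. logint m \<le> u}" for u
    using finite_gen_integers_le[OF system] by simp
qed (auto simp: countable_exponents logint_nonneg)

sublocale primes: discrete_dirichlet UNIV logp logp
proof
  have "{k \<in> UNIV. logp k \<le> u} = {k. p k \<le> exp u}" for u
    using exp_le_cancel_iff[of "logp _" u] by (simp add: exp_logp)
  then show "finite {k \<in> UNIV. logp k \<le> u}" for u
    using finite_gen_primes_le[OF system] by simp
qed (auto simp: less_imp_le[OF logp_pos])

sublocale powers: nonneg_dirichlet "prime_powers q" mangoldt plog for q
  by unfold_locales (auto simp: prime_powers_def mangoldt_def plog_def less_imp_le[OF logp_pos])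

sublocale log_powers: nonneg_dirichlet "prime_powers 1" "\<lambda>(k, j). 1 / real j" plog
  by unfold_locales (auto simp: prime_powers_def plog_def less_imp_le[OF logp_pos])

abbreviation zeta :: "complex \<Rightarrow> complex" where "zeta \<equiv> dirichlet exponents (\<lambda>_. 1) logint"
abbreviation theta_series :: "complex \<Rightarrow> complex" where "theta_series \<equiv> dirichlet UNIV logp logp"
abbreviation power_series :: "nat \<Rightarrow> complex \<Rightarrow> complex" where
  "power_series q \<equiv> dirichlet (prime_powers q) mangoldt plog"
abbreviation log_zeta :: "complex \<Rightarrow> complex" where
  "log_zeta \<equiv> dirichlet (prime_powers 1) (\<lambda>(k, j). 1 / real j) plog"

text \<open>
  Every prime is an integer, and convergence for all larger real parts absorbs the logarithmic weight.
\<close>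

lemma primes_summable_of_integers:
  assumes "\<And>x. 1 < x \<Longrightarrow> dirichlet_summable exponents (\<lambda>_. 1) logint x" "1 < x"
  shows "dirichlet_summable UNIV logp logp x"
proof -
  interpret unit: nonneg_dirichlet UNIV "\<lambda>_. 1" logp
    by unfold_locales (auto simp: less_imp_le[OF logp_pos])
  define e :: "nat \<Rightarrow> nat \<Rightarrow> nat" where "e = (\<lambda>k i. if i = k then 1 else 0)"
  have supp: "{i. e k i \<noteq> 0} = {k}" for k by (auto simp: e_def)
  have e_mem: "e k \<in> exponents" for k by (simp only: exponents_def mem_Collect_eq supp) simp
  have e_log: "logint (e k) = logp k" for k
  proof -
    have "logint (e k) = (\<Sum>i\<in>{k}. real (e k i) * logp i)"
      by (rule logint_eq_sum) (simp_all only: supp order_refl finite.intros)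
    then show ?thesis by (simp add: e_def)
  qed
  have inj: "inj e" by (rule injI) (metis e_def zero_neq_one)
  have "dirichlet_summable UNIV (\<lambda>_. 1) logp y" if "1 < y" for y
  proof -
    have "Infinite_Set_Sum.abs_summable_on (\<lambda>m. 1 * exp (- (y * logint m))) (range e)"
      using assms(1)[OF that] unfolding dirichlet_summable_def
      by (rule abs_summable_on_subset) (use e_mem in auto)
    then have "Infinite_Set_Sum.abs_summable_on (\<lambda>k. 1 * exp (- (y * logint (e k)))) UNIV"
      by (subst (asm) abs_summable_on_reindex_iff[OF inj, symmetric])
    then show ?thesis by (simp add: dirichlet_summable_def e_log)
  qed
  from unit.summable_log_weight[OF this assms(2)] show ?thesis by simp
qed

end

text \<open>
  Convergence of the prime series for \<open>Re s > 1\<close>. It follows from each of the two asymptotic formulas, and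
  it implies that all the series below converge there.
\<close>

locale summable_gen_primes = gen_primes +
  assumes primes_summable: "\<And>x. 1 < x \<Longrightarrow> dirichlet_summable UNIV logp logp x"
begin

lemma powers_summable:
  assumes q: "1 \<le> q" and x: "1 < real q * x"
  shows "dirichlet_summable (prime_powers q) mangoldt plog x"
proof -
  have x0: "0 < x" using q x by (smt (verit) mult_nonneg_nonpos of_nat_0_le_iff)
  define r where "r = exp (- (x * logp 0))"
  have r: "0 < r" "r < 1" using logp_pos[of 0] x0 by (auto simp: r_def)
  have "Infinite_Set_Sum.abs_summable_on (\<lambda>k. logp k * exp (- (real q * x * logp k))) UNIV"
    using primes_summable[OF x] by (simp add: dirichlet_summable_def)
  moreover have "Infinite_Set_Sum.abs_summable_on (\<lambda>j. inverse r ^ q * r ^ j) {q..}"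
    using r by (intro abs_summable_on_cmult_right abs_summable_geometric) auto
  ultimately have prod: "Infinite_Set_Sum.abs_summable_on
      (\<lambda>(k, j). (logp k * exp (- (real q * x * logp k))) * (inverse r ^ q * r ^ j)) (UNIV \<times> {q..})"
    by (intro abs_summable_on_product) auto
  show ?thesis unfolding dirichlet_summable_def prime_powers_def
  proof (rule abs_summable_on_comparison_test[OF prod])
    fix kj :: "nat \<times> nat" assume "kj \<in> UNIV \<times> {q..}"
    then obtain k j where kj: "kj = (k, j)" "q \<le> j" by auto
    then obtain i where i: "j = q + i" using le_Suc_ex by blast
    have "exp (- (x * (real j * logp k))) = exp (- (real q * x * logp k)) * exp (- (x * logp k)) ^ i"
      by (simp add: i exp_of_nat_mult[symmetric] exp_add[symmetric] algebra_simps)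
    also have "\<dots> \<le> exp (- (real q * x * logp k)) * r ^ i"
      unfolding r_def using logp_ge_first[of k] x0 by (intro mult_left_mono power_mono) auto
    also have "r ^ i = inverse r ^ q * r ^ j"
      using r by (simp add: i power_add power_inverse)
    finally have "logp k * exp (- (x * (real j * logp k))) \<le> logp k * (exp (- (real q * x * logp k)) * (inverse r ^ q * r ^ j))"
      using logp_pos[of k] by (intro mult_left_mono) auto
    then show "norm (mangoldt kj * exp (- (x * plog kj)))
      \<le> norm (case kj of (k, j) \<Rightarrow> (logp k * exp (- (real q * x * logp k))) * (inverse r ^ q * r ^ j))"
      using logp_pos[of k] r by (simp add: kj mangoldt_def plog_def abs_mult mult.assoc)
  qed
qed

lemma log_powers_summable:
  assumes "1 < x"
  shows "dirichlet_summable (prime_powers 1) (\<lambda>(k, j). 1 / real j) plog x"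
  unfolding dirichlet_summable_def
proof (rule abs_summable_on_comparison_test)
  show "Infinite_Set_Sum.abs_summable_on (\<lambda>i. 1 / logp 0 * (mangoldt i * exp (- (x * plog i)))) (prime_powers 1)"
    using powers_summable[of 1 x] assms
    by (intro abs_summable_on_cmult_right) (simp add: dirichlet_summable_def)
  fix i assume "i \<in> prime_powers 1"
  then obtain k j where i: "i = (k, j)" "1 \<le> j" by (auto simp: prime_powers_def)
  have "1 / real j \<le> 1" using i by simp
  also have "1 \<le> logp k / logp 0" using logp_ge_first[of k] logp_pos[of 0] by simp
  finally have "1 / real j * exp (- (x * plog i)) \<le> logp k / logp 0 * exp (- (x * plog i))"
    by (rule mult_right_mono) simp
  then show "norm ((case i of (k, j) \<Rightarrow> 1 / real j) * exp (- (x * plog i)))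
    \<le> norm (1 / logp 0 * (mangoldt i * exp (- (x * plog i))))"
    using logp_pos[of 0] logp_pos[of k] by (simp add: i mangoldt_def abs_mult)
qed

text \<open>
  A finite partial sum is at most a finite product of truncated geometric series in \<open>r k = p k powr -x\<close>.
  Each factor is at most \<open>1 / (1 - r k)\<close>, hence at most \<open>exp (c * r k)\<close> because \<open>r k \<le> r 0 < 1\<close>.
\<close>

lemma zeta_summable:
  assumes x: "1 < x"
  shows "dirichlet_summable exponents (\<lambda>_. 1) logint x"
proof -
  define r where "r = (\<lambda>k. exp (- (x * logp k)))"
  have r: "0 < r k" "r k \<le> r 0" "r k < 1" for k
    using x logp_pos[of k] logp_ge_first[of k] by (auto simp: r_def)
  have r_sum: "Infinite_Set_Sum.abs_summable_on r UNIV"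
  proof (rule abs_summable_on_comparison_test)
    show "Infinite_Set_Sum.abs_summable_on (\<lambda>k. 1 / logp 0 * (logp k * exp (- (x * logp k)))) UNIV"
      using primes_summable[OF x] by (intro abs_summable_on_cmult_right) (simp add: dirichlet_summable_def)
    fix k
    have "1 * exp (- (x * logp k)) \<le> logp k / logp 0 * exp (- (x * logp k))"
      using logp_ge_first[of k] logp_pos[of 0] by (intro mult_right_mono) auto
    then show "norm (r k) \<le> norm (1 / logp 0 * (logp k * exp (- (x * logp k))))"
      using logp_pos[of 0] logp_pos[of k] by (simp add: r_def abs_mult)
  qed
  define c where "c = 1 / (1 - r 0)"
  have c: "0 < c" using r[of 0] by (simp add: c_def)
  have euler_factor: "(\<Sum>j\<le>B. r k ^ j) \<le> exp (c * r k)" for B k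
  proof -
    have "(\<Sum>j\<le>B. r k ^ j) \<le> (\<Sum>j. r k ^ j)"
      using r[of k] by (intro sum_le_suminf summable_geometric) auto
    also have "\<dots> = 1 / (1 - r k)" using r[of k] by (simp add: suminf_geometric)
    also have "\<dots> = 1 + r k / (1 - r k)" using r[of k] by (simp add: field_simps)
    also have "\<dots> \<le> 1 + r k / (1 - r 0)"
      using r[of k] r[of 0] by (intro add_left_mono divide_left_mono) auto
    also have "\<dots> \<le> exp (c * r k)"
      using exp_ge_add_one_self[of "c * r k"] by (simp add: c_def)
    finally show ?thesis .
  qed
  show ?thesis unfolding dirichlet_summable_def
  proof (rule abs_summable_finite_sumsI)
    fix F assume F: "finite F" "F \<subseteq> exponents"
    define K where "K = (\<Union>m\<in>F. {k. m k \<noteq> 0})"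
    have K: "finite K" using F by (auto simp: K_def exponents_def)
    obtain B where B: "\<And>m k. m \<in> F \<Longrightarrow> k \<in> K \<Longrightarrow> m k \<le> B"
    proof (rule that)
      fix m k assume mk: "m \<in> F" "k \<in> K"
      have "m k \<in> (\<lambda>(m, k). m k) ` (F \<times> K)" using mk by force
      then show "m k \<le> Max ((\<lambda>(m, k). m k) ` (F \<times> K))" using F K by (intro Max_ge) auto
    qed
    have factor: "norm (1 * exp (- (x * logint m))) = (\<Prod>k\<in>K. r k ^ m k)" if "m \<in> F" for m
    proof -
      have "logint m = (\<Sum>k\<in>K. real (m k) * logp k)"
        using that K by (intro logint_eq_sum) (auto simp: K_def)
      then have "exp (- (x * logint m)) = exp (\<Sum>k\<in>K. real (m k) * (- (x * logp k)))"
        by (simp add: sum_distrib_left sum_negf mult_ac)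
      also have "\<dots> = (\<Prod>k\<in>K. r k ^ m k)"
        unfolding exp_sum[OF K] r_def by (simp only: exp_of_nat_mult)
      finally have eq: "exp (- (x * logint m)) = (\<Prod>k\<in>K. r k ^ m k)" .
      have "norm (1 * exp (- (x * logint m))) = exp (- (x * logint m))" by simp
      then show ?thesis by (simp only: eq)
    qed
    have inj: "inj_on (\<lambda>m. restrict m K) F"
    proof (rule inj_onI)
      fix m m' assume m: "m \<in> F" "m' \<in> F" "restrict m K = restrict m' K"
      have "m k = m' k" for k
      proof (cases "k \<in> K")
        case True
        then show ?thesis using m(3) by (metis restrict_apply')
      next
        case False
        then have zero: "\<forall>x\<in>F. x k = 0" by (simp add: K_def)
        have "m k = 0" "m' k = 0" by (rule bspec[OF zero m(1)], rule bspec[OF zero m(2)])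
        then show ?thesis by simp
      qed
      then show "m = m'" by blast
    qed
    have "(\<Sum>m\<in>F. norm (1 * exp (- (x * logint m)))) = (\<Sum>m\<in>F. \<Prod>k\<in>K. r k ^ restrict m K k)"
    proof (rule sum.cong[OF refl])
      fix m assume m: "m \<in> F"
      show "norm (1 * exp (- (x * logint m))) = (\<Prod>k\<in>K. r k ^ restrict m K k)"
        unfolding factor[OF m] by (intro prod.cong) auto
    qed
    also have "\<dots> = (\<Sum>g\<in>(\<lambda>m. restrict m K) ` F. \<Prod>k\<in>K. r k ^ g k)"
      using inj by (simp add: sum.reindex)
    also have "\<dots> \<le> (\<Sum>g\<in>PiE K (\<lambda>_. {..B}). \<Prod>k\<in>K. r k ^ g k)"
      using B K r by (intro sum_mono2 finite_PiE) (auto intro!: prod_nonneg zero_le_power less_imp_le[OF r(1)])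
    also have "\<dots> = (\<Prod>k\<in>K. \<Sum>j\<le>B. r k ^ j)"
      using K by (subst prod_sum_PiE) auto
    also have "\<dots> \<le> (\<Prod>k\<in>K. exp (c * r k))"
      using euler_factor r by (intro prod_mono) (auto intro!: sum_nonneg zero_le_power less_imp_le[OF r(1)])
    also have "\<dots> = exp (c * (\<Sum>k\<in>K. r k))"
      using K by (simp add: exp_sum sum_distrib_left)
    also have "\<dots> \<le> exp (c * infsetsum r UNIV)"
    proof -
      have "(\<Sum>k\<in>K. r k) = infsetsum r K" using K by simp
      also have "\<dots> \<le> infsetsum r UNIV"
        using r_sum K r by (intro infsetsum_mono_neutral) (auto intro: less_imp_le[OF r(1)])
      finally show ?thesis using c by simp
    qed
    finally show "(\<Sum>m\<in>F. norm (1 * exp (- (x * logint m)))) \<le> exp (c * infsetsum r UNIV)" .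
  qed
qed

text \<open>
  This is \<open>log n = (sum of \<Lambda>(d) over the divisors d of n)\<close>, multiplied by \<open>n powr -s\<close> and summed. The
  logarithm of the integer with exponents \<open>m\<close> is the sum of \<open>log (p k)\<close> over the pairs \<open>(k, j)\<close> with
  \<open>1 \<le> j \<le> m k\<close>, and removing \<open>j\<close> factors \<open>p k\<close> from \<open>m\<close> sets up a bijection of such triples
  \<open>(m, k, j)\<close> with the pairs of an integer and a prime power.
\<close>

lemma zeta_log_derivative_identity:
  assumes s: "1 < Re s"
  shows "dirichlet exponents (\<lambda>m. logint m * 1) logint s = zeta s * power_series 1 s"
proof -
  define f :: "(nat \<Rightarrow> nat) \<Rightarrow> complex" where "f = (\<lambda>m. of_real 1 * exp (- (s * of_real (logint m))))"
  define g :: "nat \<times> nat \<Rightarrow> complex" where "g = (\<lambda>i. of_real (mangoldt i) * exp (- (s * of_real (plog i))))"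
  define T where "T = Sigma exponents (\<lambda>m. {(k, j). 1 \<le> j \<and> j \<le> m k})"
  define F :: "(nat \<Rightarrow> nat) \<times> (nat \<times> nat) \<Rightarrow> complex" where
    "F = (\<lambda>(m, i). of_real (mangoldt i) * exp (- (s * of_real (logint m))))"
  define \<phi> :: "(nat \<Rightarrow> nat) \<times> (nat \<times> nat) \<Rightarrow> (nat \<Rightarrow> nat) \<times> (nat \<times> nat)" where
    "\<phi> = (\<lambda>(m, (k, j)). (m(k := m k + j), (k, j)))"
  have f: "Infinite_Set_Sum.abs_summable_on f exponents"
    using zeta_summable[OF s] unfolding dirichlet_summable_def f_def
    by (rule abs_summable_on_comparison_test) (simp add: norm_mult)
  have g: "Infinite_Set_Sum.abs_summable_on g (prime_powers 1)"
  proof -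
    have "dirichlet_summable (prime_powers 1) mangoldt plog (Re s)"
      using s by (intro powers_summable) auto
    then show ?thesis unfolding dirichlet_summable_def g_def
      by (rule abs_summable_on_comparison_test) (simp add: norm_mult abs_mult)
  qed
  have cnt: "countable exponents" "countable (prime_powers 1)"
    by (rule countable_exponents) simp
  have prod_sum: "Infinite_Set_Sum.abs_summable_on (\<lambda>(m, i). f m * g i) (exponents \<times> prime_powers 1)"
    by (rule abs_summable_on_product[OF cnt f g])
  have bij: "bij_betw \<phi> (exponents \<times> prime_powers 1) T"
  proof (rule bij_betwI[where g = "\<lambda>(m, (k, j)). (m(k := m k - j), (k, j))"])
    show "\<phi> \<in> exponents \<times> prime_powers 1 \<rightarrow> T"
    proof
      fix x assume "x \<in> exponents \<times> prime_powers 1"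
      then obtain m k j where x: "x = (m, (k, j))" "m \<in> exponents" "1 \<le> j"
        by (auto simp: prime_powers_def)
      have "finite (insert k {i. m i \<noteq> 0})" using x by (simp add: exponents_def)
      then have "m(k := m k + j) \<in> exponents"
        unfolding exponents_def mem_Collect_eq by (rule rev_finite_subset) (auto split: if_splits)
      then show "\<phi> x \<in> T" using x by (auto simp: \<phi>_def T_def)
    qed
    show "(\<lambda>(m, (k, j)). (m(k := m k - j), (k, j))) \<in> T \<rightarrow> exponents \<times> prime_powers 1"
    proof
      fix x assume "x \<in> T"
      then obtain m k j where x: "x = (m, (k, j))" "m \<in> exponents" "1 \<le> j" "j \<le> m k"
        by (auto simp: T_def)
      have "finite {i. m i \<noteq> 0}" using x by (simp add: exponents_def)
      then have "m(k := m k - j) \<in> exponents"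
        unfolding exponents_def mem_Collect_eq by (rule rev_finite_subset) (auto split: if_splits)
      then show "(\<lambda>(m, (k, j)). (m(k := m k - j), (k, j))) x \<in> exponents \<times> prime_powers 1"
        using x by (auto simp: prime_powers_def)
    qed
  qed (auto simp: \<phi>_def T_def)
  have F\<phi>: "F (\<phi> x) = (case x of (m, i) \<Rightarrow> f m * g i)" if "x \<in> exponents \<times> prime_powers 1" for x
  proof -
    obtain m i where mi: "x = (m, i)" by (cases x)
    obtain k j where "i = (k, j)" by (cases i)
    with mi that have x: "x = (m, (k, j))" "m \<in> exponents" by auto
    have "F (\<phi> x) = of_real (logp k) * exp (- (s * of_real (logint m + real j * logp k)))"
      by (simp only: x \<phi>_def F_def mangoldt_def prod.case logint_add_power[OF x(2)])
    also have "\<dots> = (case x of (m, i) \<Rightarrow> f m * g i)"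
      by (simp add: x f_def g_def mangoldt_def plog_def algebra_simps exp_add[symmetric])
    finally show ?thesis .
  qed
  have F_sum: "Infinite_Set_Sum.abs_summable_on F T"
    using prod_sum unfolding abs_summable_on_reindex_bij_betw[OF bij, symmetric]
    by (subst abs_summable_on_cong[OF F\<phi> refl]) auto
  have fiber: "infsetsum (\<lambda>i. F (m, i)) {(k, j). 1 \<le> j \<and> j \<le> m k}
      = of_real (logint m * 1) * exp (- (s * of_real (logint m)))" if m: "m \<in> exponents" for m
  proof -
    define K where "K = {k. m k \<noteq> 0}"
    have K: "finite K" using m by (simp add: K_def exponents_def)
    have set: "{(k, j). 1 \<le> j \<and> j \<le> m k} = Sigma K (\<lambda>k. {1..m k})" by (auto simp: K_def)
    have fin: "finite (Sigma K (\<lambda>k. {1..m k}))" using K by (intro finite_SigmaI) auto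
    have "infsetsum (\<lambda>i. F (m, i)) {(k, j). 1 \<le> j \<and> j \<le> m k} = (\<Sum>i\<in>Sigma K (\<lambda>k. {1..m k}). F (m, i))"
      unfolding set by (rule infsetsum_finite[OF fin])
    also have "\<dots> = (\<Sum>k\<in>K. \<Sum>j\<in>{1..m k}. of_real (logp k) * exp (- (s * of_real (logint m))))"
      using K by (subst sum.Sigma) (auto simp: F_def mangoldt_def intro!: sum.cong)
    also have "\<dots> = of_real (\<Sum>k\<in>K. real (m k) * logp k) * exp (- (s * of_real (logint m)))"
      by (simp add: sum_distrib_right mult.assoc)
    also have "(\<Sum>k\<in>K. real (m k) * logp k) = logint m"
      using K by (intro logint_eq_sum[symmetric]) (auto simp: K_def)
    finally show ?thesis by simp
  qed
  have "dirichlet exponents (\<lambda>m. logint m * 1) logint s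
      = infsetsum (\<lambda>m. infsetsum (\<lambda>i. F (m, i)) {(k, j). 1 \<le> j \<and> j \<le> m k}) exponents"
    unfolding dirichlet_def by (intro infsetsum_cong refl fiber[symmetric])
  also have "\<dots> = infsetsum F T"
    unfolding T_def by (rule infsetsum_Sigma[symmetric]) (use F_sum cnt in \<open>auto simp: T_def\<close>)
  also have "\<dots> = infsetsum (\<lambda>x. F (\<phi> x)) (exponents \<times> prime_powers 1)"
    by (rule infsetsum_reindex_bij_betw[OF bij, symmetric])
  also have "\<dots> = infsetsum (\<lambda>(m, i). f m * g i) (exponents \<times> prime_powers 1)"
    by (intro infsetsum_cong refl F\<phi>)
  also have "\<dots> = infsetsum f exponents * infsetsum g (prime_powers 1)"
    by (rule infsetsum_product[OF cnt f g])
  finally show ?thesis by (simp add: dirichlet_def f_def g_def)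
qed

lemma log_zeta_has_derivative:
  assumes "1 < Re s"
  shows "(log_zeta has_field_derivative - power_series 1 s) (at s)"
proof -
  have "dirichlet (prime_powers 1) (\<lambda>i. plog i * (case i of (k, j) \<Rightarrow> 1 / real j)) plog s = power_series 1 s"
    unfolding dirichlet_def
    by (intro infsetsum_cong) (auto simp: prime_powers_def plog_def mangoldt_def)
  then show ?thesis
    using log_powers.dirichlet_has_derivative[OF log_powers_summable assms] by simp
qed

lemma zeta_has_derivative:
  assumes "1 < Re s"
  shows "(zeta has_field_derivative - (zeta s * power_series 1 s)) (at s)"
  unfolding zeta_log_derivative_identity[OF assms, symmetric]
  by (rule integers.dirichlet_has_derivative[OF zeta_summable assms])

text \<open>
  The constant ratio of \<open>zeta\<close> and \<open>exp log_zeta\<close>, evaluated at an arbitrary point of the half-plane.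
\<close>

definition zeta_factor :: complex where
  "zeta_factor = zeta 2 * exp (- log_zeta 2)"

text \<open>
  The quotient \<open>zeta / exp log_zeta\<close> has derivative zero, because \<open>zeta' / zeta\<close> and the derivative of
  \<open>log_zeta\<close> are both minus the sum over the prime powers. This form shows at once that \<open>zeta\<close> has no zeros, and it turns
  bounds for \<open>Re log_zeta\<close> into bounds for \<open>|zeta|\<close> from both sides.
\<close>

lemma zeta_eq_exp_log_zeta:
  assumes s: "1 < Re s"
  shows "zeta s = zeta_factor * exp (log_zeta s)"
proof -
  have "\<exists>c. \<forall>s\<in>{s. 1 < Re s}. zeta s * exp (- log_zeta s) = c"
  proof (rule has_field_derivative_zero_constant[OF convex_halfspace_Re_gt])
    fix s assume "s \<in> {s. 1 < Re s}"
    then have s: "1 < Re s" by simp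
    show "((\<lambda>s. zeta s * exp (- log_zeta s)) has_field_derivative 0) (at s within {s. 1 < Re s})"
    proof (rule has_field_derivative_at_within)
      have "((\<lambda>s. exp (- log_zeta s)) has_field_derivative exp (- log_zeta s) * - (- power_series 1 s)) (at s)"
        by (rule DERIV_chain2[OF DERIV_exp DERIV_minus[OF log_zeta_has_derivative[OF s]]])
      from DERIV_mult[OF zeta_has_derivative[OF s] this]
      show "((\<lambda>s. zeta s * exp (- log_zeta s)) has_field_derivative 0) (at s)"
        by (rule DERIV_cong) (simp add: mult_ac)
    qed
  qed
  then obtain c where c: "\<And>s. 1 < Re s \<Longrightarrow> zeta s * exp (- log_zeta s) = c" by blast
  have "zeta s * exp (- log_zeta s) = zeta_factor"
    unfolding zeta_factor_def using c[OF s] c[of 2] by simp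
  then show ?thesis by (simp add: exp_minus field_simps)
qed

lemma zeta_factor_nonzero: "zeta_factor \<noteq> 0"
proof
  assume "zeta_factor = 0"
  then have "zeta (of_real 2) = 0" by (simp add: zeta_factor_def)
  then have "(\<Sum>\<^sub>am\<in>exponents. 1 * exp (- (2 * logint m))) = 0"
    by (simp only: integers.dirichlet_of_real of_real_eq_0_iff)
  moreover have "(\<Sum>\<^sub>am\<in>{\<lambda>_. 0}. 1 * exp (- (2 * logint m))) \<le> (\<Sum>\<^sub>am\<in>exponents. 1 * exp (- (2 * logint m)))"
    using zeta_summable[of 2]
    by (intro infsetsum_mono_neutral) (auto simp: dirichlet_summable_def exponents_def)
  moreover have "logint (\<lambda>_. 0) = 0" by (simp add: logint_def gen_integer_def)
  ultimately show False by simp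
qed

lemma power_series_split:
  assumes "1 < Re s"
  shows "power_series 1 s = theta_series s + power_series 2 s"
proof -
  define g :: "nat \<times> nat \<Rightarrow> complex" where "g = (\<lambda>i. of_real (mangoldt i) * exp (- (s * of_real (plog i))))"
  have g: "Infinite_Set_Sum.abs_summable_on g (prime_powers 1)"
  proof -
    have "dirichlet_summable (prime_powers 1) mangoldt plog (Re s)"
      using assms by (intro powers_summable) auto
    then show ?thesis unfolding dirichlet_summable_def g_def
      by (rule abs_summable_on_comparison_test) (simp add: norm_mult abs_mult)
  qed
  have split: "prime_powers 1 = UNIV \<times> {1} \<union> prime_powers 2" by (auto simp: prime_powers_def)
  have "infsetsum g (prime_powers 1) = infsetsum g (UNIV \<times> {1}) + infsetsum g (prime_powers 2)"
    unfolding split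
  proof (rule infsetsum_Un_disjoint)
    show "Infinite_Set_Sum.abs_summable_on g (UNIV \<times> {1})"
      by (rule abs_summable_on_subset[OF g]) (auto simp: prime_powers_def)
    show "Infinite_Set_Sum.abs_summable_on g (prime_powers 2)"
      by (rule abs_summable_on_subset[OF g]) (auto simp: prime_powers_def)
  qed (auto simp: prime_powers_def)
  also have "infsetsum g (UNIV \<times> {1}) = infsetsum (\<lambda>k. g (k, 1)) UNIV"
    by (rule infsetsum_reindex_bij_betw[symmetric]) (auto simp: bij_betw_def inj_on_def)
  also have "\<dots> = theta_series s"
    unfolding dirichlet_def by (simp add: g_def mangoldt_def plog_def)
  finally show ?thesis by (simp add: dirichlet_def g_def)
qed

text \<open>
  Every term carries the factor \<open>3 + 4 cos \<alpha> + cos 2\<alpha> = 2 (1 + cos \<alpha>) ^ 2\<close>.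
\<close>

lemma three_four_one:
  assumes x: "1 < x"
  shows "0 \<le> 3 * Re (log_zeta (of_real x)) + 4 * Re (log_zeta (Complex x t)) + Re (log_zeta (Complex x (2 * t)))"
proof -
  define c :: "nat \<times> nat \<Rightarrow> real" where "c = (\<lambda>i. (case i of (k, j) \<Rightarrow> 1 / real j) * exp (- (x * plog i)))"
  have c: "Infinite_Set_Sum.abs_summable_on c (prime_powers 1)"
    using log_powers_summable[OF x] by (simp add: dirichlet_summable_def c_def)
  have cc: "Infinite_Set_Sum.abs_summable_on (\<lambda>i. c i * cos (v * plog i)) (prime_powers 1)" for v
    by (rule abs_summable_on_comparison_test[OF c]) (simp add: abs_mult mult_left_le)
  have Re: "Re (log_zeta (Complex x v)) = infsetsum (\<lambda>i. c i * cos (v * plog i)) (prime_powers 1)" for v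
  proof -
    have eq: "Re (of_real (case i of (k, j) \<Rightarrow> 1 / real j) * exp (- (Complex x v * of_real (plog i)))) = c i * cos (v * plog i)" for i
      by (simp add: c_def Re_exp)
    have "Infinite_Set_Sum.abs_summable_on (\<lambda>i. complex_of_real (case i of (k, j) \<Rightarrow> 1 / real j) * exp (- (Complex x v * of_real (plog i)))) (prime_powers 1)"
      by (rule abs_summable_on_comparison_test[OF c]) (simp add: c_def norm_mult abs_mult)
    then show ?thesis unfolding dirichlet_def by (simp only: Re_infsetsum eq)
  qed
  have "0 \<le> infsetsum (\<lambda>i. 3 * c i + 4 * (c i * cos (t * plog i)) + c i * cos (2 * t * plog i)) (prime_powers 1)"
  proof (rule infsetsum_nonneg)
    fix i assume "i \<in> prime_powers 1"
    have "cos (2 * t * plog i) = 2 * (cos (t * plog i))\<^sup>2 - 1"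
      using cos_double_cos[of "t * plog i"] by (simp add: mult.assoc)
    then have "3 * c i + 4 * (c i * cos (t * plog i)) + c i * cos (2 * t * plog i) = 2 * c i * (1 + cos (t * plog i))\<^sup>2"
      by (simp only:) (simp add: power2_eq_square algebra_simps)
    also have "\<dots> \<ge> 0" by (auto simp: c_def split: prod.splits)
    finally show "0 \<le> 3 * c i + 4 * (c i * cos (t * plog i)) + c i * cos (2 * t * plog i)" .
  qed
  also have "\<dots> = 3 * infsetsum c (prime_powers 1) + 4 * infsetsum (\<lambda>i. c i * cos (t * plog i)) (prime_powers 1)
      + infsetsum (\<lambda>i. c i * cos (2 * t * plog i)) (prime_powers 1)"
    using c cc by (simp add: infsetsum_add infsetsum_cmult_right abs_summable_on_add abs_summable_on_cmult_right)
  also have "infsetsum c (prime_powers 1) = Re (log_zeta (of_real x))"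
    using Re[of 0] by (simp add: complex_of_real_def)
  finally show ?thesis by (simp only: Re)
qed

text \<open>
  The prime powers with exponent at least two already converge for \<open>Re s > 1 / 2\<close>.
\<close>

lemma slow_higher_powers: "slow (\<lambda>z. power_series 2 (1 + z))"
proof (rule slow_bounded[of _ "1/4"])
  have sum: "dirichlet_summable (prime_powers 2) mangoldt plog x" if "1 / 2 < x" for x
    using that by (intro powers_summable) auto
  have "(power_series 2 \<circ> (\<lambda>z. 1 + z)) holomorphic_on {z. - (1/4) < Re z}"
  proof (rule holomorphic_on_compose_gen[where t = "{s. 1 / 2 < Re s}"])
    show "power_series 2 holomorphic_on {s. 1 / 2 < Re s}"
      by (rule powers.dirichlet_holomorphic[OF sum])
  qed (auto intro!: holomorphic_intros)
  then show "(\<lambda>z. power_series 2 (1 + z)) holomorphic_on {z. - (1/4) < Re z}" by (simp add: o_def)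
  show "norm (power_series 2 (1 + z)) \<le> Re (power_series 2 (of_real (3/4)))" if "- (1/4) < Re z" for z
  proof -
    have "norm (power_series 2 (1 + z)) \<le> Re (power_series 2 (of_real (Re (1 + z))))"
      using that by (intro powers.norm_dirichlet_le sum) auto
    also have "\<dots> \<le> Re (power_series 2 (of_real (3/4)))"
      using that by (intro powers.Re_dirichlet_antimono sum) auto
    finally show ?thesis .
  qed
qed simp

end

section \<open>Passing between the integers and the primes in the half-plane\<close>

lemma slow_of_bounded_derivs:
  assumes "g holomorphic_on right_half_plane"
    and "\<And>k. \<exists>B. \<forall>z. 0 < Re z \<longrightarrow> Re z < 1 \<longrightarrow> norm ((deriv ^^ k) g z) \<le> B"
  shows "slow g"
proof (rule slowI[OF assms(1)])
  fix j :: nat and e :: real assume e: "0 < e"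
  obtain B where B: "\<forall>z. 0 < Re z \<longrightarrow> Re z < 1 \<longrightarrow> norm ((deriv ^^ j) g z) \<le> B"
    using assms(2) by blast
  have "norm ((deriv ^^ j) g z) \<le> \<bar>B\<bar> * (1 + \<bar>Im z\<bar>) powr e" if z: "0 < Re z" "Re z < 1" for z
  proof -
    have "norm ((deriv ^^ j) g z) \<le> \<bar>B\<bar> * 1" using B z by fastforce
    also have "\<dots> \<le> \<bar>B\<bar> * (1 + \<bar>Im z\<bar>) powr e"
      using e by (intro mult_left_mono ge_one_powr_ge_zero) auto
    finally show ?thesis .
  qed
  then show "\<exists>C. \<forall>z. 0 < Re z \<longrightarrow> Re z < 1 \<longrightarrow> norm ((deriv ^^ j) g z) \<le> C * (1 + \<bar>Im z\<bar>) powr e"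
    by blast
qed

lemma norm_diff_horizontal_le:
  assumes der: "\<And>x. x1 \<le> x \<Longrightarrow> x \<le> x2 \<Longrightarrow> (g has_field_derivative g' (Complex x t)) (at (Complex x t))"
    and B: "\<And>x. x1 \<le> x \<Longrightarrow> x \<le> x2 \<Longrightarrow> norm (g' (Complex x t)) \<le> B" and x: "x1 \<le> x2"
  shows "norm (g (Complex x1 t) - g (Complex x2 t)) \<le> B * (x2 - x1)"
proof -
  have seg: "u = Complex (Re u) t \<and> x1 \<le> Re u \<and> Re u \<le> x2" if u: "u \<in> closed_segment (Complex x1 t) (Complex x2 t)" for u
  proof -
    from u obtain v where v: "0 \<le> v" "v \<le> 1" "u = (1 - v) *\<^sub>R Complex x1 t + v *\<^sub>R Complex x2 t"
      by (auto simp: in_segment)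
    have "Re u = x1 + v * (x2 - x1)" "Im u = t" by (simp_all add: v algebra_simps)
    moreover have "0 \<le> v * (x2 - x1)" "v * (x2 - x1) \<le> 1 * (x2 - x1)"
      using v x by (intro mult_nonneg_nonneg mult_right_mono; simp)+
    ultimately show ?thesis by (simp add: complex_eq_iff)
  qed
  have "norm (g (Complex x1 t) - g (Complex x2 t)) \<le> B * norm (Complex x1 t - Complex x2 t)"
  proof (rule field_differentiable_bound[where S = "closed_segment (Complex x1 t) (Complex x2 t)" and f' = g'])
    fix u assume u: "u \<in> closed_segment (Complex x1 t) (Complex x2 t)"
    show "(g has_field_derivative g' u) (at u within closed_segment (Complex x1 t) (Complex x2 t))"
      using der[of "Re u"] seg[OF u] by (metis has_field_derivative_at_within)
    show "norm (g' u) \<le> B" using B[of "Re u"] seg[OF u] by metis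
  qed auto
  also have "Complex x1 t - Complex x2 t = of_real (x1 - x2)" by (simp add: complex_eq_iff)
  also have "norm (complex_of_real (x1 - x2)) = x2 - x1" unfolding norm_of_real using x by simp
  finally show ?thesis .
qed

lemma norm_ratio_bounds:
  assumes "0 < Re z"
  shows "norm z / (1 + norm z) \<le> norm (z / (1 + z))" "norm (z / (1 + z)) \<le> 1" "norm (z / (1 + z)) \<le> norm z"
proof -
  have pos: "1 < norm (1 + z)" using complex_Re_le_cmod[of "1 + z"] assms by simp
  have "norm (1 + z) \<le> 1 + norm z" using norm_triangle_ineq[of 1 z] by simp
  then show "norm z / (1 + norm z) \<le> norm (z / (1 + z))"
    unfolding norm_divide using pos by (intro divide_left_mono mult_pos_pos) (auto intro: add_pos_nonneg)
  have "(norm z)\<^sup>2 \<le> (norm (1 + z))\<^sup>2" unfolding cmod_power2 using assms by (simp add: power2_eq_square algebra_simps)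
  then have "norm z \<le> norm (1 + z)" by (rule power2_le_imp_le) simp
  then show "norm (z / (1 + z)) \<le> 1" unfolding norm_divide using pos by (subst divide_le_eq_1_pos) auto
  have "norm z / norm (1 + z) \<le> norm z / 1" using pos by (intro divide_left_mono) auto
  then show "norm (z / (1 + z)) \<le> norm z" by (simp add: norm_divide)
qed

lemma slow_inverse_shift: "slow (\<lambda>z. 1 / (1 + z))"
proof (rule slow_bounded[of _ "1/2" 2])
  have nz: "1 + z \<noteq> 0" if "- (1/2) < Re z" for z :: complex
    using that by (auto simp: complex_eq_iff)
  show "(\<lambda>z::complex. 1 / (1 + z)) holomorphic_on {z. - (1/2) < Re z}"
    using nz by (auto intro!: holomorphic_intros)
  show "norm (1 / (1 + z)) \<le> 2" if "- (1/2) < Re z" for z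
  proof -
    have "1/2 \<le> norm (1 + z)" using complex_Re_le_cmod[of "1 + z"] that by simp
    then have "inverse (norm (1 + z)) \<le> inverse (1/2)" by (rule le_imp_inverse_le) simp
    then show ?thesis by (simp add: norm_divide inverse_eq_divide)
  qed
qed simp

context summable_gen_primes
begin

abbreviation Z :: "complex \<Rightarrow> complex" where "Z \<equiv> integers.residue_form"
abbreviation V :: "complex \<Rightarrow> complex" where "V \<equiv> primes.residue_form"
abbreviation R :: "complex \<Rightarrow> complex" where "R \<equiv> \<lambda>z. power_series 2 (1 + z)"

definition Z_log_deriv :: "complex \<Rightarrow> complex" where
  "Z_log_deriv z = 1 / z - 1 / (1 + z) - theta_series (1 + z) - R z"

text \<open>
  A holomorphic logarithm of \<open>Z\<close>, up to an additive constant.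
\<close>

definition Z_log :: "complex \<Rightarrow> complex" where
  "Z_log z = log_zeta (1 + z) + Ln z - Ln (1 + z)"

lemma Z_log_has_derivative:
  assumes z: "0 < Re z"
  shows "(Z_log has_field_derivative Z_log_deriv z) (at z)"
proof -
  have "((\<lambda>z. log_zeta (1 + z)) has_field_derivative - power_series 1 (1 + z) * 1) (at z)"
    by (rule DERIV_chain2[where f = log_zeta and g = "\<lambda>z. 1 + z"])
      (use z log_zeta_has_derivative[of "1 + z"] in \<open>auto intro!: derivative_eq_intros\<close>)
  moreover have "(Ln has_field_derivative inverse z) (at z)"
    using z by (intro has_field_derivative_Ln) (auto simp: complex_nonpos_Reals_iff)
  moreover have "((\<lambda>z. Ln (1 + z)) has_field_derivative inverse (1 + z) * 1) (at z)"
    by (rule DERIV_chain2[where f = Ln and g = "\<lambda>z. 1 + z"])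
      (use z in \<open>auto intro!: derivative_eq_intros has_field_derivative_Ln simp: complex_nonpos_Reals_iff\<close>)
  ultimately have "(Z_log has_field_derivative
      (- power_series 1 (1 + z) * 1 + inverse z) - inverse (1 + z) * 1) (at z)"
    unfolding Z_log_def by (intro DERIV_diff DERIV_add)
  also have "(- power_series 1 (1 + z) * 1 + inverse z) - inverse (1 + z) * 1 = Z_log_deriv z"
    using z by (simp only: power_series_split Z_log_deriv_def plus_complex.sel one_complex.sel)
      (simp add: inverse_eq_divide)
  finally show ?thesis .
qed

lemma Z_eq_exp_Z_log:
  assumes z: "0 < Re z"
  shows "Z z = zeta_factor * exp (Z_log z)"
proof -
  have "z \<noteq> 0" "1 + z \<noteq> 0" using z by (auto simp: complex_eq_iff)
  then have "exp (Z_log z) = exp (log_zeta (1 + z)) * z / (1 + z)"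
    by (simp add: Z_log_def exp_add exp_diff)
  moreover have "zeta (1 + z) = zeta_factor * exp (log_zeta (1 + z))"
    using z by (intro zeta_eq_exp_log_zeta) simp
  ultimately show ?thesis by (simp add: integers.residue_form_def)
qed

lemma Z_nonzero: "0 < Re z \<Longrightarrow> Z z \<noteq> 0"
  by (simp add: Z_eq_exp_Z_log zeta_factor_nonzero)

lemma Z_has_derivative:
  assumes "0 < Re z"
  shows "(Z has_field_derivative Z_log_deriv z * Z z) (at z)"
proof -
  have "((\<lambda>z. zeta_factor * exp (Z_log z)) has_field_derivative zeta_factor * (exp (Z_log z) * Z_log_deriv z)) (at z)"
    by (rule DERIV_cmult[OF DERIV_chain2[OF DERIV_exp Z_log_has_derivative[OF assms]]])
  then have "((\<lambda>z. zeta_factor * exp (Z_log z)) has_field_derivative Z_log_deriv z * Z z) (at z)"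
    by (rule DERIV_cong) (simp add: Z_eq_exp_Z_log[OF assms] mult_ac)
  then show ?thesis
    by (rule has_field_derivative_transform_within_open[OF _ open_right_half_plane])
      (use assms Z_eq_exp_Z_log in auto)
qed

lemma Z_holomorphic: "Z holomorphic_on right_half_plane"
  unfolding holomorphic_on_open[OF open_right_half_plane]
proof
  fix z assume "z \<in> right_half_plane"
  then have "0 < Re z" by simp
  from Z_has_derivative[OF this] show "\<exists>f'. (Z has_field_derivative f') (at z)" by blast
qed

lemma V_eq:
  assumes "0 < Re z"
  shows "V z = z / (1 + z) * (1 / z - 1 / (1 + z) - Z_log_deriv z - R z)"
  by (simp add: primes.residue_form_def Z_log_deriv_def)

lemma Z_log_deriv_eq:
  assumes "0 < Re z"
  shows "Z_log_deriv z = (1 - V z) / z - V z - 1 / (1 + z) - R z"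
proof -
  have nz: "z \<noteq> 0" "1 + z \<noteq> 0" using assms by (auto simp: complex_eq_iff)
  have "V z / z + V z = V z * ((1 + z) / z)" using nz by (simp add: field_simps)
  also have "\<dots> = theta_series (1 + z)" using nz by (simp add: primes.residue_form_def)
  finally have eq: "theta_series (1 + z) = V z / z + V z" by (rule sym)
  show ?thesis unfolding Z_log_deriv_def eq diff_divide_distrib by (simp add: algebra_simps)
qed

text \<open>
  The coefficients of \<open>log_zeta\<close> are nonnegative, so \<open>|Re log_zeta|\<close> is largest on the real axis.
\<close>

lemma norm_exp_log_zeta_ge:
  assumes "1 < Re s"
  shows "exp (- Re (log_zeta (of_real (Re s)))) \<le> norm (exp (log_zeta s))"
proof -
  have "\<bar>Re (log_zeta s)\<bar> \<le> Re (log_zeta (of_real (Re s)))"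
    using log_powers.norm_dirichlet_le[OF log_powers_summable[OF assms]] abs_Re_le_cmod[of "log_zeta s"]
    by linarith
  then show ?thesis by simp
qed

text \<open>
  Close to \<open>0\<close> the limit \<open>a > 0\<close> keeps \<open>Z\<close> away from zero; at a fixed distance from the boundary
  \<open>|zeta|\<close> is at least the reciprocal of its value at a real point, up to a constant.
\<close>

lemma Z_lower_bound_near_real_axis:
  assumes lim: "\<And>z. 0 < Re z \<Longrightarrow> norm z < 1 \<Longrightarrow> norm (Z z - of_real a) \<le> C * norm z" and a: "0 < a"
  shows "\<exists>d>0. \<exists>m>0. \<forall>z. 0 < Re z \<longrightarrow> \<bar>Im z\<bar> \<le> d \<longrightarrow> Re z < 1 \<longrightarrow> m \<le> norm (Z z)"
proof -
  define c where "c = zeta_factor"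
  have c: "c \<noteq> 0" "\<And>s. 1 < Re s \<Longrightarrow> zeta s = c * exp (log_zeta s)"
    by (simp_all only: c_def zeta_factor_nonzero zeta_eq_exp_log_zeta not_False_eq_True)
  have C: "0 \<le> C"
  proof -
    have "0 \<le> C * norm (1/2 :: complex)" using order_trans[OF norm_ge_zero lim[of "1/2"]] by simp
    then show ?thesis by simp
  qed
  define d where "d = min (1 / 4) (a / (4 * (C + 1)))"
  have d: "0 < d" using a C by (simp add: d_def)
  have d4: "d \<le> 1 / 4" unfolding d_def by (rule min.cobounded1)
  have da: "d \<le> a / (4 * (C + 1))" unfolding d_def by (rule min.cobounded2)
  note d = d d4 da
  define m' where "m' = d / (1 + d) * (norm c * exp (- Re (log_zeta (of_real (1 + d)))))"
  have m': "0 < m'" using d c by (simp add: m'_def)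
  have "min (a / 2) m' \<le> norm (Z z)" if z: "0 < Re z" "\<bar>Im z\<bar> \<le> d" "Re z < 1" for z
  proof (cases "Re z < d")
    case True
    have nz: "norm z \<le> 2 * d" using cmod_le[of z] z True by linarith
    then have "norm z < 1" using d by linarith
    then have "norm (Z z - of_real a) \<le> C * norm z" using z by (intro lim)
    also have "\<dots> \<le> C * (2 * d)" using nz C by (intro mult_left_mono)
    also have "\<dots> \<le> (C + 1) * (2 * (a / (4 * (C + 1))))" using d C by (intro mult_mono) auto
    also have "\<dots> = a / 2" using C by (simp add: field_simps)
    finally have "norm (Z z - of_real a) \<le> a / 2" .
    moreover have "norm (of_real a :: complex) \<le> norm (Z z) + norm (Z z - of_real a)"
      using norm_triangle_ineq4[of "Z z" "Z z - of_real a"] by simp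
    ultimately show ?thesis using a by simp
  next
    case False
    then have x: "d \<le> Re z" by simp
    have "d / (1 + d) \<le> norm z / (1 + norm z)"
      using x complex_Re_le_cmod[of z] d by (simp add: field_simps)
    also have "\<dots> \<le> norm (z / (1 + z))" using z by (intro norm_ratio_bounds)
    finally have 1: "d / (1 + d) \<le> norm (z / (1 + z))" .
    have "Re (log_zeta (of_real (Re (1 + z)))) \<le> Re (log_zeta (of_real (1 + d)))"
      using x d z by (intro log_powers.Re_dirichlet_antimono log_powers_summable) auto
    then have "exp (- Re (log_zeta (of_real (1 + d)))) \<le> norm (exp (log_zeta (1 + z)))"
      using norm_exp_log_zeta_ge[of "1 + z"] z by (simp del: norm_exp_eq_Re) (smt (verit) exp_le_cancel_iff)
    then have 2: "norm c * exp (- Re (log_zeta (of_real (1 + d)))) \<le> norm (zeta (1 + z))"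
      using z by (simp only: c(2) plus_complex.sel one_complex.sel norm_mult less_add_same_cancel1) (rule mult_left_mono, auto)
    have "m' \<le> norm (z / (1 + z)) * norm (zeta (1 + z))"
      unfolding m'_def using 1 2 by (intro mult_mono) auto
    then show ?thesis by (simp add: integers.residue_form_def norm_mult norm_divide)
  qed
  then show ?thesis using d m' a by (intro exI[of _ d] conjI exI[of _ "min (a / 2) m'"]) auto
qed

text \<open>
  In \<open>zeta(1 + x) ^ 3 * |zeta(1 + x + i t)| ^ 4 * |zeta(1 + x + 2 i t)|\<close>, which is bounded below, the first
  factor is at most \<open>O(x powr -3)\<close> and the last is slow away from the pole.
\<close>

lemma Z_lower_bound_three_four_one:
  assumes slow: "slow Z" and d: "0 < d" and e: "0 < e"
  shows "\<exists>k>0. \<forall>z. 0 < Re z \<longrightarrow> Re z < 1 \<longrightarrow> d \<le> \<bar>Im z\<bar> \<longrightarrow>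
    k * Re z ^ 3 * (1 + \<bar>Im z\<bar>) powr (- e) \<le> norm (Z z) ^ 4"
proof -
  define c where "c = zeta_factor"
  have c: "c \<noteq> 0" "\<And>s. 1 < Re s \<Longrightarrow> zeta s = c * exp (log_zeta s)"
    by (simp_all only: c_def zeta_factor_nonzero zeta_eq_exp_log_zeta not_False_eq_True)
  obtain A where A: "0 < A" "\<forall>z. 0 < Re z \<longrightarrow> Re z < 1 \<longrightarrow> norm ((deriv ^^ 0) Z z) \<le> A * (1 + \<bar>Im z\<bar>) powr e"
    using slow_bound[OF slow e, of 0] by (elim exE conjE) (rule that)
  have zeta_le: "norm (zeta (1 + w)) \<le> (1 + 1 / norm w) * (A * (1 + \<bar>Im w\<bar>) powr e)"
    if w: "0 < Re w" "Re w < 1" for w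
  proof -
    have nz: "w \<noteq> 0" "1 + w \<noteq> 0" using w by (auto simp: complex_eq_iff)
    have "1 + 1 / w = (1 + w) / w" using nz by (simp add: field_simps)
    then have "zeta (1 + w) = (1 + 1 / w) * Z w"
      using nz by (simp add: integers.residue_form_def)
    moreover have "norm (1 + 1 / w) \<le> 1 + 1 / norm w"
      using norm_triangle_ineq[of 1 "1 / w"] by (simp add: norm_divide)
    moreover have "norm (Z w) \<le> A * (1 + \<bar>Im w\<bar>) powr e" using A w by simp
    ultimately show ?thesis by (simp only: norm_mult) (intro mult_mono, auto)
  qed
  define K where "K = (1 + 1 / d) * (A * 2 powr e)"
  have K: "0 < K" using d A by (simp add: K_def add_pos_pos)
  define k where "k = (d / (1 + d)) ^ 4 * (norm c ^ 8 / ((2 * A) ^ 3 * K))"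
  have k: "0 < k" using d c A K by (simp add: k_def)
  have "k * Re z ^ 3 * (1 + \<bar>Im z\<bar>) powr (- e) \<le> norm (Z z) ^ 4"
    if z: "0 < Re z" "Re z < 1" "d \<le> \<bar>Im z\<bar>" for z
  proof -
    define x where "x = Re z" define t where "t = Im z" define T where "T = 1 + \<bar>t\<bar>"
    have x: "0 < x" "x < 1" and t: "d \<le> \<bar>t\<bar>" and zc: "z = Complex x t"
      using z by (auto simp: x_def t_def)
    have T: "1 \<le> T" by (simp add: T_def)
    have z0: "norm (zeta (of_real (1 + x))) \<le> 2 * A / x"
    proof -
      have "norm (zeta (1 + of_real x)) \<le> (1 + 1 / x) * (A * (1 + 0) powr e)"
        using zeta_le[of "of_real x"] x by simp
      also have "\<dots> = A * (1 + 1 / x)" by simp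
      also have "\<dots> \<le> A * (2 / x)" using A x by (intro mult_left_mono) (auto simp: field_simps)
      finally show ?thesis by (simp add: mult.commute)
    qed
    have z2: "norm (zeta (Complex (1 + x) (2 * t))) \<le> K * T powr e"
    proof -
      have "norm (zeta (1 + Complex x (2 * t))) \<le> (1 + 1 / norm (Complex x (2 * t))) * (A * (1 + \<bar>2 * t\<bar>) powr e)"
        using zeta_le[of "Complex x (2 * t)"] x by simp
      also have "\<dots> \<le> (1 + 1 / d) * (A * (2 * T) powr e)"
      proof (intro mult_mono add_left_mono)
        have "d \<le> norm (Complex x (2 * t))" using abs_Im_le_cmod[of "Complex x (2 * t)"] t by simp
        then show "1 / norm (Complex x (2 * t)) \<le> 1 / d" using d by (intro divide_left_mono mult_pos_pos) auto
        show "(1 + \<bar>2 * t\<bar>) powr e \<le> (2 * T) powr e" using e by (intro powr_mono2) (auto simp: T_def)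
      qed (use A d in auto)
      also have "\<dots> = K * T powr e" using T by (simp add: K_def powr_mult)
      also have "1 + Complex x (2 * t) = Complex (1 + x) (2 * t)" by (simp add: complex_eq_iff)
      finally show ?thesis .
    qed
    have norm_zeta: "norm (zeta s) = norm c * exp (Re (log_zeta s))" if "1 < Re s" for s
      using that by (simp add: c(2) norm_mult)
    have "norm c ^ 8 * 1 \<le> norm c ^ 8 * exp (3 * Re (log_zeta (of_real (1 + x)))
        + 4 * Re (log_zeta (Complex (1 + x) t)) + Re (log_zeta (Complex (1 + x) (2 * t))))"
      using three_four_one[of "1 + x" t] x by (intro mult_left_mono) auto
    also have "\<dots> = norm (zeta (of_real (1 + x))) ^ 3 * norm (zeta (Complex (1 + x) t)) ^ 4
        * norm (zeta (Complex (1 + x) (2 * t)))"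
    proof -
      have nat: "exp (3 * u) = exp u ^ 3" "exp (4 * u) = exp u ^ 4" for u :: real
        using exp_of_nat_mult[of 3 u] exp_of_nat_mult[of 4 u] by simp_all
      have "1 < Re (of_real (1 + x))" "1 < Re (Complex (1 + x) t)" "1 < Re (Complex (1 + x) (2 * t))"
        using x by simp_all
      then show ?thesis
        by (simp only: norm_zeta exp_add nat power_mult_distrib) (simp add: eval_nat_numeral)
    qed
    also have "\<dots> \<le> (2 * A / x) ^ 3 * norm (zeta (Complex (1 + x) t)) ^ 4 * (K * T powr e)"
      using z0 z2 A x by (intro mult_mono power_mono mult_nonneg_nonneg zero_le_power) auto
    finally have zeta4: "norm c ^ 8 \<le> (2 * A / x) ^ 3 * (K * T powr e) * norm (zeta (Complex (1 + x) t)) ^ 4"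
      by (simp add: mult_ac)
    have Tp: "0 < T powr e" using T by simp
    have "norm c ^ 8 / ((2 * A) ^ 3 * K) * x ^ 3 * T powr (- e)
        = norm c ^ 8 / ((2 * A / x) ^ 3 * (K * T powr e))"
    proof -
      have "u / (v * w) * y * inverse r = u / (v / y * (w * r))" if "y \<noteq> 0" for u v w y r :: real
        using that by (simp add: divide_inverse mult_ac)
      from this[of "x ^ 3"] x show ?thesis by (simp only: power_divide powr_minus) simp
    qed
    also have "\<dots> \<le> norm (zeta (Complex (1 + x) t)) ^ 4"
      using zeta4 A x K Tp by (subst pos_divide_le_eq) (auto simp: mult.commute)
    finally have "norm c ^ 8 / ((2 * A) ^ 3 * K) * x ^ 3 * T powr (- e) \<le> norm (zeta (Complex (1 + x) t)) ^ 4" .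
    then have 1: "norm c ^ 8 / ((2 * A) ^ 3 * K) * x ^ 3 * T powr (- e) \<le> norm (zeta (1 + z)) ^ 4"
    proof -
      have "Complex (1 + x) t = 1 + z" by (simp add: zc complex_eq_iff)
      then show ?thesis using \<open>norm c ^ 8 / ((2 * A) ^ 3 * K) * x ^ 3 * T powr (- e) \<le> norm (zeta (Complex (1 + x) t)) ^ 4\<close>
        by (simp only:)
    qed
    have "d / (1 + d) \<le> norm z / (1 + norm z)"
      using t abs_Im_le_cmod[of z] d by (simp add: t_def field_simps)
    also have "\<dots> \<le> norm (z / (1 + z))" using z by (intro norm_ratio_bounds)
    finally have 2: "(d / (1 + d)) ^ 4 \<le> norm (z / (1 + z)) ^ 4" using d by (intro power_mono) auto
    have "k * x ^ 3 * T powr (- e) = (d / (1 + d)) ^ 4 * (norm c ^ 8 / ((2 * A) ^ 3 * K) * x ^ 3 * T powr (- e))"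
      by (simp add: k_def)
    also have "\<dots> \<le> norm (z / (1 + z)) ^ 4 * norm (zeta (1 + z)) ^ 4"
      using 1 2 A K x by (intro mult_mono) auto
    also have "\<dots> = norm (Z z) ^ 4"
      by (simp only: integers.residue_form_def norm_mult power_mult_distrib)
    finally show ?thesis by (simp add: x_def T_def t_def)
  qed
  then show ?thesis using k by blast
qed

text \<open>
  The exponents balance as follows. With \<open>T = 1 + |Im z|\<close> and \<open>x1 = h ^ 4 * T powr (-8 * e)\<close>, the 3-4-1
  bound gives \<open>|Z|\<close> of order at least \<open>h ^ 3 * T powr (-7 * e)\<close> at abscissae from \<open>x1\<close> on. Between \<open>x1\<close> and
  the boundary \<open>Z\<close> changes by at most \<open>x1\<close> times \<open>A * T powr e\<close>, which is \<open>A * h ^ 4 * T powr (-7 * e)\<close>. For a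
  small constant \<open>h\<close> the change is at most half of the bound.
\<close>

lemma slow_upto_0_inverse_Z:
  assumes slow: "slow Z" and a: "0 < a"
    and lim: "\<And>z. 0 < Re z \<Longrightarrow> norm z < 1 \<Longrightarrow> norm (Z z - of_real a) \<le> C * norm z"
  shows "slow_upto 0 (\<lambda>z. inverse (Z z))"
proof (rule slow_upto_0I)
  show "(\<lambda>z. inverse (Z z)) holomorphic_on right_half_plane"
    using Z_holomorphic Z_nonzero by (intro holomorphic_on_inverse) auto
  fix e' :: real assume e': "0 < e'"
  define e where "e = e' / 7"
  have e: "0 < e" using e' by (simp add: e_def)
  obtain d m where d: "0 < d" and m: "0 < m"
    and near: "\<forall>z. 0 < Re z \<longrightarrow> \<bar>Im z\<bar> \<le> d \<longrightarrow> Re z < 1 \<longrightarrow> m \<le> norm (Z z)"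
  proof -
    have "\<exists>d>0. \<exists>m>0. \<forall>z. 0 < Re z \<longrightarrow> \<bar>Im z\<bar> \<le> d \<longrightarrow> Re z < 1 \<longrightarrow> m \<le> norm (Z z)"
      by (rule Z_lower_bound_near_real_axis[OF lim a])
    then show thesis by (elim exE conjE) (rule that)
  qed
  obtain k where k: "0 < k" and far: "\<forall>z. 0 < Re z \<longrightarrow> Re z < 1 \<longrightarrow> d \<le> \<bar>Im z\<bar> \<longrightarrow>
      k * Re z ^ 3 * (1 + \<bar>Im z\<bar>) powr (- e) \<le> norm (Z z) ^ 4"
    using Z_lower_bound_three_four_one[OF slow d e] by (elim exE conjE) (rule that)
  obtain A where A: "0 < A" "\<forall>z. 0 < Re z \<longrightarrow> Re z < 1 \<longrightarrow> norm ((deriv ^^ 1) Z z) \<le> A * (1 + \<bar>Im z\<bar>) powr e"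
    using slow_bound[OF slow e, of 1] by (elim exE conjE) (rule that)
  define r where "r = root 4 k"
  have r: "0 < r" "r ^ 4 = k" using k by (simp_all add: r_def)
  \<comment> \<open>At abscissa \<open>h ^ 4 * T powr (- 8 * e)\<close> the lower bound beats the variation of the function to the left of it.\<close>
  define h where "h = min (1 / 2) (r / (2 * A))"
  have h: "0 < h" "h < 1" "h \<le> r / (2 * A)" using r A by (auto simp: h_def)
  define q where "q = r * h ^ 3 / 2"
  have q: "0 < q" using r h by (simp add: q_def)
  have far': "q * (1 + \<bar>Im z\<bar>) powr (- e') \<le> norm (Z z)" if z: "0 < Re z" "Re z < 1" "d \<le> \<bar>Im z\<bar>" for z
  proof -
    define x where "x = Re z" define t where "t = Im z" define T where "T = 1 + \<bar>t\<bar>"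
    have x: "0 < x" "x < 1" and t: "d \<le> \<bar>t\<bar>" and zc: "z = Complex x t"
      using z by (auto simp: x_def t_def)
    have T: "1 \<le> T" by (simp add: T_def)
    define x1 where "x1 = h ^ 4 * T powr (- 8 * e)"
    have x1: "0 < x1" using h T by (simp add: x1_def)
    have "x1 \<le> h ^ 4 * 1"
      unfolding x1_def using h T e powr_mono[of "- 8 * e" 0 T] by (intro mult_left_mono) auto
    also have "\<dots> < 1" using h by (simp add: power_less_one_iff)
    finally have x1': "x1 < 1" .
    \<comment> \<open>A point further than \<open>x1\<close> from the boundary stays where it is; any other is moved to abscissa \<open>x1\<close>.\<close>
    define y where "y = max x x1"
    have y: "0 < y" "y < 1" "x1 \<le> y" "x \<le> y" "y - x \<le> x1" using x x1 x1' by (auto simp: y_def)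
    have "2 * q * T powr (- e') \<le> norm (Z (Complex y t))"
    proof (rule power_le_imp_le_base)
      have "(2 * q * T powr (- e')) ^ Suc 3 = k * h ^ 12 * (T powr (- e')) ^ 4"
        using r by (simp add: q_def power_mult_distrib eval_nat_numeral)
      also have "(T powr (- e')) ^ 4 = T powr (- 28 * e)"
      proof -
        have "(T powr (- e')) ^ 4 = (T powr (- e')) powr real 4"
          using T by (subst powr_realpow) auto
        also have "\<dots> = T powr (- e' * real 4)" by (rule powr_powr)
        also have "- e' * real 4 = - 28 * e" by (simp add: e_def)
        finally show ?thesis .
      qed
      also have "k * h ^ 12 * T powr (- 28 * e) \<le> k * h ^ 12 * T powr (- 25 * e)"
        using k h T e by (intro mult_left_mono powr_mono) auto
      also have "\<dots> = k * x1 ^ 3 * T powr (- e)"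
      proof -
        have "x1 ^ 3 = h ^ 12 * T powr (- 24 * e)"
        proof -
          have "(T powr (- 8 * e)) ^ 3 = (T powr (- 8 * e)) powr real 3"
            using T by (subst powr_realpow) auto
          also have "\<dots> = T powr (- 8 * e * real 3)" by (rule powr_powr)
          also have "- 8 * e * real 3 = - 24 * e" by simp
          finally have "(T powr (- 8 * e)) ^ 3 = T powr (- 24 * e)" .
          moreover have "(h ^ 4) ^ 3 = h ^ 12" by (simp flip: power_mult)
          ultimately show ?thesis by (simp only: x1_def power_mult_distrib)
        qed
        moreover have "T powr (- 24 * e) * T powr (- e) = T powr (- 25 * e)"
          by (simp add: powr_add[symmetric])
        ultimately show ?thesis by (simp add: mult.assoc)
      qed
      also have "\<dots> \<le> k * y ^ 3 * T powr (- e)"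
        using k x1 y by (intro mult_right_mono mult_left_mono power_mono) auto
      also have "\<dots> \<le> norm (Z (Complex y t)) ^ 4"
        using far[rule_format, of "Complex y t"] y t by (simp add: T_def)
      finally show "(2 * q * T powr (- e')) ^ Suc 3 \<le> norm (Z (Complex y t)) ^ Suc 3" by simp
    qed simp
    moreover have "norm (Z (Complex x t) - Z (Complex y t)) \<le> q * T powr (- e')"
    proof -
      have "norm (Z (Complex x t) - Z (Complex y t)) \<le> A * T powr e * (y - x)"
      proof (rule norm_diff_horizontal_le[where g' = "deriv Z"])
        fix u assume u: "x \<le> u" "u \<le> y"
        show "(Z has_field_derivative deriv Z (Complex u t)) (at (Complex u t))"
          by (rule holomorphic_derivI[OF Z_holomorphic open_right_half_plane]) (use u x in simp)
        show "norm (deriv Z (Complex u t)) \<le> A * T powr e"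
          using A(2)[rule_format, of "Complex u t"] u x y by (simp add: T_def)
      qed (use y in simp)
      also have "\<dots> \<le> A * T powr e * x1" using A y by (intro mult_left_mono) auto
      also have "\<dots> = (A * h) * h ^ 3 * (T powr e * T powr (- 8 * e))"
        by (simp add: x1_def eval_nat_numeral)
      also have "T powr e * T powr (- 8 * e) = T powr (- e')"
        by (simp add: powr_add[symmetric] e_def)
      also have "A * h \<le> r / 2" using h A by (simp add: field_simps)
      then have "(A * h) * h ^ 3 * T powr (- e') \<le> r / 2 * h ^ 3 * T powr (- e')"
        using h by (intro mult_right_mono) auto
      finally show ?thesis by (simp add: q_def)
    qed
    moreover have "norm (Z (Complex y t)) \<le> norm (Z (Complex x t)) + norm (Z (Complex x t) - Z (Complex y t))"
      using norm_triangle_ineq4[of "Z (Complex x t)" "Z (Complex x t) - Z (Complex y t)"] by simp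
    ultimately have "q * T powr (- e') \<le> norm (Z (Complex x t))" by linarith
    then show ?thesis by (simp add: zc T_def)
  qed
  have "norm (inverse (Z z)) \<le> (1 / min m q) * (1 + \<bar>Im z\<bar>) powr e'" if z: "0 < Re z" "Re z < 1" for z
  proof -
    have T1: "(1 + \<bar>Im z\<bar>) powr (- e') \<le> 1" using powr_mono[of "- e'" 0 "1 + \<bar>Im z\<bar>"] e' by (auto split: if_splits)
    have "min m q * (1 + \<bar>Im z\<bar>) powr (- e') \<le> norm (Z z)"
    proof (cases "d \<le> \<bar>Im z\<bar>")
      case True
      have "min m q * (1 + \<bar>Im z\<bar>) powr (- e') \<le> q * (1 + \<bar>Im z\<bar>) powr (- e')" by (intro mult_right_mono) auto
      then show ?thesis using far'[OF z True] by linarith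
    next
      case False
      have "min m q * (1 + \<bar>Im z\<bar>) powr (- e') \<le> m * 1" using T1 m q by (intro mult_mono) auto
      then show ?thesis using near[rule_format, of z] False z by simp
    qed
    moreover have "0 < min m q * (1 + \<bar>Im z\<bar>) powr (- e')" using m q by simp
    ultimately have "inverse (norm (Z z)) \<le> inverse (min m q * (1 + \<bar>Im z\<bar>) powr (- e'))"
      by (rule le_imp_inverse_le)
    also have "\<dots> = (1 / min m q) * (1 + \<bar>Im z\<bar>) powr e'" by (simp add: powr_minus divide_inverse)
    finally show ?thesis by (simp add: norm_inverse)
  qed
  then show "\<exists>C. \<forall>z. 0 < Re z \<longrightarrow> Re z < 1 \<longrightarrow> norm (inverse (Z z)) \<le> C * (1 + \<bar>Im z\<bar>) powr e'" by blast
qed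

text \<open>
  With \<open>W = Z' / Z\<close> and the series \<open>R\<close> of the proper prime powers, \<open>1 - V\<close> is \<open>z / (1 + z)\<close> times the slow
  function \<open>1 + 1 / (1 + z) + W + R\<close>, which also shows the rate at which \<open>V\<close> tends to \<open>1\<close>.
\<close>

lemma V_slow_of_Z_slow:
  assumes slow: "slow Z" and a: "0 < a"
    and lim: "\<And>z. 0 < Re z \<Longrightarrow> norm z < 1 \<Longrightarrow> norm (Z z - of_real a) \<le> C * norm z"
  shows "slow V" and "\<exists>C. \<forall>z. 0 < Re z \<longrightarrow> norm z < 1 \<longrightarrow> norm (V z - of_real 1) \<le> C * norm z"
proof -
  have inv: "slow (\<lambda>z. inverse (Z z))"
    by (rule slow_inverse[OF slow slow_upto_0_inverse_Z[OF slow a lim] Z_nonzero])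
  have "slow (\<lambda>z. deriv Z z * inverse (Z z))" by (intro slow_mult slow_deriv slow inv)
  then have W: "slow Z_log_deriv"
    by (rule slow_cong) (use DERIV_imp_deriv[OF Z_has_derivative] Z_nonzero in auto)
  define Q where "Q = (\<lambda>z. 1 + 1 / (1 + z) + Z_log_deriv z + R z)"
  have Q: "slow Q" unfolding Q_def
    by (intro slow_add slow_const slow_inverse_shift W slow_higher_powers)
  have V: "V z = 1 - z / (1 + z) * Q z" if z: "0 < Re z" for z
  proof -
    have nz: "z \<noteq> 0" "1 + z \<noteq> 0" using z by (auto simp: complex_eq_iff)
    have "z / (1 + z) * (1 / z) = 1 - z / (1 + z)" using nz by (simp add: field_simps)
    then show ?thesis unfolding V_eq[OF z] Q_def by (simp add: algebra_simps)
  qed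
  have "slow (\<lambda>z. 1 - (1 - 1 / (1 + z)) * Q z)"
    by (intro slow_diff slow_const slow_mult slow_inverse_shift Q)
  then show "slow V"
  proof (rule slow_cong)
    fix z :: complex assume z: "0 < Re z"
    have "1 + z \<noteq> 0" using z by (auto simp: complex_eq_iff)
    then have "1 - 1 / (1 + z) = z / (1 + z)" by (simp add: field_simps)
    then show "1 - (1 - 1 / (1 + z)) * Q z = V z" by (simp only: V[OF z])
  qed
  obtain A where A: "0 < A" "\<forall>z. 0 < Re z \<longrightarrow> Re z < 1 \<longrightarrow> norm ((deriv ^^ 0) Q z) \<le> A * (1 + \<bar>Im z\<bar>) powr 1"
    using slow_bound[OF Q zero_less_one, of 0] by (elim exE conjE) (rule that)
  show "\<exists>C. \<forall>z. 0 < Re z \<longrightarrow> norm z < 1 \<longrightarrow> norm (V z - of_real 1) \<le> C * norm z"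
  proof (intro exI[of _ "2 * A"] allI impI)
    fix z :: complex assume z: "0 < Re z" "norm z < 1"
    have z': "Re z < 1" "\<bar>Im z\<bar> < 1" using abs_Re_le_cmod[of z] abs_Im_le_cmod[of z] z by auto
    have "norm (Q z) \<le> A * (1 + \<bar>Im z\<bar>)" using A(2)[rule_format, of z] z z' by simp
    also have "\<dots> \<le> A * 2" using A z' by (intro mult_left_mono) auto
    finally have "norm (z / (1 + z)) * norm (Q z) \<le> norm z * (A * 2)"
      using norm_ratio_bounds(3)[OF z(1)] by (intro mult_mono) auto
    moreover have "norm (V z - of_real 1) = norm (z / (1 + z)) * norm (Q z)"
      unfolding V[OF z(1)] by (simp add: norm_mult norm_divide)
    ultimately show "norm (V z - of_real 1) \<le> 2 * A * norm z" by (simp add: mult_ac)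
  qed
qed

text \<open>
  The logarithm \<open>Z_log\<close> of \<open>Z\<close> has the slow derivative \<open>W\<close>. On the real axis this makes it bounded, so
  that \<open>log_zeta (1 + x) \<le> M + log (2 / x)\<close>; nonnegative coefficients carry the estimate to all points with
  real part \<open>x\<close>. It is used at \<open>x0 = T powr -b / 2\<close>, where the logarithm of \<open>1 / x0\<close> is \<open>O(log T)\<close>, and from
  there to the boundary \<open>W\<close>, of size \<open>T powr b\<close>, contributes a bounded amount. The limit at \<open>0\<close> is real
  and positive because \<open>Z\<close> is real and bounded below on the positive axis.
\<close>

lemma Z_slow_of_V_slow:
  assumes slow: "slow V"
    and lim: "\<And>z. 0 < Re z \<Longrightarrow> norm z < 1 \<Longrightarrow> norm (V z - of_real 1) \<le> C * norm z"
  shows "slow Z" and "\<exists>a>0. \<exists>C. \<forall>z. 0 < Re z \<longrightarrow> norm z < 1 \<longrightarrow> norm (Z z - of_real a) \<le> C * norm z"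
proof -
  have quot: "slow (\<lambda>z. (1 - V z) / z)"
  proof (rule slow_of_bounded_derivs)
    show "(\<lambda>z. (1 - V z) / z) holomorphic_on right_half_plane"
      using slow_holomorphic[OF slow] by (intro holomorphic_intros) auto
    show "\<exists>B. \<forall>z. 0 < Re z \<longrightarrow> Re z < 1 \<longrightarrow> norm ((deriv ^^ k) (\<lambda>z. (1 - V z) / z) z) \<le> B" for k
    proof (rule bounded_higher_deriv_quotient)
      show "slow (\<lambda>z. 1 - V z)" by (intro slow_diff slow_const slow)
      show "norm (1 - V z) \<le> C * norm z" if "0 < Re z" "norm z < 1" for z
        using lim[OF that] by (simp add: norm_minus_commute)
    qed
  qed
  have "slow (\<lambda>z. (1 - V z) / z - V z - 1 / (1 + z) - R z)"
    by (intro slow_diff quot slow slow_inverse_shift slow_higher_powers)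
  then have W: "slow Z_log_deriv"
    by (rule slow_cong) (simp only: Z_log_deriv_eq)
  define c where "c = zeta_factor"
  have c: "c \<noteq> 0" "\<And>z. 0 < Re z \<Longrightarrow> Z z = c * exp (Z_log z)"
    by (simp_all only: c_def zeta_factor_nonzero Z_eq_exp_Z_log not_False_eq_True)
  have growth: "\<exists>K. 0 < K \<and> (\<forall>z. 0 < Re z \<longrightarrow> Re z < 1 \<longrightarrow> \<bar>Re (Z_log z)\<bar> \<le> ln (K * (1 + \<bar>Im z\<bar>) powr e))"
    if e: "0 < e" for e
  proof -
    define b where "b = e / 2"
    have b: "0 < b" using e by (simp add: b_def)
    obtain A where A: "0 < A" "\<forall>z. 0 < Re z \<longrightarrow> Re z < 1 \<longrightarrow> norm ((deriv ^^ 0) Z_log_deriv z) \<le> A * (1 + \<bar>Im z\<bar>) powr b"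
      using slow_bound[OF W b, of 0] by (elim exE conjE) (rule that)
    have move: "norm (Z_log (Complex x1 t) - Z_log (Complex x2 t)) \<le> A * (1 + \<bar>t\<bar>) powr b * (x2 - x1)"
      if "0 < x1" "x1 \<le> x2" "x2 < 1" for x1 x2 t
    proof (rule norm_diff_horizontal_le[where g' = Z_log_deriv])
      fix u assume u: "x1 \<le> u" "u \<le> x2"
      show "(Z_log has_field_derivative Z_log_deriv (Complex u t)) (at (Complex u t))"
        using u that by (intro Z_log_has_derivative) simp
      show "norm (Z_log_deriv (Complex u t)) \<le> A * (1 + \<bar>t\<bar>) powr b"
        using A(2)[rule_format, of "Complex u t"] u that by simp
    qed (use that in simp)
    define M where "M = norm (Z_log (Complex (1/2) 0)) + A"
    have real_axis: "norm (Z_log (Complex x 0)) \<le> M" if x: "0 < x" "x < 1" for x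
    proof -
      have "norm (Z_log (Complex x 0) - Z_log (Complex (1/2) 0)) \<le> A"
      proof (cases "x \<le> 1/2")
        case True
        have "norm (Z_log (Complex x 0) - Z_log (Complex (1/2) 0)) \<le> A * (1 + \<bar>0\<bar>) powr b * (1/2 - x)"
          using x True by (intro move) auto
        also have "\<dots> \<le> A * 1" using x A by (auto intro!: mult_left_mono)
        finally show ?thesis by simp
      next
        case False
        have "norm (Z_log (Complex (1/2) 0) - Z_log (Complex x 0)) \<le> A * (1 + \<bar>0\<bar>) powr b * (x - 1/2)"
          using x False by (intro move) auto
        also have "\<dots> \<le> A * 1" using x A by (auto intro!: mult_left_mono)
        finally show ?thesis by (simp add: norm_minus_commute)
      qed
      then show ?thesis unfolding M_def using norm_triangle_sub[of "Z_log (Complex x 0)" "Z_log (Complex (1/2) 0)"] by linarith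
    qed
    have ratio: "\<bar>ln (norm (z / (1 + z)))\<bar> \<le> ln (2 / Re z)" if z: "0 < Re z" "Re z < 1" for z
    proof -
      have "Re z / 2 \<le> Re z / (1 + Re z)" using z by (intro divide_left_mono) auto
      also have "\<dots> \<le> norm z / (1 + norm z)"
        using z complex_Re_le_cmod[of z] by (simp add: field_simps)
      also have "\<dots> \<le> norm (z / (1 + z))" using z by (intro norm_ratio_bounds)
      finally have 1: "Re z / 2 \<le> norm (z / (1 + z))" .
      have 2: "norm (z / (1 + z)) \<le> 1" using z by (intro norm_ratio_bounds)
      have pos: "0 < norm (z / (1 + z))" using 1 z by linarith
      have "ln (Re z / 2) \<le> ln (norm (z / (1 + z)))" using 1 z pos by (subst ln_le_cancel_iff) auto
      moreover have "ln (Re z / 2) = - ln (2 / Re z)" using z by (simp add: ln_div)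
      moreover have "ln (norm (z / (1 + z))) \<le> 0" using 2 pos by simp
      ultimately show ?thesis by linarith
    qed
    have Re_Z_log: "Re (Z_log z) = Re (log_zeta (1 + z)) + ln (norm (z / (1 + z)))" if z: "0 < Re z" for z
    proof -
      have nz: "z \<noteq> 0" "1 + z \<noteq> 0" using z by (auto simp: complex_eq_iff)
      then show ?thesis by (simp add: Z_log_def Re_Ln norm_divide ln_div)
    qed
    have at_x: "\<bar>Re (Z_log (Complex x t))\<bar> \<le> M + 2 * ln (2 / x)" if x: "0 < x" "x < 1" for x t
    proof -
      have Cx: "Complex x 0 = of_real x" by (simp add: complex_eq_iff)
      have "\<bar>Re (log_zeta (1 + Complex x t))\<bar> \<le> Re (log_zeta (of_real (Re (1 + Complex x t))))"
        using x by (intro order_trans[OF abs_Re_le_cmod log_powers.norm_dirichlet_le] log_powers_summable) simp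
      also have "\<dots> = Re (Z_log (Complex x 0)) - ln (norm (Complex x 0 / (1 + Complex x 0)))"
        using Re_Z_log[of "Complex x 0"] x by (simp add: Cx)
      also have "\<dots> \<le> M + ln (2 / x)"
        using real_axis[OF x] ratio[of "Complex x 0"] x abs_Re_le_cmod[of "Z_log (Complex x 0)"] by simp
      finally show ?thesis
        using Re_Z_log[of "Complex x t"] ratio[of "Complex x t"] x by simp
    qed
    define K where "K = exp (A / 2 + M) * 16"
    have "\<bar>Re (Z_log z)\<bar> \<le> ln (K * (1 + \<bar>Im z\<bar>) powr e)" if z: "0 < Re z" "Re z < 1" for z
    proof -
      define x where "x = Re z" define t where "t = Im z" define T where "T = 1 + \<bar>t\<bar>"
      have x: "0 < x" "x < 1" and zc: "z = Complex x t" using z by (auto simp: x_def t_def)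
      have T: "1 \<le> T" by (simp add: T_def)
      define x0 where "x0 = T powr (- b) / 2"
      have Tb: "T powr (- b) \<le> 1" using powr_mono[of "- b" 0 T] b T by simp
      have x0: "0 < x0" "x0 < 1" using T Tb by (auto simp: x0_def)
      define y where "y = max x x0"
      have y: "0 < y" "y < 1" "x \<le> y" "x0 \<le> y" "y - x \<le> x0" using x x0 by (auto simp: y_def)
      have "norm (Z_log (Complex x t) - Z_log (Complex y t)) \<le> A * T powr b * (y - x)"
        unfolding T_def using x y by (intro move) auto
      also have "\<dots> \<le> A * T powr b * x0" using A y by (intro mult_left_mono) auto
      also have "\<dots> = A / 2" using T by (simp add: x0_def powr_minus)
      finally have 1: "\<bar>Re (Z_log (Complex x t)) - Re (Z_log (Complex y t))\<bar> \<le> A / 2"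
        using abs_Re_le_cmod[of "Z_log (Complex x t) - Z_log (Complex y t)"] by simp
      have "ln (2 / y) \<le> ln (2 / x0)" using x0 y by (intro ln_mono divide_left_mono) auto
      also have "2 / x0 = 4 * T powr b" using T by (simp add: x0_def powr_minus field_simps)
      finally have 2: "ln (2 / y) \<le> ln (4 * T powr b)" .
      have "\<bar>Re (Z_log (Complex x t))\<bar> \<le> A / 2 + (M + 2 * ln (4 * T powr b))"
        using 1 2 at_x[OF y(1,2), of t] by linarith
      also have "\<dots> = ln (K * T powr e)"
      proof -
        have "2 * ln (4 * T powr b) = ln ((4 * T powr b) ^ 2)" by (subst ln_realpow) (use T in auto)
        also have "(4 * T powr b) ^ 2 = 16 * T powr e"
          using T by (simp add: power2_eq_square powr_add[symmetric] b_def)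
        finally show ?thesis using T by (simp add: K_def ln_mult)
      qed
      finally show ?thesis by (simp add: zc T_def)
    qed
    then show ?thesis by (intro exI[of _ K]) (auto simp: K_def)
  qed
  have bounds: "\<exists>K. 0 < K \<and> (\<forall>z. 0 < Re z \<longrightarrow> Re z < 1 \<longrightarrow> norm (Z z) \<le> K * (1 + \<bar>Im z\<bar>) powr e
      \<and> 1 \<le> norm (Z z) * (K * (1 + \<bar>Im z\<bar>) powr e))" if e: "0 < e" for e
  proof -
    obtain K where K: "0 < K" "\<forall>z. 0 < Re z \<longrightarrow> Re z < 1 \<longrightarrow> \<bar>Re (Z_log z)\<bar> \<le> ln (K * (1 + \<bar>Im z\<bar>) powr e)"
      using growth[OF e] by blast
    define K' where "K' = max (norm c) (1 / norm c) * K"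
    have "norm (Z z) \<le> K' * (1 + \<bar>Im z\<bar>) powr e \<and> 1 \<le> norm (Z z) * (K' * (1 + \<bar>Im z\<bar>) powr e)"
      if z: "0 < Re z" "Re z < 1" for z
    proof -
      define P where "P = K * (1 + \<bar>Im z\<bar>) powr e"
      have P: "0 < P" using K by (simp add: P_def add_pos_nonneg)
      have abs: "\<bar>Re (Z_log z)\<bar> \<le> ln P" using K z by (simp add: P_def)
      have nZ: "norm (Z z) = norm c * exp (Re (Z_log z))" using c(2)[OF z(1)] by (simp add: norm_mult)
      have "exp (Re (Z_log z)) \<le> exp (ln P)" "exp (- ln P) \<le> exp (Re (Z_log z))" using abs by auto
      then have E: "exp (Re (Z_log z)) \<le> P" "1 / P \<le> exp (Re (Z_log z))"
        using P by (auto simp: exp_minus inverse_eq_divide)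
      have c0: "0 < norm c" using c by simp
      have "norm (Z z) \<le> max (norm c) (1 / norm c) * P"
        unfolding nZ using E c0 P by (intro mult_mono) (auto simp: le_max_iff_disj)
      moreover have "1 \<le> norm (Z z) * (max (norm c) (1 / norm c) * P)"
      proof -
        have "1 = (norm c * (1 / P)) * (1 / norm c * P)" using c0 P by simp
        also have "\<dots> \<le> (norm c * exp (Re (Z_log z))) * (max (norm c) (1 / norm c) * P)"
          using E c0 P by (intro mult_mono mult_nonneg_nonneg) (auto simp: le_max_iff_disj)
        finally show ?thesis by (simp only: nZ)
      qed
      ultimately show ?thesis by (simp add: K'_def P_def mult_ac)
    qed
    moreover have "0 < K'" using K c by (auto simp: K'_def less_max_iff_disj)
    ultimately show ?thesis by blast
  qed
  have "slow_upto 0 Z"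
  proof (rule slow_upto_0I[OF Z_holomorphic])
    show "\<exists>C. \<forall>z. 0 < Re z \<longrightarrow> Re z < 1 \<longrightarrow> norm (Z z) \<le> C * (1 + \<bar>Im z\<bar>) powr e" if "0 < e" for e
      using bounds[OF that] by blast
  qed
  then show slowZ: "slow Z"
    using DERIV_imp_deriv[OF Z_has_derivative] by (intro slow_linear_ode[OF W])
  obtain a C where a: "\<forall>z. 0 < Re z \<longrightarrow> norm z < 1 \<longrightarrow> norm (Z z - a) \<le> C * norm z"
    using slow_boundary_limit[OF slowZ] by blast
  obtain K where K: "0 < K" "\<forall>z. 0 < Re z \<longrightarrow> Re z < 1 \<longrightarrow> norm (Z z) \<le> K * (1 + \<bar>Im z\<bar>) powr 1
      \<and> 1 \<le> norm (Z z) * (K * (1 + \<bar>Im z\<bar>) powr 1)"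
    using bounds[OF zero_less_one] by blast
  define x where "x = (\<lambda>n. inverse (real (Suc (Suc n))))"
  have x: "0 < x n" "x n < 1" for n by (auto simp: x_def field_simps)
  have x_lim: "x \<longlonglongrightarrow> 0" unfolding x_def by (rule LIMSEQ_Suc[OF LIMSEQ_inverse_real_of_nat])
  have Z_lim: "(\<lambda>n. Z (of_real (x n))) \<longlonglongrightarrow> a"
  proof (rule LIMSEQ_I)
    fix r :: real assume r: "0 < r"
    have "(\<lambda>n. C * x n) \<longlonglongrightarrow> C * 0" by (intro tendsto_intros x_lim)
    then have "\<forall>\<^sub>F n in sequentially. C * x n < r" using r by (intro order_tendstoD) auto
    then obtain N where N: "\<And>n. n \<ge> N \<Longrightarrow> C * x n < r" by (auto simp: eventually_sequentially)
    have "norm (Z (of_real (x n)) - a) < r" if "n \<ge> N" for n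
    proof -
      have "norm (Z (of_real (x n)) - a) \<le> C * norm (complex_of_real (x n))"
        using a[rule_format, of "complex_of_real (x n)"] x[of n] by simp
      also have "norm (complex_of_real (x n)) = x n" using x[of n] by simp
      also have "C * x n < r" using N that by simp
      finally show ?thesis .
    qed
    then show "\<exists>no. \<forall>n\<ge>no. norm (Z (of_real (x n)) - a) < r" by blast
  qed
  have Z_real: "Z (of_real y) = of_real (Re (Z (of_real y))) \<and> 1 / K \<le> Re (Z (of_real y))" if y: "0 < y" "y < 1" for y
  proof -
    define \<zeta> where "\<zeta> = Re (zeta (of_real (1 + y)))"
    have z: "zeta (1 + of_real y) = of_real \<zeta>"
      using integers.Re_dirichlet_of_real[of "1 + y"] by (simp add: \<zeta>_def)
    have "0 \<le> \<zeta>" unfolding \<zeta>_def by (rule integers.Re_dirichlet_nonneg)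
    have eq: "Z (of_real y) = of_real (y / (1 + y) * \<zeta>)"
      unfolding integers.residue_form_def z by simp
    have "1 \<le> norm (Z (of_real y)) * K" using K(2)[rule_format, of "of_real y"] y by simp
    also have "norm (Z (of_real y)) = y / (1 + y) * \<zeta>"
      unfolding eq norm_of_real using y \<open>0 \<le> \<zeta>\<close> by (simp add: abs_mult)
    finally have "1 / K \<le> y / (1 + y) * \<zeta>" using K(1) by (simp add: field_simps)
    then show ?thesis by (simp add: eq)
  qed
  have "1 / K \<le> Re a"
  proof (rule tendsto_lowerbound)
    show "(\<lambda>n. Re (Z (of_real (x n)))) \<longlonglongrightarrow> Re a" by (intro tendsto_intros Z_lim)
    show "\<forall>\<^sub>F n in sequentially. 1 / K \<le> Re (Z (of_real (x n)))" using Z_real x by simp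
  qed simp
  then have pos: "0 < Re a" using K(1) by (smt (verit) divide_pos_pos)
  have "a = of_real (Re a)"
  proof (rule LIMSEQ_unique[OF Z_lim])
    have "(\<lambda>n. complex_of_real (Re (Z (of_real (x n))))) \<longlonglongrightarrow> of_real (Re a)" by (intro tendsto_intros Z_lim)
    then show "(\<lambda>n. Z (of_real (x n))) \<longlonglongrightarrow> of_real (Re a)" using Z_real x by simp
  qed
  then show "\<exists>a>0. \<exists>C. \<forall>z. 0 < Re z \<longrightarrow> norm z < 1 \<longrightarrow> norm (Z z - of_real a) \<le> C * norm z"
    using a pos by metis
qed

end

section \<open>From the prime count to a weighted prime count\<close>

lemma ln_power_over_self_tendsto_0: "((\<lambda>x::real. ln x ^ n / x) \<longlongrightarrow> 0) at_top"
proof -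
  have "((\<lambda>x::real. ln x ^ n / exp (ln x)) \<longlongrightarrow> 0) at_top"
    by (rule filterlim_compose[OF tendsto_power_div_exp_0 ln_at_top])
  moreover have "\<forall>\<^sub>F x::real in at_top. ln x ^ n / exp (ln x) = ln x ^ n / x"
    using eventually_gt_at_top[of 0] by eventually_elim simp
  ultimately show ?thesis by (rule Lim_transform_eventually)
qed

lemma const_bigo_self_over_ln_power: "(\<lambda>x::real. c) \<in> O[at_top](\<lambda>x::real. x / ln x ^ n)"
proof (rule bigoI)
  have "\<forall>\<^sub>F x::real in at_top. ln x ^ n / x < 1"
    by (rule order_tendstoD[OF ln_power_over_self_tendsto_0]) simp
  then show "\<forall>\<^sub>F x::real in at_top. norm c \<le> \<bar>c\<bar> * norm (x / ln x ^ n)"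
    using eventually_gt_at_top[of 1]
  proof eventually_elim
    case (elim x)
    then have "ln x ^ n < x" "0 < ln x ^ n" by (simp_all add: field_simps)
    then have "1 \<le> norm (x / ln x ^ n)" using elim by simp
    then have "\<bar>c\<bar> * 1 \<le> \<bar>c\<bar> * norm (x / ln x ^ n)" by (intro mult_left_mono) auto
    then show ?case by simp
  qed
qed

text \<open>
  The substitution \<open>x = exp u\<close>. The \<open>O\<close>-estimates concern large \<open>x\<close> only; boundedness on compact sets
  covers the remaining range.
\<close>

lemma bigo_iff_rapidly_decaying:
  fixes G :: "real \<Rightarrow> real"
  assumes bdd: "\<And>X. \<exists>B. \<forall>x. 1 \<le> x \<longrightarrow> x \<le> X \<longrightarrow> \<bar>G x\<bar> \<le> B"
  shows "(\<forall>n::nat. G \<in> O[at_top](\<lambda>x. x / ln x ^ n)) \<longleftrightarrow> rapidly_decaying (\<lambda>u. G (exp u) * exp (- u))"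
proof
  assume bigo: "\<forall>n::nat. G \<in> O[at_top](\<lambda>x. x / ln x ^ n)"
  show "rapidly_decaying (\<lambda>u. G (exp u) * exp (- u))"
    unfolding rapidly_decaying_def
  proof
    fix n :: nat
    obtain c where c: "0 < c" "\<forall>\<^sub>F x in at_top. norm (G x) \<le> c * norm (x / ln x ^ n)"
      using bigo by (blast elim: landau_o.bigE)
    then obtain X where X: "\<And>x. X \<le> x \<Longrightarrow> norm (G x) \<le> c * norm (x / ln x ^ n)"
      by (auto simp: eventually_at_top_linorder)
    define M where "M = max 1 X"
    define U where "U = max 1 (ln M)"
    have U: "1 \<le> U" by (simp add: U_def)
    have XU: "X \<le> exp U"
    proof -
      have "exp (ln M) \<le> exp U" by (rule iffD2[OF exp_le_cancel_iff]) (simp add: U_def)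
      moreover have "exp (ln M) = M" by (rule exp_ln) (simp add: M_def)
      ultimately show ?thesis by (simp add: M_def)
    qed
    obtain B where B: "\<And>x. 1 \<le> x \<Longrightarrow> x \<le> exp U \<Longrightarrow> \<bar>G x\<bar> \<le> B" using bdd by blast
    have B0: "0 \<le> B" using B[of 1] U by (smt (verit) one_le_exp_iff)
    have "\<bar>G (exp u) * exp (- u)\<bar> \<le> (c * 2 ^ n + B * (1 + U) ^ n) / (1 + u) ^ n" if u: "0 \<le> u" for u
    proof (cases "U \<le> u")
      case True
      have "X \<le> exp u" using XU True by (meson exp_le_cancel_iff order_trans)
      then have "\<bar>G (exp u)\<bar> \<le> c * (exp u / u ^ n)" using X[of "exp u"] u by simp
      then have "\<bar>G (exp u)\<bar> * exp (- u) \<le> c * (exp u / u ^ n) * exp (- u)" by (rule mult_right_mono) simp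
      also have "\<dots> = c / u ^ n" by (simp add: exp_minus)
      also have "\<dots> \<le> c * 2 ^ n / (1 + u) ^ n"
      proof -
        have "(1 + u) ^ n \<le> (2 * u) ^ n" using True U by (intro power_mono) auto
        then have "c * (1 + u) ^ n \<le> c * (2 ^ n * u ^ n)" using c by (simp add: power_mult_distrib)
        moreover have "0 < u ^ n" "0 < (1 + u) ^ n" using True U by auto
        ultimately show ?thesis by (simp add: field_simps)
      qed
      also have "\<dots> \<le> (c * 2 ^ n + B * (1 + U) ^ n) / (1 + u) ^ n"
        using B0 U u by (intro divide_right_mono) auto
      finally show ?thesis by (simp add: abs_mult)
    next
      case False
      have "\<bar>G (exp u)\<bar> * exp (- u) \<le> B * 1"
        using B[of "exp u"] B0 u False by (intro mult_mono) auto
      also have "\<dots> \<le> B * ((1 + U) ^ n / (1 + u) ^ n)"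
      proof (intro mult_left_mono B0)
        have "(1 + u) ^ n \<le> (1 + U) ^ n" using False u by (intro power_mono) auto
        then show "1 \<le> (1 + U) ^ n / (1 + u) ^ n" using u by (simp add: field_simps)
      qed
      also have "\<dots> \<le> (c * 2 ^ n + B * (1 + U) ^ n) / (1 + u) ^ n"
        using c u by (simp add: add_divide_distrib)
      finally show ?thesis by (simp add: abs_mult)
    qed
    then show "\<exists>C. \<forall>u\<ge>0. \<bar>G (exp u) * exp (- u)\<bar> \<le> C / (1 + u) ^ n" by blast
  qed
next
  assume rapid: "rapidly_decaying (\<lambda>u. G (exp u) * exp (- u))"
  show "\<forall>n::nat. G \<in> O[at_top](\<lambda>x. x / ln x ^ n)"
  proof
    fix n :: nat
    obtain C where C: "\<And>u. 0 \<le> u \<Longrightarrow> \<bar>G (exp u) * exp (- u)\<bar> \<le> C / (1 + u) ^ n"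
      using rapid unfolding rapidly_decaying_def by blast
    have C0: "0 \<le> C" using order_trans[OF abs_ge_zero C[of 0]] by simp
    show "G \<in> O[at_top](\<lambda>x. x / ln x ^ n)"
    proof (rule bigoI)
      show "\<forall>\<^sub>F x in at_top. norm (G x) \<le> C * norm (x / ln x ^ n)"
        using eventually_gt_at_top[of 1]
      proof eventually_elim
        case (elim x)
        define u where "u = ln x"
        have u: "0 < u" "exp u = x" using elim by (auto simp: u_def)
        have "\<bar>G x\<bar> * exp (- u) \<le> C / (1 + u) ^ n" using C[of u] u by (simp add: abs_mult)
        also have "\<dots> \<le> C / u ^ n"
          using u C0 by (intro divide_left_mono power_mono mult_pos_pos zero_less_power) auto
        finally have "\<bar>G x\<bar> * exp (- u) * x \<le> C / u ^ n * x" using elim by (intro mult_right_mono) auto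
        moreover have "exp (- u) * x = 1" using u elim by (simp add: exp_minus field_simps)
        ultimately have "\<bar>G x\<bar> \<le> C / u ^ n * x" by (simp add: mult.assoc)
        then show ?case using elim by (simp add: u_def)
      qed
    qed
  qed
qed

text \<open>
  For \<open>ln u \<ge> 2 * n\<close> the derivative of \<open>2 * u / ln u ^ n\<close> is at least \<open>1 / ln u ^ n\<close>, so this function
  dominates the integral.
\<close>

lemma integral_bigo_self_over_ln_power:
  fixes h :: "real \<Rightarrow> real"
  assumes int: "\<And>x. h integrable_on {2..x}" and h: "h \<in> O[at_top](\<lambda>x. 1 / ln x ^ n)"
  shows "(\<lambda>x. integral {2..x} h) \<in> O[at_top](\<lambda>x. x / ln x ^ n)"
proof -
  obtain c where c: "0 < c" "\<forall>\<^sub>F x in at_top. norm (h x) \<le> c * norm (1 / ln x ^ n)"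
    using h by (blast elim: landau_o.bigE)
  then obtain X where X: "\<And>x. X \<le> x \<Longrightarrow> norm (h x) \<le> c * norm (1 / ln x ^ n)"
    by (auto simp: eventually_at_top_linorder)
  define X0 where "X0 = max X (max 2 (exp (2 * real n)))"
  have X0: "X \<le> X0" "2 \<le> X0" "exp (2 * real n) \<le> X0" by (auto simp: X0_def)
  define F where "F = (\<lambda>u. c * (2 * u / ln u ^ n))"
  define F' where "F' = (\<lambda>u. c * (2 / ln u ^ n - 2 * real n / ln u ^ Suc n))"
  have lnpos: "0 < ln u" "2 * real n \<le> ln u" if "X0 \<le> u" for u
  proof -
    have "exp (2 * real n) \<le> u" "1 < u" using that X0 by auto
    then show "0 < ln u" "2 * real n \<le> ln u" by (auto simp: ln_ge_iff)
  qed
  have der: "(F has_real_derivative F' u) (at u)" if "X0 \<le> u" for u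
  proof -
    have u: "0 < u" using that X0 by auto
    have "((\<lambda>u. 2 * u * inverse (ln u) ^ n) has_real_derivative
        2 * inverse (ln u) ^ n + 2 * u * (real n * inverse (ln u) ^ (n - 1) * (- (inverse (ln u) * (1 / u) * inverse (ln u))))) (at u)"
      using u lnpos[OF that] by (auto intro!: derivative_eq_intros)
    also have "2 * inverse (ln u) ^ n + 2 * u * (real n * inverse (ln u) ^ (n - 1) * (- (inverse (ln u) * (1 / u) * inverse (ln u))))
      = 2 / ln u ^ n - 2 * real n / ln u ^ Suc n"
      using u lnpos[OF that] by (cases n) (simp_all add: divide_inverse power_inverse mult_ac)
    finally have "((\<lambda>u. c * (2 * u * inverse (ln u) ^ n)) has_real_derivative F' u) (at u)"
      unfolding F'_def by (rule DERIV_cmult)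
    then show ?thesis unfolding F_def by (simp add: divide_inverse power_inverse)
  qed
  have le: "norm (h u) \<le> F' u" if "X0 \<le> u" for u
  proof -
    have "norm (h u) \<le> c * norm (1 / ln u ^ n)" using that X0 by (intro X) auto
    also have "\<dots> = c * (1 / ln u ^ n)" using lnpos[OF that] by simp
    also have "\<dots> \<le> F' u" unfolding F'_def
    proof (intro mult_left_mono)
      have "2 * real n / ln u ^ Suc n = (2 * real n / ln u) / ln u ^ n" by simp
      also have "\<dots> \<le> 1 / ln u ^ n" using lnpos[OF that] by (intro divide_right_mono) auto
      finally show "1 / ln u ^ n \<le> 2 / ln u ^ n - 2 * real n / ln u ^ Suc n" by simp
    qed (use c in simp)
    finally show ?thesis .
  qed
  have bound: "norm (integral {2..x} h) \<le> \<bar>integral {2..X0} h\<bar> + 2 * c * norm (x / ln x ^ n)" if x: "X0 \<le> x" for x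
  proof -
    have F'_int: "(F' has_integral (F x - F X0)) {X0..x}"
      using x der by (intro fundamental_theorem_of_calculus)
        (auto simp: has_real_derivative_iff_has_vector_derivative[symmetric] intro: has_field_derivative_at_within)
    have "integral {2..x} h = integral {2..X0} h + integral {X0..x} h"
      using int X0 x by (intro Henstock_Kurzweil_Integration.integral_combine[symmetric]) auto
    moreover have "norm (integral {X0..x} h) \<le> integral {X0..x} F'"
    proof (rule Henstock_Kurzweil_Integration.integral_norm_bound_integral)
      show "h integrable_on {X0..x}"
        using int[of x] by (rule integrable_on_subinterval) (use X0 in auto)
      show "F' integrable_on {X0..x}" using F'_int by blast
    qed (use le in auto)
    moreover have "integral {X0..x} F' = F x - F X0" using F'_int by (rule integral_unique)
    moreover have "0 \<le> F X0" using c X0 lnpos[of X0] by (simp add: F_def)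
    moreover have "F x = 2 * c * norm (x / ln x ^ n)" using c X0 lnpos[OF x] x by (simp add: F_def)
    ultimately show ?thesis unfolding real_norm_def by linarith
  qed
  have "(\<lambda>x. 2 * c * norm (x / ln x ^ n)) \<in> O[at_top](\<lambda>x. x / ln x ^ n)"
    by (rule bigoI[of _ "2 * c"]) (use c in \<open>simp add: abs_mult\<close>)
  then have "(\<lambda>x. \<bar>integral {2..X0} h\<bar> + 2 * c * norm (x / ln x ^ n)) \<in> O[at_top](\<lambda>x. x / ln x ^ n)"
    by (intro sum_in_bigo const_bigo_self_over_ln_power)
  moreover have "(\<lambda>x. integral {2..x} h) \<in> O[at_top](\<lambda>x. \<bar>integral {2..X0} h\<bar> + 2 * c * norm (x / ln x ^ n))"
  proof (rule bigoI[of _ 1])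
    show "\<forall>\<^sub>F x in at_top. norm (integral {2..x} h) \<le> 1 * norm (\<bar>integral {2..X0} h\<bar> + 2 * c * norm (x / ln x ^ n))"
      using eventually_ge_at_top[of X0]
    proof eventually_elim
      case (elim x)
      then show ?case using bound[OF elim] c by (simp add: add_nonneg_nonneg)
    qed
  qed
  ultimately show ?thesis by (rule landau_o.big_trans[rotated])
qed

context gen_primes
begin

definition theta :: "real \<Rightarrow> real" where "theta x = (\<Sum>k | p k \<le> x. ln (p k))"

lemma finite_primes_le: "finite {k. p k \<le> x}"
  by (rule finite_gen_primes_le[OF system])

text \<open>
  A point above \<open>1\<close>, where logarithms vanish, and not above any prime: a generalized prime may be smaller
  than \<open>2\<close>, the lower limit in \<open>Li\<close>.
\<close>

definition start :: real where "start = min 2 (p 0)"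

lemma start: "1 < start" "start \<le> 2" "start \<le> p k"
  using prime_gt_1[of 0] prime_ge_first[of k] by (auto simp: start_def)

text \<open>
  The term of \<open>p k\<close> contributes \<open>b k * (\<phi> x - \<phi> (p k))\<close>, the integral of \<open>b k * \<phi>'\<close> from \<open>p k\<close> to \<open>x\<close>.
\<close>

lemma partial_summation:
  fixes b :: "nat \<Rightarrow> real" and \<phi> \<phi>' :: "real \<Rightarrow> real"
  assumes der: "\<And>u. start \<le> u \<Longrightarrow> (\<phi> has_real_derivative \<phi>' u) (at u)"
  shows "((\<lambda>u. (\<Sum>k | p k \<le> u. b k) * \<phi>' u) has_integral
     ((\<Sum>k | p k \<le> x. b k) * \<phi> x - (\<Sum>k | p k \<le> x. b k * \<phi> (p k)))) {start..x}"
proof -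
  define A where "A = {k. p k \<le> x}"
  have A: "finite A" unfolding A_def by (rule finite_primes_le)
  have "((\<lambda>u. \<Sum>k\<in>A. b k * (if u \<in> {p k..x} then \<phi>' u else 0)) has_integral (\<Sum>k\<in>A. b k * (\<phi> x - \<phi> (p k)))) {start..x}"
  proof (intro has_integral_sum A has_integral_mult_right)
    fix k assume "k \<in> A"
    then have k: "p k \<le> x" by (simp add: A_def)
    have "(\<phi>' has_integral (\<phi> x - \<phi> (p k))) {p k..x}"
      using k der start(3)[of k] by (intro fundamental_theorem_of_calculus)
        (auto simp: has_real_derivative_iff_has_vector_derivative[symmetric] intro: has_field_derivative_at_within)
    then show "((\<lambda>u. if u \<in> {p k..x} then \<phi>' u else 0) has_integral (\<phi> x - \<phi> (p k))) {start..x}"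
      using start(3)[of k] by (subst has_integral_restrict) auto
  qed
  moreover have "(\<Sum>k\<in>A. b k * (\<phi> x - \<phi> (p k))) = (\<Sum>k | p k \<le> x. b k) * \<phi> x - (\<Sum>k | p k \<le> x. b k * \<phi> (p k))"
    by (simp add: A_def right_diff_distrib sum_subtractf sum_distrib_right)
  moreover have "(\<Sum>k\<in>A. b k * (if u \<in> {p k..x} then \<phi>' u else 0)) = (\<Sum>k | p k \<le> u. b k) * \<phi>' u"
    if "u \<in> {start..x}" for u
  proof -
    have "(\<Sum>k\<in>A. b k * (if u \<in> {p k..x} then \<phi>' u else 0)) = (\<Sum>k\<in>A. if p k \<le> u then b k * \<phi>' u else 0)"
      using that by (intro sum.cong) auto
    also have "\<dots> = (\<Sum>k\<in>{k \<in> A. p k \<le> u}. b k * \<phi>' u)"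
      using A by (simp add: sum.inter_filter)
    also have "{k \<in> A. p k \<le> u} = {k. p k \<le> u}" using that by (auto simp: A_def)
    finally show ?thesis by (simp add: sum_distrib_right)
  qed
  ultimately show ?thesis by (metis (no_types, lifting) has_integral_cong)
qed

lemma ln_pos_start: "start \<le> u \<Longrightarrow> 0 < ln u"
  using start(1) by simp

lemma theta_via_prime_count:
  "((\<lambda>u. real (gen_prime_count p u) / u) has_integral (real (gen_prime_count p x) * ln x - theta x)) {start..x}"
proof -
  have "(ln has_real_derivative 1 / u) (at u)" if "start \<le> u" for u
    using that start(1) by (auto intro!: derivative_eq_intros)
  from partial_summation[where b = "\<lambda>_. 1", OF this] show ?thesis
    by (simp add: gen_prime_count_def theta_def)
qed

lemma prime_count_via_theta:
  "((\<lambda>u. theta u / (u * (ln u)\<^sup>2)) has_integral (real (gen_prime_count p x) - theta x / ln x)) {start..x}"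
proof -
  have "((\<lambda>u. - (1 / ln u)) has_real_derivative 1 / (u * (ln u)\<^sup>2)) (at u)" if "start \<le> u" for u
    using that start(1) ln_pos_start[OF that]
    by (auto intro!: derivative_eq_intros simp: field_simps power2_eq_square)
  from partial_summation[where b = "\<lambda>k. ln (p k)", OF this]
  have "((\<lambda>u. theta u * (1 / (u * (ln u)\<^sup>2))) has_integral
      (theta x * - (1 / ln x) - (\<Sum>k | p k \<le> x. ln (p k) * - (1 / ln (p k))))) {start..x}"
    by (simp add: theta_def)
  moreover have "(\<Sum>k | p k \<le> x. ln (p k) * - (1 / ln (p k))) = - real (gen_prime_count p x)"
  proof -
    have "ln (p k) * - (1 / ln (p k)) = -1" for k using prime_gt_1[of k] by simp
    then show ?thesis by (simp add: gen_prime_count_def)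
  qed
  ultimately show ?thesis by simp
qed

end

lemma Li_has_derivative:
  assumes "2 \<le> x" "x \<le> y"
  shows "(Li has_real_derivative 1 / ln x) (at x within {2..y})"
proof -
  have "continuous_on {2..y} (\<lambda>u. 1 / ln u :: real)"
    by (intro continuous_intros) auto
  from integral_has_real_derivative[OF this, of x] assms show ?thesis
    by (simp add: Li_def[abs_def])
qed

lemma Li_log_integral:
  assumes "2 \<le> x"
  shows "((\<lambda>u. Li u / u) has_integral (Li x * ln x - (x - 2))) {2..x}"
proof -
  have "((\<lambda>u. Li u / u) has_integral ((Li x * ln x - x) - (Li 2 * ln 2 - 2))) {2..x}"
  proof (rule fundamental_theorem_of_calculus[OF assms])
    fix u assume u: "u \<in> {2..x}"
    have "((\<lambda>u. Li u * ln u - u) has_real_derivative Li u / u) (at u within {2..x})"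
      using u by (auto intro!: derivative_eq_intros Li_has_derivative simp: field_simps)
    then show "((\<lambda>u. Li u * ln u - u) has_vector_derivative Li u / u) (at u within {2..x})"
      by (simp add: has_real_derivative_iff_has_vector_derivative)
  qed
  moreover have "Li 2 = 0" by (simp add: Li_def)
  ultimately show ?thesis by (simp add: algebra_simps)
qed

lemma Li_by_parts:
  assumes "2 \<le> x"
  shows "((\<lambda>u. 1 / (ln u)\<^sup>2) has_integral (Li x - x / ln x + 2 / ln 2)) {2..x}"
proof -
  have "((\<lambda>u. 1 / (ln u)\<^sup>2) has_integral ((Li x - x / ln x) - (Li 2 - 2 / ln 2))) {2..x}"
  proof (rule fundamental_theorem_of_calculus[OF assms])
    fix u assume u: "u \<in> {2..x}"
    then have "0 < ln u" by simp
    then have "((\<lambda>u. Li u - u / ln u) has_real_derivative 1 / (ln u)\<^sup>2) (at u within {2..x})"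
      using u by (auto intro!: derivative_eq_intros Li_has_derivative simp: field_simps power2_eq_square)
    then show "((\<lambda>u. Li u - u / ln u) has_vector_derivative 1 / (ln u)\<^sup>2) (at u within {2..x})"
      by (simp add: has_real_derivative_iff_has_vector_derivative)
  qed
  moreover have "Li 2 = 0" by (simp add: Li_def)
  ultimately show ?thesis by simp
qed

context gen_primes
begin

text \<open>
  Subtract from the partial summation formula for \<open>\<theta>\<close> the corresponding identity for \<open>Li\<close>, whose
  main term is \<open>x\<close>.
\<close>

lemma theta_error_eq:
  assumes x: "2 \<le> x"
  defines "h \<equiv> \<lambda>u. (real (gen_prime_count p u) - Li u) / u"
  shows "h integrable_on {2..x}"
    and "theta x - x = (real (gen_prime_count p x) - Li x) * ln x - integral {2..x} h
          - (2 + integral {start..2} (\<lambda>u. real (gen_prime_count p u) / u))"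
proof -
  define g where "g = (\<lambda>u. real (gen_prime_count p u) / u)"
  have g: "(g has_integral (real (gen_prime_count p x) * ln x - theta x)) {start..x}"
    unfolding g_def by (rule theta_via_prime_count)
  have g2: "g integrable_on {2..x}"
    using has_integral_integrable[OF g] by (rule integrable_on_subinterval) (use start in auto)
  have comb: "integral {start..2} g + integral {2..x} g = integral {start..x} g"
    using g start x by (intro Henstock_Kurzweil_Integration.integral_combine) auto
  have h: "h = (\<lambda>u. g u - Li u / u)" by (simp add: h_def g_def diff_divide_distrib)
  have logp: "((\<lambda>u. Li u / u) has_integral (Li x * ln x - (x - 2))) {2..x}" by (rule Li_log_integral[OF x])
  show "h integrable_on {2..x}" unfolding h using g2 logp by (intro Henstock_Kurzweil_Integration.integrable_diff) auto
  have "integral {2..x} h = integral {2..x} g - integral {2..x} (\<lambda>u. Li u / u)"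
    unfolding h using g2 logp by (intro Henstock_Kurzweil_Integration.integral_diff) auto
  also have "integral {2..x} (\<lambda>u. Li u / u) = Li x * ln x - (x - 2)" using logp by (rule integral_unique)
  also have "integral {2..x} g = real (gen_prime_count p x) * ln x - theta x - integral {start..2} g"
    using comb integral_unique[OF g] by simp
  finally show "theta x - x = (real (gen_prime_count p x) - Li x) * ln x - integral {2..x} h
          - (2 + integral {start..2} (\<lambda>u. real (gen_prime_count p u) / u))"
    by (simp add: g_def left_diff_distrib)
qed

lemma prime_count_error_eq:
  assumes x: "2 \<le> x"
  defines "h \<equiv> \<lambda>u. (theta u - u) / (u * (ln u)\<^sup>2)"
  shows "h integrable_on {2..x}"
    and "real (gen_prime_count p x) - Li x = (theta x - x) / ln x + integral {2..x} h
          + (2 / ln 2 + integral {start..2} (\<lambda>u. theta u / (u * (ln u)\<^sup>2)))"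
proof -
  define g where "g = (\<lambda>u. theta u / (u * (ln u)\<^sup>2))"
  have g: "(g has_integral (real (gen_prime_count p x) - theta x / ln x)) {start..x}"
    unfolding g_def by (rule prime_count_via_theta)
  have g2: "g integrable_on {2..x}"
    using has_integral_integrable[OF g] by (rule integrable_on_subinterval) (use start in auto)
  have comb: "integral {start..2} g + integral {2..x} g = integral {start..x} g"
    using g start x by (intro Henstock_Kurzweil_Integration.integral_combine) auto
  have h: "h u = g u - 1 / (ln u)\<^sup>2" if "u \<in> {2..x}" for u
    using that by (simp add: h_def g_def diff_divide_distrib)
  have logp: "((\<lambda>u. 1 / (ln u)\<^sup>2) has_integral (Li x - x / ln x + 2 / ln 2)) {2..x}" by (rule Li_by_parts[OF x])
  have "(\<lambda>u. g u - 1 / (ln u)\<^sup>2) integrable_on {2..x}"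
    using g2 logp by (intro Henstock_Kurzweil_Integration.integrable_diff) auto
  then show "h integrable_on {2..x}"
    by (rule integrable_eq) (simp add: h)
  have "integral {2..x} h = integral {2..x} (\<lambda>u. g u - 1 / (ln u)\<^sup>2)"
    by (rule Henstock_Kurzweil_Integration.integral_cong) (rule h)
  also have "\<dots> = integral {2..x} g - integral {2..x} (\<lambda>u. 1 / (ln u)\<^sup>2)"
    using g2 logp by (intro Henstock_Kurzweil_Integration.integral_diff) auto
  also have "integral {2..x} (\<lambda>u. 1 / (ln u)\<^sup>2) = Li x - x / ln x + 2 / ln 2" using logp by (rule integral_unique)
  also have "integral {2..x} g = real (gen_prime_count p x) - theta x / ln x - integral {start..2} g"
    using comb integral_unique[OF g] by simp
  finally show "real (gen_prime_count p x) - Li x = (theta x - x) / ln x + integral {2..x} h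
          + (2 / ln 2 + integral {start..2} (\<lambda>u. theta u / (u * (ln u)\<^sup>2)))"
    by (simp add: g_def diff_divide_distrib)
qed

lemma prime_count_bigo_iff_theta_bigo:
  "(\<forall>n::nat. (\<lambda>x. real (gen_prime_count p x) - Li x) \<in> O[at_top](\<lambda>x. x / ln x ^ n))
    \<longleftrightarrow> (\<forall>n::nat. (\<lambda>x. theta x - x) \<in> O[at_top](\<lambda>x. x / ln x ^ n))"
proof (intro iffI allI)
  fix n :: nat
  define E where "E = (\<lambda>x. real (gen_prime_count p x) - Li x)"
  define h where "h = (\<lambda>u. E u / u)"
  define c where "c = 2 + integral {start..2} (\<lambda>u. real (gen_prime_count p u) / u)"
  assume "\<forall>n::nat. (\<lambda>x. real (gen_prime_count p x) - Li x) \<in> O[at_top](\<lambda>x. x / ln x ^ n)"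
  then have E: "E \<in> O[at_top](\<lambda>x. x / ln x ^ n)" "E \<in> O[at_top](\<lambda>x. x / ln x ^ Suc n)"
    unfolding E_def by blast+
  have "(\<lambda>x. E x * ln x) \<in> O[at_top](\<lambda>x. x / ln x ^ Suc n * ln x)"
    by (intro landau_o.big.mult E(2)) simp
  also have "(\<lambda>x. x / ln x ^ Suc n * ln x) \<in> \<Theta>[at_top](\<lambda>x::real. x / ln x ^ n)"
  proof (rule bigthetaI_cong)
    show "\<forall>\<^sub>F x::real in at_top. x / ln x ^ Suc n * ln x = x / ln x ^ n"
      using eventually_gt_at_top[of 1] by eventually_elim simp
  qed
  finally have 1: "(\<lambda>x. E x * ln x) \<in> O[at_top](\<lambda>x. x / ln x ^ n)" .
  have "(\<lambda>x. E x * (1 / x)) \<in> O[at_top](\<lambda>x. x / ln x ^ n * (1 / x))"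
    by (intro landau_o.big.mult E(1)) simp
  also have "(\<lambda>x. x / ln x ^ n * (1 / x)) \<in> \<Theta>[at_top](\<lambda>x::real. 1 / ln x ^ n)"
  proof (rule bigthetaI_cong)
    show "\<forall>\<^sub>F x::real in at_top. x / ln x ^ n * (1 / x) = 1 / ln x ^ n"
      using eventually_gt_at_top[of 1] by eventually_elim simp
  qed
  finally have "h \<in> O[at_top](\<lambda>x. 1 / ln x ^ n)" by (simp add: h_def)
  moreover have "h integrable_on {2..x}" for x
  proof (cases "2 \<le> x")
    case True
    then show ?thesis using theta_error_eq(1)[OF True] by (simp add: h_def E_def)
  qed (simp add: integrable_on_empty)
  ultimately have 2: "(\<lambda>x. integral {2..x} h) \<in> O[at_top](\<lambda>x. x / ln x ^ n)"
    by (intro integral_bigo_self_over_ln_power)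
  have "(\<lambda>x. E x * ln x - integral {2..x} h - c) \<in> O[at_top](\<lambda>x. x / ln x ^ n)"
    by (intro sum_in_bigo 1 2 const_bigo_self_over_ln_power)
  moreover have "\<forall>\<^sub>F x in at_top. E x * ln x - integral {2..x} h - c = theta x - x"
    using eventually_ge_at_top[of 2]
  proof eventually_elim
    case (elim x)
    show ?case using theta_error_eq(2)[OF elim] by (simp only: E_def h_def c_def)
  qed
  ultimately show "(\<lambda>x. theta x - x) \<in> O[at_top](\<lambda>x. x / ln x ^ n)"
    by (rule landau_o.big.in_cong[THEN iffD1, rotated])
next
  fix n :: nat
  define E where "E = (\<lambda>x. theta x - x)"
  define h where "h = (\<lambda>u. E u / (u * (ln u)\<^sup>2))"
  define c where "c = 2 / ln 2 + integral {start..2} (\<lambda>u. theta u / (u * (ln u)\<^sup>2))"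
  assume "\<forall>n::nat. (\<lambda>x. theta x - x) \<in> O[at_top](\<lambda>x. x / ln x ^ n)"
  then have E: "E \<in> O[at_top](\<lambda>x. x / ln x ^ n)" unfolding E_def by blast
  have "(\<lambda>x. E x * (1 / ln x)) \<in> O[at_top](\<lambda>x. x / ln x ^ n * 1)"
    by (intro landau_o.big.mult E) real_asymp
  then have 1: "(\<lambda>x. E x / ln x) \<in> O[at_top](\<lambda>x. x / ln x ^ n)" by simp
  have "(\<lambda>x. E x * (1 / (x * (ln x)\<^sup>2))) \<in> O[at_top](\<lambda>x. x / ln x ^ n * (1 / x))"
    by (intro landau_o.big.mult E) real_asymp
  also have "(\<lambda>x. x / ln x ^ n * (1 / x)) \<in> \<Theta>[at_top](\<lambda>x::real. 1 / ln x ^ n)"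
  proof (rule bigthetaI_cong)
    show "\<forall>\<^sub>F x::real in at_top. x / ln x ^ n * (1 / x) = 1 / ln x ^ n"
      using eventually_gt_at_top[of 1] by eventually_elim simp
  qed
  finally have "h \<in> O[at_top](\<lambda>x. 1 / ln x ^ n)" by (simp add: h_def)
  moreover have "h integrable_on {2..x}" for x
  proof (cases "2 \<le> x")
    case True
    then show ?thesis using prime_count_error_eq(1)[OF True] by (simp add: h_def E_def)
  qed (simp add: integrable_on_empty)
  ultimately have 2: "(\<lambda>x. integral {2..x} h) \<in> O[at_top](\<lambda>x. x / ln x ^ n)"
    by (intro integral_bigo_self_over_ln_power)
  have "(\<lambda>x. E x / ln x + integral {2..x} h + c) \<in> O[at_top](\<lambda>x. x / ln x ^ n)"
    by (intro sum_in_bigo 1 2 const_bigo_self_over_ln_power)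
  moreover have "\<forall>\<^sub>F x in at_top. E x / ln x + integral {2..x} h + c = real (gen_prime_count p x) - Li x"
    using eventually_ge_at_top[of 2]
  proof eventually_elim
    case (elim x)
    show ?case using prime_count_error_eq(2)[OF elim] by (simp only: E_def h_def c_def)
  qed
  ultimately show "(\<lambda>x. real (gen_prime_count p x) - Li x) \<in> O[at_top](\<lambda>x. x / ln x ^ n)"
    by (rule landau_o.big.in_cong[THEN iffD1, rotated])
qed

lemma theta_exp: "theta (exp u) = summatory UNIV logp logp u"
proof -
  have "p k \<le> exp u \<longleftrightarrow> logp k \<le> u" for k
    using exp_le_cancel_iff[of "logp k" u] by (simp add: exp_logp)
  then show ?thesis by (simp add: theta_def summatory_def logp_def)
qed

lemma gen_integer_count_exp: "real (gen_integer_count p (exp u)) = summatory exponents (\<lambda>_. 1) logint u"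
proof -
  have "gen_integer p m \<le> exp u \<longleftrightarrow> logint m \<le> u" for m
    using exp_le_cancel_iff[of "logint m" u] by (simp add: exp_logint)
  then show ?thesis by (simp add: gen_integer_count_def summatory_def)
qed

lemma theta_bigo_iff:
  "(\<forall>n::nat. (\<lambda>x. theta x - x) \<in> O[at_top](\<lambda>x. x / ln x ^ n)) \<longleftrightarrow> rapidly_decaying (primes.remainder 1)"
proof -
  have "\<exists>B. \<forall>x. 1 \<le> x \<longrightarrow> x \<le> X \<longrightarrow> \<bar>theta x - x\<bar> \<le> B" for X
  proof (intro exI allI impI)
    fix x assume x: "1 \<le> x" "x \<le> X"
    have nonneg: "0 \<le> ln (p k)" for k using prime_gt_1[of k] by simp
    have "0 \<le> theta x" unfolding theta_def by (intro sum_nonneg nonneg)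
    moreover have "theta x \<le> theta X"
      unfolding theta_def using x finite_primes_le by (intro sum_mono2 nonneg) auto
    ultimately show "\<bar>theta x - x\<bar> \<le> theta X + X" using x by linarith
  qed
  then have "(\<forall>n::nat. (\<lambda>x. theta x - x) \<in> O[at_top](\<lambda>x. x / ln x ^ n))
      \<longleftrightarrow> rapidly_decaying (\<lambda>u. (theta (exp u) - exp u) * exp (- u))"
    by (rule bigo_iff_rapidly_decaying)
  moreover have "(\<lambda>u. (theta (exp u) - exp u) * exp (- u)) = primes.remainder 1"
    by (simp add: fun_eq_iff primes.remainder_def theta_exp left_diff_distrib exp_add[symmetric])
  ultimately show ?thesis by simp
qed

lemma gen_integer_count_bigo_iff:
  "(\<forall>n::nat. (\<lambda>x. real (gen_integer_count p x) - a * x) \<in> O[at_top](\<lambda>x. x / ln x ^ n))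
    \<longleftrightarrow> rapidly_decaying (integers.remainder a)"
proof -
  have "\<exists>B. \<forall>x. 1 \<le> x \<longrightarrow> x \<le> X \<longrightarrow> \<bar>real (gen_integer_count p x) - a * x\<bar> \<le> B" for X
  proof (intro exI allI impI)
    fix x assume x: "1 \<le> x" "x \<le> X"
    have "gen_integer_count p x \<le> gen_integer_count p X"
      unfolding gen_integer_count_def using x finite_gen_integers_le[OF system] by (intro card_mono) auto
    moreover have "\<bar>a * x\<bar> \<le> \<bar>a\<bar> * X" using x by (simp add: abs_mult mult_left_mono)
    ultimately show "\<bar>real (gen_integer_count p x) - a * x\<bar> \<le> real (gen_integer_count p X) + \<bar>a\<bar> * X"
      by linarith
  qed
  then have "(\<forall>n::nat. (\<lambda>x. real (gen_integer_count p x) - a * x) \<in> O[at_top](\<lambda>x. x / ln x ^ n))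
      \<longleftrightarrow> rapidly_decaying (\<lambda>u. (real (gen_integer_count p (exp u)) - a * exp u) * exp (- u))"
    by (rule bigo_iff_rapidly_decaying)
  moreover have "(\<lambda>u. (real (gen_integer_count p (exp u)) - a * exp u) * exp (- u)) = integers.remainder a"
    by (simp add: fun_eq_iff integers.remainder_def gen_integer_count_exp left_diff_distrib mult.assoc exp_add[symmetric])
  ultimately show ?thesis by simp
qed

end

section \<open>The prime number theorem equivalence\<close>

theorem theorem1:
  fixes p :: "nat \<Rightarrow> real"
  assumes "gen_prime_system p"
  shows "(\<forall>n::nat. (\<lambda>x::real. real (gen_prime_count p x) - Li x) \<in> O[at_top](\<lambda>x. x / ln x ^ n))
     \<longleftrightarrow> (\<exists>a>0. \<forall>n::nat. (\<lambda>x::real. real (gen_integer_count p x) - a * x) \<in> O[at_top](\<lambda>x. x / ln x ^ n))"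
proof -
  interpret gen_primes p by unfold_locales (rule assms)
  show ?thesis
    unfolding prime_count_bigo_iff_theta_bigo theta_bigo_iff gen_integer_count_bigo_iff
  proof
    assume "rapidly_decaying (primes.remainder 1)"
    note abelian = primes.abelian[OF this]
    interpret summable_gen_primes p by unfold_locales (rule abelian(1))
    obtain C where C: "\<forall>z. 0 < Re z \<longrightarrow> norm (V z - of_real 1) \<le> C * norm z"
      using abelian(3) by blast
    have lim: "norm (V z - of_real 1) \<le> C * norm z" if "0 < Re z" "norm z < 1" for z
      using C that by blast
    obtain a C' where a: "0 < a" "\<forall>z. 0 < Re z \<longrightarrow> norm z < 1 \<longrightarrow> norm (Z z - of_real a) \<le> C' * norm z"
      using Z_slow_of_V_slow(2)[OF abelian(2) lim] by blast
    have "rapidly_decaying (integers.remainder a)"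
    proof (rule integers.tauberian[OF zeta_summable])
      show "slow Z" by (rule Z_slow_of_V_slow(1)[OF abelian(2) lim])
    qed (use a in auto)
    then show "\<exists>a>0. rapidly_decaying (integers.remainder a)" using a(1) by blast
  next
    assume "\<exists>a>0. rapidly_decaying (integers.remainder a)"
    then obtain a where a: "0 < a" "rapidly_decaying (integers.remainder a)" by blast
    note abelian = integers.abelian[OF a(2)]
    interpret summable_gen_primes p
      by unfold_locales (rule primes_summable_of_integers[OF abelian(1)])
    obtain C where C: "\<forall>z. 0 < Re z \<longrightarrow> norm (Z z - of_real a) \<le> C * norm z"
      using abelian(3) by blast
    have lim: "norm (Z z - of_real a) \<le> C * norm z" if "0 < Re z" "norm z < 1" for z
      using C that by blast
    obtain C' where C': "\<forall>z. 0 < Re z \<longrightarrow> norm z < 1 \<longrightarrow> norm (V z - of_real 1) \<le> C' * norm z"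
      using V_slow_of_Z_slow(2)[OF abelian(2) a(1) lim] by blast
    show "rapidly_decaying (primes.remainder 1)"
    proof (rule primes.tauberian[OF primes_summable])
      show "slow V" by (rule V_slow_of_Z_slow(1)[OF abelian(2) a(1) lim])
    qed (use C' in auto)
  qed
qed

end
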